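(* Let $\mathfrak{F}\subset B(\mathcal{X})$ satisfy $L_b(\mathcal{X})\subset\mathfrak{F}$ and Hypothesis $(\mathbf{H_1})$. Then the following are equivalent: (i) $\Phi$ is asymptotically stable with respect to $\mathfrak{F}$; (ii) $\Phi$ is eventually continuous with respect to $\mathfrak{F}$ on $\mathcal{X}$, and there exists $z\in\mathcal{X}$ such that $\Phi$ satisfies the lower bound condition $(\mathcal{C}_1)$ at $z$; (iii) there exists $z\in\mathcal{X}$ such that $\Phi$ is eventually continuous with respect to $\mathfrak{F}$ at $z$ and satisfies the lower bound condition $(\mathcal{C}_1)$ at $z$.
   Context: Standing setting: $(\mathcal{X},\rho)$ is a Polish space with Borel $\sigma$-algebra; $\Phi=\{\Phi_t\}_{t\ge0}$ is a càdlàg Feller Markov process on $\mathcal{X}$ (hence strong Markov), realized as a Markov family $(\Omega,\mathcal{F},\{\Phi_t\},\{\mathcal{F}_t\},\{\mathbb{P}^x\}_{x\in\mathcal{X}})$ with expectations $\mathbb{E}^x$, and transition kernels $P_t(x,\cdot)$. $B(\mathcal{X})$ denotes Borel real functions, $B_b(\mathcal X)$ the bounded ones, $L_b(\mathcal{X})$ bounded Lipschitz functions, $B(z,r)=\{y:\rho(y,z)<r\}$, $\langle f,\mu\rangle=\int f\,d\mu$. Let $\mathcal{A}=\{f\in B(\mathcal{X}):\int|f(y)|P_t(x,dy)<\infty\ \forall x\in\mathcal X,\ t\ge0\}$, and for $f\in\mathcal{A}$ set $P_tf(x)=\int f(y)P_t(x,dy)$, $Q_tf(x)=\frac1t\int_0^tP_sf(x)\,ds$,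 $Q_t(x,\cdot)=\frac1t\int_0^tP_s(x,\cdot)\,ds$. A probability measure $\mu$ is invariant if $\int P_t(x,A)\mu(dx)=\mu(A)$ for all $t,A$. Definitions: $\Phi$ is asymptotically stable with respect to $\mathfrak{F}$ if it has a unique invariant probability measure $\mu$, $\mathfrak{F}\subset L^1(\mu)$, and $\lim_{t\to\infty}|P_tf(x)-\langle f,\mu\rangle|=0$ for all $x\in\mathcal X$, $f\in\mathfrak{F}$. Lower bound condition $(\mathcal{C}_1)$ at $z$: for every $r>0$, $\inf_{x\in\mathcal{X}}\liminf_{t\to\infty}P_t(x,B(z,r))>0$. For $\mathfrak{F}\subset\mathcal{A}$, $\Phi$ is eventually continuous with respect to $\mathfrak{F}$ at $x$ if for every $f\in\mathfrak{F}$, $\limsup_{x'\to x}\limsup_{t\to\infty}|P_tf(x')-P_tf(x)|=0$; "on $\mathcal X$" means at every $x\in\mathcal X$. A family $\{\xi_t\}_{t\ge0}$ of random variables is uniformly integrable if $\lim_{K\to\infty}\sup_t\mathbb{E}(|\xi_t|\chi_{\{|\xi_t|\ge K\}})=0$. Hypothesis $(\mathbf{H_1})$: for every $f\in\mathfrak{F}$ and $x\in\mathcal{X}$, $\{f(\Phi_t)\}_{t\ge0}$ is uniformly integrable under $\mathbb{P}^x$. *)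

theory Defs
  imports "HOL-Probability.Probability"
begin

text \<open>State space: a type of class polish_space (complete separable metric space),
with its Borel sigma-algebra.  Time: real t \<ge> 0.
A Markov family is given by a measurable space M on the sample space 'w,
a filtration F t (sigma-algebras on space M), the process Phi t : 'w \<Rightarrow> 'a,
and the family of probability measures Px x.\<close>

definition trans_kernel :: "('a \<Rightarrow> 'w measure) \<Rightarrow> (real \<Rightarrow> 'w \<Rightarrow> 'a::topological_space)
    \<Rightarrow> real \<Rightarrow> 'a \<Rightarrow> 'a measure" where
  "trans_kernel Px Phi t x = distr (Px x) borel (Phi t)"

definition markov_family ::
  "'w measure \<Rightarrow> (real \<Rightarrow> 'w set set) \<Rightarrow> (real \<Rightarrow> 'w \<Rightarrow> 'a::topological_space)
     \<Rightarrow> ('a \<Rightarrow> 'w measure) \<Rightarrow> bool" where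
  "markov_family M F Phi Px \<longleftrightarrow>
     (\<forall>t\<ge>0. sigma_algebra (space M) (F t) \<and> F t \<subseteq> sets M) \<and>
     (\<forall>s t. 0 \<le> s \<and> s \<le> t \<longrightarrow> F s \<subseteq> F t) \<and>
     (\<forall>t\<ge>0. Phi t \<in> space M \<rightarrow> UNIV \<and>
              (\<forall>A\<in>sets borel. {\<omega>\<in>space M. Phi t \<omega> \<in> A} \<in> F t)) \<and>
     (\<forall>x. prob_space (Px x) \<and> sets (Px x) = sets M) \<and>
     (\<forall>A\<in>sets M. (\<lambda>x. emeasure (Px x) A) \<in> borel_measurable borel) \<and>
     (\<forall>x. AE \<omega> in Px x. Phi 0 \<omega> = x) \<and>
     (\<forall>x s t A B. 0 \<le> s \<longrightarrow> 0 \<le> t \<longrightarrow> A \<in> sets borel \<longrightarrow> B \<in> F t \<longrightarrow>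
        measure (Px x) ({\<omega>\<in>space M. Phi (t + s) \<omega> \<in> A} \<inter> B) =
        (\<integral>\<omega>. indicator B \<omega> * measure (trans_kernel Px Phi s (Phi t \<omega>)) A \<partial>Px x))"

definition cadlag_paths :: "'w measure \<Rightarrow> (real \<Rightarrow> 'w \<Rightarrow> 'a::topological_space) \<Rightarrow> bool" where
  "cadlag_paths M Phi \<longleftrightarrow>
     (\<forall>\<omega>\<in>space M. (\<forall>t\<ge>0. continuous (at_right t) (\<lambda>s. Phi s \<omega>)) \<and>
                   (\<forall>t>0. \<exists>l. ((\<lambda>s. Phi s \<omega>) \<longlongrightarrow> l) (at_left t)))"

definition feller :: "('a \<Rightarrow> 'w measure) \<Rightarrow> (real \<Rightarrow> 'w \<Rightarrow> 'a::metric_space) \<Rightarrow> bool" where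
  "feller Px Phi \<longleftrightarrow>
     (\<forall>t\<ge>0. \<forall>f::'a \<Rightarrow> real. continuous_on UNIV f \<and> bounded (range f) \<longrightarrow>
        continuous_on UNIV (\<lambda>x. \<integral>y. f y \<partial>trans_kernel Px Phi t x))"

definition cadlag_feller_markov ::
  "'w measure \<Rightarrow> (real \<Rightarrow> 'w set set) \<Rightarrow> (real \<Rightarrow> 'w \<Rightarrow> 'a::metric_space)
     \<Rightarrow> ('a \<Rightarrow> 'w measure) \<Rightarrow> bool" where
  "cadlag_feller_markov M F Phi Px \<longleftrightarrow>
     markov_family M F Phi Px \<and> cadlag_paths M Phi \<and> feller Px Phi"

definition Pf :: "('a \<Rightarrow> 'w measure) \<Rightarrow> (real \<Rightarrow> 'w \<Rightarrow> 'a::topological_space)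
    \<Rightarrow> real \<Rightarrow> ('a \<Rightarrow> real) \<Rightarrow> 'a \<Rightarrow> real" where
  "Pf Px Phi t f x = (\<integral>y. f y \<partial>trans_kernel Px Phi t x)"

definition Lb :: "('a::metric_space \<Rightarrow> real) set" where
  "Lb = {f. (\<exists>C. C-lipschitz_on UNIV f) \<and> bounded (range f)}"

definition invariant_prob :: "('a \<Rightarrow> 'w measure) \<Rightarrow> (real \<Rightarrow> 'w \<Rightarrow> 'a::topological_space)
    \<Rightarrow> 'a measure \<Rightarrow> bool" where
  "invariant_prob Px Phi \<mu> \<longleftrightarrow> prob_space \<mu> \<and> sets \<mu> = sets borel \<and>
     (\<forall>t\<ge>0. \<forall>A\<in>sets borel.
        (\<integral>x. measure (trans_kernel Px Phi t x) A \<partial>\<mu>) = measure \<mu> A)"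

definition asymptotically_stable :: "('a \<Rightarrow> 'w measure) \<Rightarrow> (real \<Rightarrow> 'w \<Rightarrow> 'a::topological_space)
    \<Rightarrow> ('a \<Rightarrow> real) set \<Rightarrow> bool" where
  "asymptotically_stable Px Phi FF \<longleftrightarrow>
     (\<exists>\<mu>. invariant_prob Px Phi \<mu> \<and> (\<forall>\<nu>. invariant_prob Px Phi \<nu> \<longrightarrow> \<nu> = \<mu>) \<and>
          (\<forall>f\<in>FF. integrable \<mu> f) \<and>
          (\<forall>x. \<forall>f\<in>FF. ((\<lambda>t. \<bar>Pf Px Phi t f x - (\<integral>y. f y \<partial>\<mu>)\<bar>) \<longlongrightarrow> 0) at_top))"

definition lower_bound_C1 :: "('a \<Rightarrow> 'w measure) \<Rightarrow> (real \<Rightarrow> 'w \<Rightarrow> 'a::metric_space)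
    \<Rightarrow> 'a \<Rightarrow> bool" where
  "lower_bound_C1 Px Phi z \<longleftrightarrow>
     (\<forall>r>0. (INF x. Liminf at_top (\<lambda>t. ereal (measure (trans_kernel Px Phi t x) (ball z r)))) > 0)"

text \<open>eventual continuity at x; the outer limsup is over x' \<rightarrow> x with x' = x allowed
  (the quantity vanishes at x' = x), so isolated points are handled correctly.\<close>
definition eventually_continuous_at :: "('a \<Rightarrow> 'w measure) \<Rightarrow> (real \<Rightarrow> 'w \<Rightarrow> 'a::topological_space)
    \<Rightarrow> ('a \<Rightarrow> real) set \<Rightarrow> 'a \<Rightarrow> bool" where
  "eventually_continuous_at Px Phi FF x \<longleftrightarrow>
     (\<forall>f\<in>FF. Limsup (nhds x) (\<lambda>x'. Limsup at_top
                 (\<lambda>t. ereal \<bar>Pf Px Phi t f x' - Pf Px Phi t f x\<bar>)) = 0)"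

definition hyp_H1 :: "('a \<Rightarrow> 'w measure) \<Rightarrow> (real \<Rightarrow> 'w \<Rightarrow> 'a)
    \<Rightarrow> ('a \<Rightarrow> real) set \<Rightarrow> bool" where
  "hyp_H1 Px Phi FF \<longleftrightarrow>
     (\<forall>f\<in>FF. \<forall>x. ((\<lambda>K::real. SUP t\<in>{0..}.
         (\<integral>\<^sup>+\<omega>. ennreal (\<bar>f (Phi t \<omega>)\<bar> * indicator {\<omega>. \<bar>f (Phi t \<omega>)\<bar> \<ge> K} \<omega>) \<partial>Px x))
        \<longlongrightarrow> 0) at_top)"

end

theory Submission
  imports Defs "HOL-Complex_Analysis.Great_Picard"
begin

text \<open>
  For \<open>f\<close> eventually continuous at \<open>z\<close>, two laws merge when tested against \<open>f\<close>: each can be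
  written as \<open>a\<close> times a law on a small ball around \<open>z\<close> plus \<open>1 - a\<close> times a remainder,
  the pieces on the ball contribute asymptotically the same amount, and iterating shrinks the remainder
  geometrically (uniform integrability controls unbounded \<open>f\<close>).  An invariant law is a weak limit
  of \<open>P\<^sub>n(z, \<cdot>)\<close>, once this family is known to be tight.  If it is not, infinitely many
  uniformly separated bumps receive mass from \<open>z\<close>; but every ball charged by the process
  contains starting points that miss some bump, since otherwise many disjoint bumps would be charged
  at one common time.  Summing suitable bumps along a nested sequence of balls gives
  a bounded Lipschitz function for which merging fails at the limit point.  Finally, a law with
  bounded density with respect to the invariant law \<open>\<mu>\<close> converges on all of \<open>L\<^sup>1(\<mu>)\<close>,
  which identifies the limit for the possibly discontinuous elements of the given class.
\<close>


section \<open>Bounded Lipschitz functions\<close>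

text \<open>Eventual continuity at \<open>z\<close> bounds \<open>T t f w - T t f z\<close> with a
  waiting time depending on \<open>w\<close>, and it does not say that \<open>T t f z\<close>
  converges. Merging therefore measures everything against the moving reference
  \<open>T t f z\<close>, and the limit is identified by a separate argument. Merging holds for one
  test function at a time, with no uniformity over test functions, so failure of tightness has to be
  contradicted by a single function. This is a gliding hump: when a bump is added, the sum of the
  earlier ones is already fixed, so a Baire argument makes its error small on a ball; the later
  bumps are made negligible by choosing them far enough out. The budget is as follows. Mass
  \<open>\<epsilon>\<close> escapes, of which a bump catches \<open>7 / 8 * \<epsilon>\<close> from
  \<open>z\<close> and at most \<open>\<epsilon> / 2\<close> from a nearby starting point; the old
  bumps cost \<open>\<epsilon> / 16\<close>. The difference exceeds \<open>\<epsilon> / 4\<close>,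
  and later bumps take away at most \<open>\<epsilon> / 8\<close>. The Feller property turns each
  such strict inequality at a fixed time into an open condition on the starting point, so that it
  survives on a smaller ball.\<close>

lemma LbI:
  fixes f :: "'a::metric_space \<Rightarrow> real"
  assumes "\<And>x y. \<bar>f x - f y\<bar> \<le> C * dist x y" and "\<And>x. \<bar>f x\<bar> \<le> B"
  shows "f \<in> Lb"
proof -
  have "(max C 0)-lipschitz_on UNIV f"
  proof (rule lipschitz_onI)
    fix x y :: 'a
    have "\<bar>f x - f y\<bar> \<le> C * dist x y" by fact
    also have "\<dots> \<le> max C 0 * dist x y" by (intro mult_right_mono) auto
    finally show "dist (f x) (f y) \<le> max C 0 * dist x y" by (simp add: dist_real_def)
  qed simp
  moreover have "bounded (range f)" using assms(2) by (auto simp: bounded_iff)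
  ultimately show ?thesis by (auto simp: Lb_def)
qed

lemma LbE:
  fixes f :: "'a::metric_space \<Rightarrow> real"
  assumes "f \<in> Lb"
  obtains C B where "0 \<le> C" "0 \<le> B" "\<And>x y. \<bar>f x - f y\<bar> \<le> C * dist x y" "\<And>x. \<bar>f x\<bar> \<le> B"
proof -
  from assms obtain C where C: "C-lipschitz_on UNIV f" and b: "bounded (range f)" by (auto simp: Lb_def)
  from b obtain B where B: "\<And>x. \<bar>f x\<bar> \<le> B" by (auto simp: bounded_iff)
  have "\<bar>f x - f y\<bar> \<le> C * dist x y" for x y
    using lipschitz_onD[OF C, of x y] by (simp add: dist_real_def)
  moreover have "0 \<le> B" using B[of undefined] by linarith
  ultimately show ?thesis using that lipschitz_on_nonneg[OF C] B by blast
qed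

lemma Lb_continuous: "f \<in> Lb \<Longrightarrow> continuous_on UNIV f"
  by (auto simp: Lb_def intro: lipschitz_on_continuous_on)

lemma Lb_bounded: "f \<in> Lb \<Longrightarrow> bounded (range f)"
  by (auto simp: Lb_def)

lemma Lb_measurable [measurable_dest]: "f \<in> Lb \<Longrightarrow> f \<in> borel_measurable borel"
  by (intro borel_measurable_continuous_onI Lb_continuous)

lemma Lb_integrable:
  assumes "f \<in> Lb" "finite_measure M" "sets M = sets borel"
  shows "integrable M f"
proof -
  interpret finite_measure M by fact
  have [measurable]: "f \<in> borel_measurable M"
    using Lb_measurable[OF assms(1)] assms(3) by (simp cong: measurable_cong_sets)
  obtain B where "\<And>x. \<bar>f x\<bar> \<le> B" using LbE[OF assms(1)] by metis
  then show ?thesis by (intro integrable_const_bound[where B=B]) auto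
qed

lemma Lb_const [simp]: "(\<lambda>_. c) \<in> Lb"
  by (rule LbI[where C=0 and B="\<bar>c\<bar>"]) auto

lemma Lb_add:
  assumes "f \<in> Lb" "g \<in> Lb" shows "(\<lambda>x. f x + g x) \<in> Lb"
proof -
  obtain C B where 1: "\<And>x y. \<bar>f x - f y\<bar> \<le> C * dist x y" "\<And>x. \<bar>f x\<bar> \<le> B"
    using LbE[OF assms(1)] by metis
  obtain C' B' where 2: "\<And>x y. \<bar>g x - g y\<bar> \<le> C' * dist x y" "\<And>x. \<bar>g x\<bar> \<le> B'"
    using LbE[OF assms(2)] by metis
  show ?thesis
  proof (rule LbI[where C="C + C'" and B="B + B'"])
    show "\<bar>f x + g x - (f y + g y)\<bar> \<le> (C + C') * dist x y" for x y
      using 1(1)[of x y] 2(1)[of x y] by (simp add: distrib_right)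
    show "\<bar>f x + g x\<bar> \<le> B + B'" for x using 1(2)[of x] 2(2)[of x] by simp
  qed
qed

lemma Lb_cmult:
  assumes "f \<in> Lb" shows "(\<lambda>x. c * f x) \<in> Lb"
proof -
  obtain C B where 1: "\<And>x y. \<bar>f x - f y\<bar> \<le> C * dist x y" "\<And>x. \<bar>f x\<bar> \<le> B"
    using LbE[OF assms(1)] by metis
  show ?thesis
  proof (rule LbI[where C="\<bar>c\<bar> * C" and B="\<bar>c\<bar> * B"])
    show "\<bar>c * f x - c * f y\<bar> \<le> \<bar>c\<bar> * C * dist x y" for x y
      using mult_left_mono[OF 1(1)[of x y], of "\<bar>c\<bar>"]
      by (simp add: abs_mult[symmetric] right_diff_distrib mult.assoc)
    show "\<bar>c * f x\<bar> \<le> \<bar>c\<bar> * B" for x using 1(2)[of x] by (simp add: abs_mult mult_left_mono)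
  qed
qed

section \<open>Lipschitz cutoffs built from distance functions\<close>

definition ramp :: "real \<Rightarrow> real \<Rightarrow> real \<Rightarrow> real" where
  "ramp a b r = max 0 (min 1 ((r - a) / (b - a)))"

lemma ramp_range: "0 \<le> ramp a b r" "ramp a b r \<le> 1"
  by (auto simp: ramp_def)

lemma ramp_eq_0: "a < b \<Longrightarrow> r \<le> a \<Longrightarrow> ramp a b r = 0"
  by (auto simp: ramp_def max_def min_def divide_simps)

lemma ramp_eq_1: "a < b \<Longrightarrow> b \<le> r \<Longrightarrow> ramp a b r = 1"
  by (auto simp: ramp_def max_def min_def divide_simps)

lemma ramp_lipschitz:
  assumes "a < b" shows "\<bar>ramp a b r - ramp a b s\<bar> \<le> \<bar>r - s\<bar> / (b - a)"
proof -
  have "\<bar>ramp a b r - ramp a b s\<bar> \<le> \<bar>(r - a) / (b - a) - (s - a) / (b - a)\<bar>"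
    by (auto simp: ramp_def max_def min_def)
  also have "\<dots> = \<bar>r - s\<bar> / (b - a)"
    using assms by (simp add: diff_divide_distrib[symmetric])
  finally show ?thesis .
qed

lemma ramp_lipschitz_comp:
  assumes "a < b" "\<And>x y. \<bar>h x - h y\<bar> \<le> dist x y"
  shows "\<bar>ramp a b (h x) - ramp a b (h y)\<bar> \<le> 1 / (b - a) * dist x y"
  using ramp_lipschitz[OF assms(1), of "h x" "h y"] assms(2)[of x y]
    divide_right_mono[OF assms(2)[of x y], of "b - a"] assms(1) by simp

lemma Lb_ramp:
  assumes "a < b" "\<And>x y. \<bar>h x - h y\<bar> \<le> dist x y"
  shows "(\<lambda>x. ramp a b (h x)) \<in> Lb"
  using ramp_range by (intro LbI[where C="1 / (b - a)" and B=1] ramp_lipschitz_comp assms) auto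

lemma Lb_one_minus_ramp:
  assumes "a < b" "\<And>x y. \<bar>h x - h y\<bar> \<le> dist x y"
  shows "(\<lambda>x. 1 - ramp a b (h x)) \<in> Lb"
  using Lb_add[OF Lb_const[of 1] Lb_cmult[OF Lb_ramp[OF assms], of "-1"]] by simp

lemma abs_dist_diff_le_dist: "\<bar>dist x z - dist y z\<bar> \<le> dist x y"
  for x y z :: "'a::metric_space"
  using dist_triangle[of x z y] dist_triangle[of y z x] by (simp add: dist_commute)

lemma ball_cutoff:
  fixes z :: "'a::metric_space"
  assumes "0 < r"
  obtains h where "h \<in> Lb" "\<And>x. 0 \<le> h x" "\<And>x. h x \<le> 1"
    "\<And>x. x \<in> ball z (r / 2) \<Longrightarrow> h x = 1" "\<And>x. x \<notin> ball z r \<Longrightarrow> h x = 0"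
proof (rule that)
  show "(\<lambda>x. 1 - ramp (r / 2) r (dist x z)) \<in> Lb"
    using assms by (intro Lb_one_minus_ramp) (auto simp: abs_dist_diff_le_dist)
qed (use assms ramp_range in \<open>auto simp: ramp_eq_0 ramp_eq_1 dist_commute\<close>)

text \<open>Closedness makes \<open>infdist x C\<close> positive off \<open>C\<close>, so the
  cutoffs converge pointwise to the indicator, dominated by 1. The distance to the empty set is 0 by
  convention, which would make the integrand constantly 1; hence
  \<open>C \<noteq> {}\<close>.\<close>

lemma integral_ramp_closed_tendsto:
  fixes M :: "'a::metric_space measure"
  assumes "finite_measure M" "sets M = sets borel" "closed C" "C \<noteq> {}"
  shows "(\<lambda>n. \<integral>x. 1 - ramp 0 (1 / real (Suc n)) (infdist x C) \<partial>M) \<longlonglongrightarrow> measure M C"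
proof -
  interpret finite_measure M by fact
  have [measurable]: "C \<in> sets M" using assms by auto
  have sp: "space M = UNIV" using sets_eq_imp_space_eq[OF assms(2)] by simp
  have "(\<lambda>n. \<integral>x. 1 - ramp 0 (1 / real (Suc n)) (infdist x C) \<partial>M) \<longlonglongrightarrow> (\<integral>x. indicator C x \<partial>M)"
  proof (rule integral_dominated_convergence[where w="\<lambda>_. 1"])
    show "AE x in M. (\<lambda>n. 1 - ramp 0 (1 / real (Suc n)) (infdist x C)) \<longlonglongrightarrow> indicator C x"
    proof (intro AE_I2)
      fix x
      show "(\<lambda>n. 1 - ramp 0 (1 / real (Suc n)) (infdist x C)) \<longlonglongrightarrow> indicator C x"
      proof (cases "x \<in> C")
        case True
        then show ?thesis by (simp add: ramp_eq_0)
      next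
        case False
        then have "infdist x C > 0" using assms by (simp add: infdist_pos_not_in_closed)
        then have "\<forall>\<^sub>F n in sequentially. 1 / real (Suc n) < infdist x C"
          using order_tendstoD(2)[OF LIMSEQ_inverse_real_of_nat, of "infdist x C"]
          by (simp add: inverse_eq_divide)
        then have "\<forall>\<^sub>F n in sequentially. 1 - ramp 0 (1 / real (Suc n)) (infdist x C) = indicator C x"
          by eventually_elim (use False in \<open>simp add: ramp_eq_1\<close>)
        then show ?thesis by (rule tendsto_eventually)
      qed
    qed
    show "(\<lambda>x. 1 - ramp 0 (1 / real (Suc n)) (infdist x C)) \<in> borel_measurable M" for n
      using Lb_measurable[OF Lb_one_minus_ramp[of 0 "1 / real (Suc n)" "\<lambda>x. infdist x C"]]
      by (simp add: infdist_triangle_abs measurable_cong_sets[OF assms(2) refl])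
  qed (use ramp_range in auto)
  then show ?thesis by (simp add: sp)
qed

text \<open>Closed sets form an intersection-stable generator of the Borel sets, and their masses
  are limits of integrals of Lipschitz cutoffs.\<close>

lemma measure_eqI_Lb:
  fixes M N :: "'a::metric_space measure"
  assumes "prob_space M" "prob_space N" "sets M = sets borel" "sets N = sets borel"
    and eq: "\<And>f. f \<in> Lb \<Longrightarrow> (\<integral>x. f x \<partial>M) = (\<integral>x. f x \<partial>N)"
  shows "M = N"
proof -
  interpret M: prob_space M by fact
  interpret N: prob_space N by fact
  show ?thesis
  proof (rule measure_eqI_generator_eq[where \<Omega>=UNIV and E="Collect closed" and A="\<lambda>_. UNIV"])
    show "Int_stable (Collect closed :: 'a set set)" by (auto simp: Int_stable_def)
    show "sets M = sigma_sets UNIV (Collect closed)" "sets N = sigma_sets UNIV (Collect closed)"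
      using assms by (auto simp: borel_eq_closed)
    fix X :: "'a set" assume X: "X \<in> Collect closed"
    show "emeasure M X = emeasure N X"
    proof (cases "X = {}")
      case False
      have "(\<lambda>n. \<integral>x. 1 - ramp 0 (1 / real (Suc n)) (infdist x X) \<partial>M) \<longlonglongrightarrow> measure M X"
        using X False assms by (intro integral_ramp_closed_tendsto) (auto intro: M.finite_measure_axioms)
      moreover have "(\<lambda>n. \<integral>x. 1 - ramp 0 (1 / real (Suc n)) (infdist x X) \<partial>N) \<longlonglongrightarrow> measure N X"
        using X False assms by (intro integral_ramp_closed_tendsto) (auto intro: N.finite_measure_axioms)
      moreover have "(\<integral>x. 1 - ramp 0 (1 / real (Suc n)) (infdist x X) \<partial>M)
          = (\<integral>x. 1 - ramp 0 (1 / real (Suc n)) (infdist x X) \<partial>N)" for n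
        by (intro eq Lb_one_minus_ramp) (auto simp: infdist_triangle_abs)
      ultimately have "measure M X = measure N X" using LIMSEQ_unique by auto
      then show ?thesis by (simp add: M.emeasure_eq_measure N.emeasure_eq_measure)
    qed simp
  qed auto
qed

text \<open>A bounded continuous function is the increasing limit of its Lipschitz regularisations
  \<open>x \<mapsto> INF y. g y + n * dist x y\<close>.\<close>

lemma continuous_Lb_approx:
  fixes g :: "'a::metric_space \<Rightarrow> real"
  assumes "continuous_on UNIV g" and B: "\<And>x. \<bar>g x\<bar> \<le> B"
  obtains G where "\<And>n. G n \<in> Lb" "\<And>n x. G n x \<le> g x" "\<And>n x. \<bar>G n x\<bar> \<le> B" "\<And>x. (\<lambda>n. G n x) \<longlonglongrightarrow> g x"
proof -
  define G where "G n x = (INF y. g y + real n * dist x y)" for n :: nat and x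
  have bdd: "bdd_below (range (\<lambda>y. g y + real n * dist x y))" for n x
  proof (rule bdd_belowI2)
    show "- B \<le> g y + real n * dist x y" for y
      using B[of y] by (smt (verit) mult_nonneg_nonneg of_nat_0_le_iff zero_le_dist)
  qed
  have up: "G n x \<le> g x" for n x
    unfolding G_def by (rule cINF_lower2[OF bdd, of x]) auto
  have lo: "- B \<le> G n x" for n x
    unfolding G_def
  proof (rule cINF_greatest)
    show "- B \<le> g y + real n * dist x y" for y
      using B[of y] by (smt (verit) mult_nonneg_nonneg of_nat_0_le_iff zero_le_dist)
  qed auto
  have lip1: "G n x \<le> G n y + real n * dist x y" for n x y
  proof -
    have "G n x - real n * dist x y \<le> G n y"
      unfolding G_def[of n y]
    proof (rule cINF_greatest)
      fix u
      have "G n x \<le> g u + real n * dist x u" unfolding G_def by (rule cINF_lower[OF bdd]) auto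
      also have "\<dots> \<le> g u + real n * (dist x y + dist y u)"
        by (intro add_left_mono mult_left_mono dist_triangle) auto
      finally show "G n x - real n * dist x y \<le> g u + real n * dist y u"
        by (simp add: distrib_left)
    qed auto
    then show ?thesis by simp
  qed
  have bd: "\<bar>G n x\<bar> \<le> B" for n x using lo[of n x] up[of n x] B[of x] by auto
  have "G n \<in> Lb" for n
  proof (rule LbI[where C="real n" and B=B])
    show "\<bar>G n x - G n y\<bar> \<le> real n * dist x y" for x y
      using lip1[of n x y] lip1[of n y x] by (simp add: dist_commute abs_le_iff)
  qed (rule bd)
  moreover have "(\<lambda>n. G n x) \<longlonglongrightarrow> g x" for x
  proof (rule LIMSEQ_I)
    fix e :: real assume "0 < e"
    obtain d where "0 < d" and d: "\<And>y. dist y x < d \<Longrightarrow> \<bar>g y - g x\<bar> < e / 2"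
      using assms(1) \<open>0 < e\<close> unfolding continuous_on_iff dist_real_def
      by (metis UNIV_I half_gt_zero)
    \<comment> \<open>From \<open>N\<close> on, moving a distance of at least \<open>d\<close> costs
      more than \<open>2 * B\<close>, the largest possible oscillation of \<open>g\<close>; only
      points closer than \<open>d\<close> to \<open>x\<close> compete for the infimum.\<close>
    obtain N :: nat where N: "2 * B / d < real N" using reals_Archimedean2 by blast
    show "\<exists>no. \<forall>n\<ge>no. norm (G n x - g x) < e"
    proof (intro exI allI impI)
      fix n assume n: "N \<le> n"
      have "g x - e / 2 \<le> G n x"
        unfolding G_def
      proof (rule cINF_greatest)
        fix y
        show "g x - e / 2 \<le> g y + real n * dist x y"
        proof (cases "dist y x < d")
          case True
          then show ?thesis using d[OF True] by (smt (verit) mult_nonneg_nonneg of_nat_0_le_iff zero_le_dist)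
        next
          case False
          have "2 * B < real N * d" using N \<open>0 < d\<close> by (simp add: divide_simps)
          also have "\<dots> \<le> real n * dist x y"
            using False n \<open>0 < d\<close> by (intro mult_mono) (auto simp: dist_commute)
          finally show ?thesis using B[of x] B[of y] \<open>0 < e\<close> by linarith
        qed
      qed auto
      then show "norm (G n x - g x) < e" using up[of n x] \<open>0 < e\<close> by simp
    qed
  qed
  ultimately show ?thesis using that up bd by blast
qed

text \<open>For an indicator, inner regularity gives a compact set of nearly full mass, and a
  Lipschitz cutoff around it approximates its indicator; sums and dominated limits do the
  rest.\<close>

lemma Lb_dense_L1:
  fixes M :: "'a::polish_space measure" and f :: "'a \<Rightarrow> real"
  assumes "finite_measure M" "sets M = sets borel" "integrable M f" "0 < e"
  shows "\<exists>g\<in>Lb. (\<integral>x. \<bar>f x - g x\<bar> \<partial>M) < e"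
  using assms(3,4)
proof (induction arbitrary: e rule: integrable_induct)
  interpret finite_measure M by fact
  case (base A c)
  have AM: "A \<in> sets M" using base by simp
  have A: "A \<in> sets borel" using AM assms by simp
  \<comment> \<open>The added 1 covers the scalar \<open>c = 0\<close>.\<close>
  define e' where "e' = e / (\<bar>c\<bar> + 1)"
  have "0 < e'" using base by (simp add: e'_def add_nonneg_pos)
  have "\<exists>K. K \<subseteq> A \<and> compact K \<and> measure M A < measure M K + e' / 2"
  \<comment> \<open>\<open>ennreal\<close> truncates negative numbers to 0, so the strict inequality
    needed below the supremum could fail for sets of small mass; for these the empty compact set
    suffices.\<close>
  proof (cases "measure M A < e' / 2")
    case True
    then show ?thesis by (intro exI[of _ "{}"]) auto
  next
    case False
    have "emeasure M A = (SUP K \<in> {K. K \<subseteq> A \<and> compact K}. emeasure M K)"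
      by (rule inner_regular[OF assms(2) _ A]) simp
    moreover have "ennreal (measure M A - e' / 2) < emeasure M A"
      using False \<open>0 < e'\<close> by (simp add: emeasure_eq_measure ennreal_less_iff)
    ultimately obtain K where "K \<subseteq> A" "compact K" "ennreal (measure M A - e' / 2) < emeasure M K"
      by (auto simp: less_SUP_iff)
    then show ?thesis
      using False by (intro exI[of _ K]) (auto simp: emeasure_eq_measure ennreal_less_iff)
  qed
  then obtain K where K: "K \<subseteq> A" "compact K" "measure M A < measure M K + e' / 2" by blast
  have cl: "closed K" using K compact_imp_closed by blast
  have [measurable]: "K \<in> sets M" "A \<in> sets M" using cl assms(2) AM by auto
  have "\<exists>g\<in>Lb. (\<integral>x. \<bar>indicator A x - g x\<bar> \<partial>M) < e'"
  proof (cases "K = {}")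
    case True
    then have "measure M A < e'" using K(3) \<open>0 < e'\<close> by simp
    then show ?thesis
      using AM by (intro bexI[of _ "\<lambda>_. 0"]) auto
  next
    case False
    define G where "G n x = 1 - ramp 0 (1 / real (Suc n)) (infdist x K)" for n x
    have "(\<lambda>n. \<integral>x. G n x \<partial>M) \<longlonglongrightarrow> measure M K"
      unfolding G_def by (intro integral_ramp_closed_tendsto assms cl False)
    then have "\<forall>\<^sub>F n in sequentially. (\<integral>x. G n x \<partial>M) < measure M K + e' / 2"
      using \<open>0 < e'\<close> by (intro order_tendstoD(2)) auto
    then obtain n where n: "(\<integral>x. G n x \<partial>M) < measure M K + e' / 2"
      by (auto simp: eventually_sequentially)
    have GL: "G n \<in> Lb"
      unfolding G_def by (intro Lb_one_minus_ramp) (auto simp: infdist_triangle_abs)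
    have Gi [simp]: "integrable M (G n)" by (rule Lb_integrable[OF GL assms(1,2)])
    have Gr: "0 \<le> G n x" "x \<in> K \<Longrightarrow> G n x = 1" for x
      using ramp_range by (auto simp: G_def ramp_eq_0)
    have [simp]: "integrable M (\<lambda>x. indicator A x :: real)" "integrable M (\<lambda>x. indicator K x :: real)"
      by (auto simp: less_top[symmetric])
    have "(\<integral>x. \<bar>indicator A x - G n x\<bar> \<partial>M)
        \<le> (\<integral>x. (indicator A x - indicator K x) + (G n x - indicator K x) \<partial>M)"
    proof (rule integral_mono)
      show "\<bar>indicator A x - G n x\<bar> \<le> (indicator A x - indicator K x) + (G n x - indicator K x)" for x
        using K(1) Gr[of x] by (auto simp: indicator_def)
    qed auto
    also have "\<dots> = (measure M A - measure M K) + ((\<integral>x. G n x \<partial>M) - measure M K)"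
      by simp
    also have "\<dots> < e'" using n K(3) by simp
    finally show ?thesis using GL by blast
  qed
  then obtain g where g: "g \<in> Lb" "(\<integral>x. \<bar>indicator A x - g x\<bar> \<partial>M) < e'" by blast
  have "(\<integral>x. \<bar>indicator A x *\<^sub>R c - c * g x\<bar> \<partial>M) = (\<integral>x. \<bar>c\<bar> * \<bar>indicator A x - g x\<bar> \<partial>M)"
    by (intro Bochner_Integration.integral_cong) (auto simp: abs_mult[symmetric] algebra_simps)
  also have "\<dots> = \<bar>c\<bar> * (\<integral>x. \<bar>indicator A x - g x\<bar> \<partial>M)" by simp
  also have "\<dots> \<le> \<bar>c\<bar> * e'" using g(2) by (intro mult_left_mono) auto
  also have "\<dots> < (\<bar>c\<bar> + 1) * e'" using \<open>0 < e'\<close> by simp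
  also have "\<dots> = e" by (simp add: e'_def add_nonneg_eq_0_iff)
  finally show ?case using Lb_cmult[OF g(1), of c] by (intro bexI[of _ "\<lambda>x. c * g x"])
next
  case (add f g)
  obtain f' where f': "f' \<in> Lb" "(\<integral>x. \<bar>f x - f' x\<bar> \<partial>M) < e / 2" using add.IH(1)[of "e / 2"] add.prems by auto
  obtain g' where g': "g' \<in> Lb" "(\<integral>x. \<bar>g x - g' x\<bar> \<partial>M) < e / 2" using add.IH(2)[of "e / 2"] add.prems by auto
  note [simp] = add.hyps Lb_integrable[OF f'(1) assms(1,2)] Lb_integrable[OF g'(1) assms(1,2)]
  have "(\<integral>x. \<bar>f x + g x - (f' x + g' x)\<bar> \<partial>M) \<le> (\<integral>x. \<bar>f x - f' x\<bar> + \<bar>g x - g' x\<bar> \<partial>M)"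
    by (intro integral_mono) auto
  also have "\<dots> < e" using f'(2) g'(2) by simp
  finally show ?case using Lb_add[OF f'(1) g'(1)] by (intro bexI[of _ "\<lambda>x. f' x + g' x"])
next
  case (lim f s)
  have "(\<lambda>n. \<integral>x. \<bar>f x - s n x\<bar> \<partial>M) \<longlonglongrightarrow> (\<integral>x. 0 \<partial>M)"
  \<comment> \<open>The approximants obey
    \<open>\<bar>s n x\<bar> \<le> 2 * \<bar>f x\<bar>\<close>, which gives the factor 3.\<close>
  proof (rule integral_dominated_convergence[where w="\<lambda>x. 3 * \<bar>f x\<bar>"])
    show "AE x in M. (\<lambda>n. \<bar>f x - s n x\<bar>) \<longlonglongrightarrow> 0"
    proof (intro AE_I2)
      fix x assume "x \<in> space M"
      from lim.hyps(2)[OF this] have "(\<lambda>n. f x - s n x) \<longlonglongrightarrow> f x - f x"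
        by (intro tendsto_intros) auto
      then show "(\<lambda>n. \<bar>f x - s n x\<bar>) \<longlonglongrightarrow> 0" by (simp add: tendsto_rabs_zero_iff)
    qed
    show "AE x in M. norm \<bar>f x - s n x\<bar> \<le> 3 * \<bar>f x\<bar>" for n
    proof (intro AE_I2)
      show "norm \<bar>f x - s n x\<bar> \<le> 3 * \<bar>f x\<bar>" if "x \<in> space M" for x
        using lim.hyps(3)[OF that, of n] by (simp add: abs_le_iff) linarith
    qed
  qed (use lim.hyps in auto)
  then have "\<forall>\<^sub>F n in sequentially. (\<integral>x. \<bar>f x - s n x\<bar> \<partial>M) < e / 2"
    using lim.prems by (intro order_tendstoD(2)) auto
  then obtain n where n: "(\<integral>x. \<bar>f x - s n x\<bar> \<partial>M) < e / 2" by (auto simp: eventually_sequentially)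
  obtain g where g: "g \<in> Lb" "(\<integral>x. \<bar>s n x - g x\<bar> \<partial>M) < e / 2" using lim.IH[of "e / 2" n] lim.prems by auto
  note [simp] = lim.hyps Lb_integrable[OF g(1) assms(1,2)]
  have "(\<integral>x. \<bar>f x - g x\<bar> \<partial>M) \<le> (\<integral>x. \<bar>f x - s n x\<bar> + \<bar>s n x - g x\<bar> \<partial>M)"
    by (intro integral_mono) auto
  also have "\<dots> < e" using n g(2) by simp
  finally show ?case using g(1) by blast
qed

section \<open>Extraction of weakly convergent subsequences\<close>

text \<open>Nested intervals in \<open>[0,1)\<close>: the word \<open>w\<close> (last letter first) is assigned an interval of
  length \<open>p w\<close>, subdivided according to the possible next letters.\<close>

primrec tree_left :: "(nat list \<Rightarrow> real) \<Rightarrow> nat list \<Rightarrow> real" where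
  "tree_left p [] = 0"
| "tree_left p (a # w) = tree_left p w + (\<Sum>b<a. p (b # w))"

definition tree_interval :: "(nat list \<Rightarrow> real) \<Rightarrow> nat list \<Rightarrow> real set" where
  "tree_interval p w = {tree_left p w..<tree_left p w + p w}"

text \<open>Reads off the address of \<open>u\<close>: the next letter is the first one at which the
  accumulated lengths of the subintervals pass \<open>u\<close>. Such a letter exists as long as
  \<open>u\<close> lies in the current interval.\<close>

primrec tree_code :: "(nat list \<Rightarrow> real) \<Rightarrow> real \<Rightarrow> nat \<Rightarrow> nat list" where
  "tree_code p u 0 = []"
| "tree_code p u (Suc k) =
    (LEAST a. u < tree_left p (tree_code p u k) + (\<Sum>b<Suc a. p (b # tree_code p u k))) # tree_code p u k"

lemma tree_interval_Cons_subset: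
  assumes "\<And>w. 0 \<le> p w" "\<And>w. (\<lambda>a. p (a # w)) sums p w"
  shows "tree_interval p (a # w) \<subseteq> tree_interval p w"
proof -
  have "(\<Sum>b<Suc a. p (b # w)) \<le> p w"
    using sum_le_suminf[of "\<lambda>a. p (a # w)" "{..<Suc a}"] assms sums_summable[OF assms(2)[of w]]
      sums_unique[OF assms(2)[of w]] by auto
  moreover have "0 \<le> (\<Sum>b<a. p (b # w))" by (intro sum_nonneg assms)
  ultimately show ?thesis by (auto simp: tree_interval_def)
qed

text \<open>The partial sums tend to \<open>p w\<close>, which strictly exceeds the offset of
  \<open>u\<close>, so the least letter exists; its minimality yields the left bound. The half-open
  form of the intervals supplies the strictness.\<close>

lemma tree_code_in_interval:
  assumes p: "\<And>w. 0 \<le> p w" "\<And>w. (\<lambda>a. p (a # w)) sums p w" "p [] = 1" and u: "u \<in> {0..<1}"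
  shows "u \<in> tree_interval p (tree_code p u k)"
proof (induction k)
  case 0
  then show ?case using u p by (simp add: tree_interval_def)
next
  case (Suc k)
  define w where "w = tree_code p u k"
  define a where "a = (LEAST a. u < tree_left p w + (\<Sum>b<Suc a. p (b # w)))"
  have u1: "tree_left p w \<le> u" and u2: "u - tree_left p w < p w"
    using Suc by (auto simp: tree_interval_def w_def)
  have "(\<lambda>n. \<Sum>b<n. p (b # w)) \<longlonglongrightarrow> p w" using p(2)[of w] by (simp add: sums_def)
  from order_tendstoD(1)[OF this u2] obtain N where N: "\<And>n. N \<le> n \<Longrightarrow> u - tree_left p w < (\<Sum>b<n. p (b # w))"
    by (auto simp: eventually_sequentially)
  have ex: "u < tree_left p w + (\<Sum>b<Suc N. p (b # w))" using N[of "Suc N"] by linarith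
  have 1: "u < tree_left p w + (\<Sum>b<Suc a. p (b # w))"
    unfolding a_def by (rule LeastI[where P="\<lambda>a. u < tree_left p w + (\<Sum>b<Suc a. p (b # w))", OF ex])
  have 2: "tree_left p w + (\<Sum>b<a. p (b # w)) \<le> u"
  proof (cases a)
    case 0
    then show ?thesis using u1 by simp
  next
    case (Suc a')
    then have "a' < a" by simp
    from not_less_Least[OF this[unfolded a_def]] show ?thesis using Suc by auto
  qed
  have "u \<in> tree_interval p (a # w)" using 1 2 by (simp add: tree_interval_def)
  then show ?case unfolding a_def w_def by (simp only: tree_code.simps)
qed

text \<open>Intervals of different words of equal length are disjoint, so the address found is the
  only possible one.\<close>

lemma tree_code_eqI:
  assumes p: "\<And>w. 0 \<le> p w" "\<And>w. (\<lambda>a. p (a # w)) sums p w"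
  shows "u \<in> tree_interval p w \<Longrightarrow> tree_code p u (length w) = w"
proof (induction w)
  case (Cons a w)
  have "u \<in> tree_interval p w" using tree_interval_Cons_subset[OF p, where a=a and w=w] Cons.prems by blast
  then have IH: "tree_code p u (length w) = w" by (rule Cons.IH)
  have u: "tree_left p w + (\<Sum>b<a. p (b # w)) \<le> u" "u < tree_left p w + (\<Sum>b<Suc a. p (b # w))"
    using Cons.prems by (auto simp: tree_interval_def)
  have "(LEAST a. u < tree_left p w + (\<Sum>b<Suc a. p (b # w))) = a"
  proof (rule Least_equality)
    show "a \<le> b" if "u < tree_left p w + (\<Sum>b<Suc b. p (b # w))" for b
    proof (rule ccontr)
      assume "\<not> a \<le> b"
      then have "(\<Sum>b<Suc b. p (b # w)) \<le> (\<Sum>b<a. p (b # w))" using p(1) by (intro sum_mono2) auto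
      then show False using that u(1) by linarith
    qed
  qed (rule u(2))
  then show ?case by (simp only: tree_code.simps IH list.size add_Suc_right add_0_right)
qed simp

lemma length_tree_code [simp]: "length (tree_code p u k) = k"
  by (induction k) auto

text \<open>Scheffe's lemma: pointwise convergence of probability weights whose limit has total mass
  1 is convergence in \<open>L1\<close>, hence convergence against every bounded function.\<close>

lemma integral_tendsto_countable:
  fixes A :: "nat \<Rightarrow> 'c::countable measure" and g :: "'c \<Rightarrow> real"
  assumes prob: "\<And>n. prob_space (A n)" "prob_space B"
    and sets: "\<And>n. sets (A n) = UNIV" "sets B = UNIV"
    and conv: "\<And>w. (\<lambda>n. measure (A n) {w}) \<longlonglongrightarrow> measure B {w}"
    and g: "\<And>w. \<bar>g w\<bar> \<le> G"
  shows "(\<lambda>n. \<integral>w. g w \<partial>A n) \<longlonglongrightarrow> (\<integral>w. g w \<partial>B)"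
proof -
  let ?C = "count_space (UNIV :: 'c set)"
  have *: "density ?C (\<lambda>w. ennreal (measure N {w})) = N" if "prob_space N" "sets N = UNIV" for N :: "'c measure"
  proof -
    interpret prob_space N by fact
    show ?thesis by (rule density_discrete) (auto simp: that emeasure_eq_measure)
  qed
  have int: "integrable ?C (\<lambda>w. measure N {w})" and nn: "(\<integral>\<^sup>+w. ennreal (measure N {w}) \<partial>?C) = 1"
    if "prob_space N" "sets N = UNIV" for N :: "'c measure"
  proof -
    interpret prob_space N by fact
    have "emeasure (density ?C (\<lambda>w. ennreal (measure N {w}))) UNIV = (\<integral>\<^sup>+w. ennreal (measure N {w}) \<partial>?C)"
      by (subst emeasure_density) auto
    also have "emeasure (density ?C (\<lambda>w. ennreal (measure N {w}))) UNIV = 1"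
      using emeasure_space_1 sets_eq_imp_space_eq[of N ?C] that by (simp add: *[OF that])
    finally show nn: "(\<integral>\<^sup>+w. ennreal (measure N {w}) \<partial>?C) = 1" by simp
    show "integrable ?C (\<lambda>w. measure N {w})"
      by (rule integrableI_bounded) (auto simp: nn)
  qed
  have G0: "0 \<le> G" using g[of undefined] by linarith
  have L1: "(\<lambda>n. \<integral>\<^sup>+ w. norm (measure (A n) {w} - measure B {w}) \<partial>?C) \<longlonglongrightarrow> 0"
    by (rule Scheffe_lemma2) (auto intro!: int prob sets conv simp: nn prob sets)
  have I: "integral\<^sup>L N g = (\<integral>w. measure N {w} * g w \<partial>?C)" if "prob_space N" "sets N = UNIV" for N
    by (subst *[OF that, symmetric], subst integral_density) auto
  have ig: "integrable ?C (\<lambda>w. measure N {w} * g w)" if "prob_space N" "sets N = UNIV" for N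
  proof (rule Bochner_Integration.integrable_bound[where f="\<lambda>w. G * measure N {w}"])
    show "AE w in ?C. norm (measure N {w} * g w) \<le> norm (G * measure N {w})"
      using g G0 by (auto simp: abs_mult mult.commute intro!: AE_I2 mult_right_mono)
  qed (use int[OF that] in auto)
  have dist: "ennreal (norm (integral\<^sup>L (A n) g - integral\<^sup>L B g))
      \<le> ennreal G * (\<integral>\<^sup>+ w. norm (measure (A n) {w} - measure B {w}) \<partial>?C)" for n
  proof -
    have "integral\<^sup>L (A n) g - integral\<^sup>L B g = (\<integral>w. (measure (A n) {w} - measure B {w}) * g w \<partial>?C)"
      by (simp add: I prob sets left_diff_distrib ig)
    also have "ennreal (norm \<dots>) \<le> (\<integral>\<^sup>+w. norm ((measure (A n) {w} - measure B {w}) * g w) \<partial>?C)"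
      by (rule integral_norm_bound_ennreal) (simp add: left_diff_distrib ig prob sets)
    also have "\<dots> \<le> (\<integral>\<^sup>+w. ennreal G * ennreal (norm (measure (A n) {w} - measure B {w})) \<partial>?C)"
      using g G0 by (intro nn_integral_mono)
        (auto simp: abs_mult mult.commute ennreal_mult[symmetric] intro!: ennreal_leI mult_right_mono)
    also have "\<dots> = ennreal G * (\<integral>\<^sup>+ w. norm (measure (A n) {w} - measure B {w}) \<partial>?C)"
      by (rule nn_integral_cmult) auto
    finally show ?thesis .
  qed
  have up: "(\<lambda>n. ennreal G * (\<integral>\<^sup>+ w. norm (measure (A n) {w} - measure B {w}) \<partial>?C)) \<longlonglongrightarrow> 0"
    using ennreal_tendsto_cmult[OF _ L1, of "ennreal G"] by simp
  have "(\<lambda>n. ennreal (norm (integral\<^sup>L (A n) g - integral\<^sup>L B g))) \<longlonglongrightarrow> 0"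
    by (rule tendsto_sandwich[OF _ _ tendsto_const up]) (use dist in \<open>auto intro!: always_eventually\<close>)
  then have "(\<lambda>n. norm (integral\<^sup>L (A n) g - integral\<^sup>L B g)) \<longlonglongrightarrow> 0"
    by (simp add: tendsto_ennreal_iff[where x=0, simplified] del: ennreal_eq_0_iff flip: ennreal_0)
  then show ?thesis by (rule LIM_zero_cancel[OF tendsto_norm_zero_cancel])
qed

text \<open>The compactness half of Prokhorov's theorem, by a Skorokhod-type construction. Each
  point is coded by the indices of nearby centres at scales \<open>(1 / 2) ^ k\<close>. Along a
  subsequence all masses of the code cells converge; tightness keeps the limit weights additive in
  the tree. The tree is then realised by nested intervals, and the coded centres converge to a
  random point whose law is the weak limit.\<close>

lemma tight_imp_weakly_convergent_subseq:
  fixes Q :: "nat \<Rightarrow> 'a::polish_space measure" and d :: "nat \<Rightarrow> 'a"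
  assumes prob: "\<And>n. prob_space (Q n)" and sets: "\<And>n. sets (Q n) = sets borel"
    and tight: "\<And>\<delta> \<epsilon>. 0 < \<delta> \<Longrightarrow> 0 < \<epsilon> \<Longrightarrow> \<exists>I. \<forall>n. 1 - \<epsilon> \<le> measure (Q n) (\<Union>i<I. ball (d i) \<delta>)"
    and dense: "\<And>x \<delta>. 0 < \<delta> \<Longrightarrow> \<exists>i. dist x (d i) < \<delta>"
  obtains r \<mu> where "strict_mono (r :: nat \<Rightarrow> nat)" "prob_space \<mu>" "sets \<mu> = sets borel"
    "\<And>f. f \<in> Lb \<Longrightarrow> (\<lambda>n. \<integral>x. f x \<partial>Q (r n)) \<longlonglongrightarrow> (\<integral>x. f x \<partial>\<mu>)"
proof -
  interpret Q: prob_space "Q n" for n by (rule prob)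
  have [measurable_cong]: "sets (Q n) = sets borel" for n by (rule sets)
  have spQ: "space (Q n) = UNIV" for n using sets_eq_imp_space_eq[OF sets[of n]] by simp
  define i where "i k x = (LEAST i. dist x (d i) < (1 / 2) ^ k)" for k x
  \<comment> \<open>The code is reversed so that its latest letter comes first: refining the scale
    is then a \<open>Cons\<close>, as for the words of the tree.\<close>
  define c where "c k x = rev (map (\<lambda>k. i k x) [0..<k])" for k x
  have i_dist: "dist x (d (i k x)) < (1 / 2) ^ k" for k x
  proof -
    obtain j where "dist x (d j) < (1 / 2) ^ k" using dense[of "(1 / 2) ^ k" x] by auto
    then show ?thesis unfolding i_def by (rule LeastI)
  qed
  have i_le: "i k x \<le> j" if "dist x (d j) < (1 / 2) ^ k" for k x j
    unfolding i_def using that by (rule Least_le)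
  have c0: "c 0 x = []" and cSuc: "c (Suc k) x = i k x # c k x" for k x
    by (auto simp: c_def)
  have len_c [simp]: "length (c k x) = k" for k x by (simp add: c_def)
  have i_meas [measurable]: "i k \<in> measurable borel (count_space UNIV)" for k
    unfolding i_def by measurable
  define Cell where "Cell w = {x. c (length w) x = w}" for w
  have Cell_Cons: "Cell (a # w) = {x \<in> Cell w. i (length w) x = a}" for a w
    by (auto simp: Cell_def cSuc)
  have Cell_borel [measurable]: "Cell w \<in> sets borel" for w
  proof (induction w)
    case Nil
    then show ?case by (simp add: Cell_def c0)
  next
    case (Cons a w)
    have "Cell (a # w) = Cell w \<inter> (i (length w) -` {a} \<inter> space borel)" by (auto simp: Cell_Cons)
    also have "\<dots> \<in> sets borel" using Cons by (intro sets.Int measurable_sets[OF i_meas]) auto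
    finally show ?case .
  qed
  define q where "q n w = measure (Q n) (Cell w)" for n w
  \<comment> \<open>Diagonal extraction over the countably many words; the masses lie in
    \<open>[0,1]\<close>.\<close>
  obtain r where r: "strict_mono (r :: nat \<Rightarrow> nat)"
    and "\<And>w. w \<in> (UNIV :: nat list set) \<Longrightarrow> \<exists>l. (\<lambda>n. q (r n) w) \<longlonglongrightarrow> l"
    by (rule function_convergent_subsequence[of "UNIV :: nat list set" q 1]) (auto simp: q_def)
  then have "\<forall>w. \<exists>l. (\<lambda>n. q (r n) w) \<longlonglongrightarrow> l" by blast
  then obtain p where p: "\<And>w. (\<lambda>n. q (r n) w) \<longlonglongrightarrow> p w" by metis
  have p0: "0 \<le> p w" for w
    using p[of w] by (rule LIMSEQ_le_const) (auto simp: q_def)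
  have p1: "p [] = 1"
  proof -
    have "q n [] = 1" for n using Q.prob_space[of n] by (simp add: q_def Cell_def c0 spQ)
    then show ?thesis using LIMSEQ_unique[OF p[of "[]"], of 1] by simp
  qed
  have part: "(\<Sum>a<I. q n (a # w)) = measure (Q n) {x \<in> Cell w. i (length w) x < I}" for I n w
  proof (induction I)
    case (Suc I)
    have "{x \<in> Cell w. i (length w) x < Suc I} = {x \<in> Cell w. i (length w) x < I} \<union> Cell (I # w)"
      by (auto simp: Cell_Cons)
    moreover have "measure (Q n) ({x \<in> Cell w. i (length w) x < I} \<union> Cell (I # w))
        = measure (Q n) {x \<in> Cell w. i (length w) x < I} + measure (Q n) (Cell (I # w))"
      by (rule Q.finite_measure_Union) (auto simp: Cell_Cons)
    ultimately show ?case using Suc by (simp add: q_def)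
  qed simp
  \<comment> \<open>Here tightness enters. At scale \<open>(1 / 2) ^ length w\<close>, the first
    \<open>I\<close> balls miss mass at most \<open>e / 2\<close> uniformly in \<open>n\<close>, and
    points in them have next letter below \<open>I\<close>; so no mass is lost to large letters in
    the limit.\<close>
  have psums: "(\<lambda>a. p (a # w)) sums p w" for w
    unfolding sums_def
  proof (rule LIMSEQ_I)
    fix e :: real assume "0 < e"
    obtain I where I: "\<And>n. 1 - e / 2 \<le> measure (Q n) (\<Union>i<I. ball (d i) ((1 / 2) ^ length w))"
      using tight[of "(1 / 2) ^ length w" "e / 2"] \<open>0 < e\<close> by auto
    have "p w - e / 2 \<le> (\<Sum>a<J. p (a # w)) \<and> (\<Sum>a<J. p (a # w)) \<le> p w" if "I \<le> J" for J
    proof -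
      have up: "(\<Sum>a<J. q n (a # w)) \<le> q n w" for n
        unfolding part unfolding q_def by (intro Q.finite_measure_mono) auto
      have lo: "q n w - e / 2 \<le> (\<Sum>a<J. q n (a # w))" for n
      proof -
        have "Cell w \<subseteq> {x \<in> Cell w. i (length w) x < J} \<union> (space (Q n) - (\<Union>i<I. ball (d i) ((1 / 2) ^ length w)))"
          using i_le that by (force simp: spQ dist_commute)
        then have "q n w \<le> measure (Q n) ({x \<in> Cell w. i (length w) x < J} \<union> (space (Q n) - (\<Union>i<I. ball (d i) ((1 / 2) ^ length w))))"
          unfolding q_def by (rule Q.finite_measure_mono) measurable
        also have "\<dots> \<le> measure (Q n) {x \<in> Cell w. i (length w) x < J}
            + measure (Q n) (space (Q n) - (\<Union>i<I. ball (d i) ((1 / 2) ^ length w)))"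
          by (rule measure_Un_le) measurable
        also have "measure (Q n) (space (Q n) - (\<Union>i<I. ball (d i) ((1 / 2) ^ length w)))
            = 1 - measure (Q n) (\<Union>i<I. ball (d i) ((1 / 2) ^ length w))"
          by (rule Q.prob_compl) measurable
        finally show ?thesis using I[of n] unfolding part by linarith
      qed
      have lim: "(\<lambda>n. \<Sum>a<J. q (r n) (a # w)) \<longlonglongrightarrow> (\<Sum>a<J. p (a # w))"
        by (intro tendsto_sum p)
      have "p w - e / 2 \<le> (\<Sum>a<J. p (a # w))"
        by (rule LIMSEQ_le[OF tendsto_diff[OF p tendsto_const] lim]) (use lo in auto)
      moreover have "(\<Sum>a<J. p (a # w)) \<le> p w"
        by (rule LIMSEQ_le[OF lim p]) (use up in auto)
      ultimately show ?thesis by simp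
    qed
    then show "\<exists>no. \<forall>J\<ge>no. norm ((\<Sum>a<J. p (a # w)) - p w) < e"
      using \<open>0 < e\<close> by (intro exI[of _ I]) force
  qed
  \<comment> \<open>Under the uniform law on \<open>[0,1)\<close>, the word \<open>w\<close> is read
    with probability equal to the length \<open>p w\<close> of its interval.\<close>
  define U where "U = restrict_space lborel {0..<1::real}"
  have spU: "space U = {0..<1}" by (simp add: U_def space_restrict_space)
  interpret U: prob_space U
    by (rule prob_spaceI) (simp add: spU, simp add: U_def emeasure_restrict_space)
  let ?W = "\<lambda>k u. tree_code p u k"
  have W_iff: "{u \<in> space U. ?W k u = w} = (if length w = k then tree_interval p w else {})" for k w
  proof -
    have sub: "tree_interval p w \<subseteq> {0..<1}" for w
    proof (induction w)
      case (Cons a w)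
      then show ?case using tree_interval_Cons_subset[OF p0 psums, of a w] by blast
    qed (simp add: tree_interval_def p1)
    have "u \<in> tree_interval p w" if "u \<in> space U" "?W k u = w" for u
      using tree_code_in_interval[OF p0 psums p1, of u k] that by (simp add: spU)
    moreover have "u \<in> space U \<and> ?W k u = w" if "u \<in> tree_interval p w" "length w = k" for u
      using tree_code_eqI[OF p0 psums that(1)] sub[of w] that by (auto simp: spU)
    ultimately show ?thesis by auto
  qed
  have W_sets: "{u \<in> space U. ?W k u = w} \<in> sets U" for k w
  proof -
    have "{u \<in> space U. ?W k u = w} \<in> sets borel" unfolding W_iff by (auto simp: tree_interval_def)
    moreover have "{u \<in> space U. ?W k u = w} \<subseteq> {0..<1}" by (auto simp: spU)
    ultimately show ?thesis by (auto simp: U_def sets_restrict_space_iff)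
  qed
  have W_meas [measurable]: "?W k \<in> measurable U (count_space UNIV)" for k
    unfolding measurable_count_space_eq2_countable
    using W_sets[of k] by (auto simp: vimage_def Int_def conj_commute)
  have W_prob: "measure U {u \<in> space U. ?W k u = w} = (if length w = k then p w else 0)" for k w
  proof -
    have "measure U {u \<in> space U. ?W k u = w} = measure lborel {u \<in> space U. ?W k u = w}"
      unfolding U_def by (rule measure_restrict_space) (auto simp: space_restrict_space)
    then show ?thesis unfolding W_iff using p0[of w] by (simp add: tree_interval_def)
  qed
  \<comment> \<open>The head of the word of length \<open>Suc k\<close> is the letter belonging to
    scale \<open>(1 / 2) ^ k\<close>.\<close>
  define Y where "Y k u = d (hd (?W (Suc k) u))" for k u
  have Y_meas [measurable]: "Y k \<in> borel_measurable U" for k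
    unfolding Y_def by (rule measurable_compose[OF W_meas]) simp
  \<comment> \<open>A word that is actually read has positive weight, so its cell cannot be empty;
    any point of the cell is close to the centres of both scales.\<close>
  have Y_near: "dist (Y k u) (Y (Suc k) u) < 2 * (1 / 2) ^ k" if "u \<in> space U" for k u
  proof -
    define w where "w = ?W (Suc (Suc k)) u"
    have "u \<in> tree_interval p w"
      unfolding w_def using that by (intro tree_code_in_interval p0 psums p1) (auto simp: spU)
    then have "0 < p w" by (auto simp: tree_interval_def)
    have "Cell w \<noteq> {}"
    proof
      assume "Cell w = {}"
      then have "q n w = 0" for n by (simp add: q_def)
      then show False using \<open>0 < p w\<close> LIMSEQ_unique[OF p[of w], of 0] by simp
    qed
    then obtain x where x: "c (Suc (Suc k)) x = w" by (auto simp: Cell_def w_def)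
    have "hd w = i (Suc k) x" using x[symmetric] by (simp add: cSuc)
    then have 1: "Y (Suc k) u = d (i (Suc k) x)" by (simp add: Y_def w_def)
    have "hd (tl w) = i k x" using x[symmetric] by (simp add: cSuc)
    moreover have "tl w = ?W (Suc k) u" unfolding w_def tree_code.simps(2)[of p u "Suc k"] by (rule list.sel)
    ultimately have 2: "Y k u = d (i k x)" by (simp add: Y_def)
    have "dist (Y k u) (Y (Suc k) u) \<le> dist x (d (i k x)) + dist x (d (i (Suc k) x))"
      unfolding 1 2 by (metis dist_commute dist_triangle)
    also have "\<dots> < (1 / 2) ^ k + (1 / 2) ^ Suc k" using i_dist[of x k] i_dist[of x "Suc k"] by simp
    also have "\<dots> \<le> 2 * (1 / 2) ^ k" by simp
    finally show ?thesis .
  qed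
  have Y_Cauchy: "Cauchy (\<lambda>k. Y k u)" if u: "u \<in> space U" for u
  proof -
    have far: "dist (Y k u) (Y (k + j) u) \<le> 4 * (1 / 2) ^ k" for k j
    proof -
      have "dist (Y k u) (Y (k + j) u) \<le> (\<Sum>l<j. 2 * (1 / 2) ^ (k + l))"
      proof (induction j)
        case (Suc j)
        have "dist (Y k u) (Y (k + Suc j) u) \<le> dist (Y k u) (Y (k + j) u) + dist (Y (k + j) u) (Y (Suc (k + j)) u)"
          using dist_triangle by simp
        then show ?case using Suc Y_near[OF u, of "k + j"] by simp
      qed simp
      also have "\<dots> = 2 * (1 / 2) ^ k * (\<Sum>l<j. (1 / 2) ^ l)"
        by (simp add: power_add sum_distrib_left mult.assoc)
      also have "\<dots> \<le> 2 * (1 / 2) ^ k * 2"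
        by (intro mult_left_mono) (simp_all add: geometric_sum)
      finally show ?thesis by simp
    qed
    show ?thesis
    proof (rule metric_CauchyI)
      fix e :: real assume "0 < e"
      have "(\<lambda>k. 4 * (1 / 2) ^ k :: real) \<longlonglongrightarrow> 4 * 0"
        by (intro tendsto_mult tendsto_const LIMSEQ_realpow_zero) auto
      from order_tendstoD(2)[OF this, of "e / 2"]
      have "\<forall>\<^sub>F k in sequentially. (4 * (1 / 2) ^ k :: real) < e / 2" using \<open>0 < e\<close> by simp
      then obtain N where N: "(4 * (1 / 2) ^ N :: real) < e / 2" by (auto simp: eventually_sequentially)
      have "dist (Y N u) (Y m u) < e / 2" if "N \<le> m" for m
        using far[of N "m - N"] N that by simp
      then show "\<exists>M. \<forall>m\<ge>M. \<forall>n\<ge>M. dist (Y m u) (Y n u) < e"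
        by (intro exI[of _ N]) (metis dist_commute dist_triangle_half_l)
    qed
  qed
  define Yl where "Yl u = lim (\<lambda>k. Y k u)" for u
  have Yl: "(\<lambda>k. Y k u) \<longlonglongrightarrow> Yl u" if "u \<in> space U" for u
    unfolding Yl_def using Y_Cauchy[OF that] by (simp add: Cauchy_convergent_iff convergent_LIMSEQ_iff)
  have Yl_meas [measurable]: "Yl \<in> borel_measurable U"
    by (rule borel_measurable_LIMSEQ_metric[OF Y_meas Yl])
  define \<mu> where "\<mu> = distr U borel Yl"
  have c_meas [measurable]: "c k \<in> measurable borel (count_space UNIV)" for k
    unfolding measurable_count_space_eq2_countable
  proof (intro conjI ballI)
    fix w :: "nat list"
    have "c k -` {w} \<inter> space borel = (if length w = k then Cell w else {})"
      by (auto simp: Cell_def)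
    then show "c k -` {w} \<inter> space borel \<in> sets borel" by simp
  qed simp_all
  \<comment> \<open>For fixed \<open>k\<close> both sides are integrals over the countable set of
    words, where convergence of the atoms is enough.\<close>
  have level: "(\<lambda>n. \<integral>x. g (c k x) \<partial>Q (r n)) \<longlonglongrightarrow> (\<integral>u. g (?W k u) \<partial>U)"
    if g: "\<And>w. \<bar>g w\<bar> \<le> G" for k and g :: "nat list \<Rightarrow> real" and G
  proof -
    have "(\<lambda>n. \<integral>w. g w \<partial>distr (Q (r n)) (count_space UNIV) (c k)) \<longlonglongrightarrow> (\<integral>w. g w \<partial>distr U (count_space UNIV) (?W k))"
    proof (rule integral_tendsto_countable[OF _ _ _ _ _ g])
      show "prob_space (distr (Q (r n)) (count_space UNIV) (c k))" for n
        by (rule Q.prob_space_distr) simp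
      show "prob_space (distr U (count_space UNIV) (?W k))"
        by (rule U.prob_space_distr) simp
      fix w :: "nat list"
      have "measure (distr (Q n) (count_space UNIV) (c k)) {w} = (if length w = k then q n w else 0)" for n
      proof -
        have "c k -` {w} \<inter> space (Q n) = (if length w = k then Cell w else {})"
          by (auto simp: Cell_def spQ)
        then show ?thesis by (subst measure_distr) (auto simp: q_def)
      qed
      moreover have "measure (distr U (count_space UNIV) (?W k)) {w} = (if length w = k then p w else 0)"
        using W_prob[of k w] by (subst measure_distr) (auto simp: vimage_def Int_def conj_commute)
      ultimately show "(\<lambda>n. measure (distr (Q (r n)) (count_space UNIV) (c k)) {w})
          \<longlonglongrightarrow> measure (distr U (count_space UNIV) (?W k)) {w}"
        using p[of w] by simp
    qed simp_all
    then show ?thesis by (simp add: integral_distr)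
  qed
  show ?thesis
  proof (rule that[OF r])
    show "prob_space \<mu>" unfolding \<mu>_def by (rule U.prob_space_distr) simp
    show "sets \<mu> = sets borel" by (simp add: \<mu>_def)
    fix f :: "'a \<Rightarrow> real" assume f: "f \<in> Lb"
    then obtain C B where C: "0 \<le> C" "\<And>x y. \<bar>f x - f y\<bar> \<le> C * dist x y" and B: "\<And>x. \<bar>f x\<bar> \<le> B"
      using LbE by metis
    note [measurable] = Lb_measurable[OF f]
    have cont: "isCont f x" for x
      using Lb_continuous[OF f] by (simp add: continuous_on_eq_continuous_at)
    have YE: "(\<lambda>k. \<integral>u. f (Y k u) \<partial>U) \<longlonglongrightarrow> (\<integral>u. f (Yl u) \<partial>U)"
      by (rule integral_dominated_convergence[where w="\<lambda>_. B"])
        (auto intro!: AE_I2 B isCont_tendsto_compose[OF cont] Yl)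
    \<comment> \<open>The discretisation error does not depend on \<open>n\<close>, so the limits in
      \<open>n\<close> and \<open>k\<close> may be combined.\<close>
    have approx: "\<bar>(\<integral>x. f x \<partial>Q n) - (\<integral>x. f (d (i k x)) \<partial>Q n)\<bar> \<le> C * (1 / 2) ^ k" for n k
    proof -
      have [simp]: "integrable (Q n) (\<lambda>x. f (d (i k x)))" "integrable (Q n) f"
        using B by (auto intro!: Q.integrable_const_bound[where B=B])
      have "(\<integral>x. f x \<partial>Q n) - (\<integral>x. f (d (i k x)) \<partial>Q n) = (\<integral>x. f x - f (d (i k x)) \<partial>Q n)" by simp
      also have "\<bar>\<dots>\<bar> \<le> (\<integral>x. \<bar>f x - f (d (i k x))\<bar> \<partial>Q n)" by (rule integral_abs_bound)
      also have "\<dots> \<le> (\<integral>x. C * (1 / 2) ^ k \<partial>Q n)"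
      proof (rule integral_mono)
        show "\<bar>f x - f (d (i k x))\<bar> \<le> C * (1 / 2) ^ k" for x
          using C(2)[of x "d (i k x)"] mult_left_mono[OF less_imp_le[OF i_dist[of x k]] C(1)] by linarith
      qed auto
      finally show ?thesis using Q.prob_space by simp
    qed
    have lev: "(\<lambda>n. \<integral>x. f (d (i k x)) \<partial>Q (r n)) \<longlonglongrightarrow> (\<integral>u. f (Y k u) \<partial>U)" for k
      using level[of "\<lambda>w. f (d (hd w))" B "Suc k"] B by (simp add: cSuc Y_def)
    have "(\<lambda>n. \<integral>x. f x \<partial>Q (r n)) \<longlonglongrightarrow> (\<integral>u. f (Yl u) \<partial>U)"
    proof (rule LIMSEQ_I)
      fix e :: real assume "0 < e"
      have "(\<lambda>k. C * (1 / 2) ^ k) \<longlonglongrightarrow> C * 0"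
        by (intro tendsto_mult tendsto_const LIMSEQ_realpow_zero) auto
      from order_tendstoD(2)[OF this, of "e / 3"]
      have "\<forall>\<^sub>F k in sequentially. C * (1 / 2) ^ k < e / 3" using \<open>0 < e\<close> by simp
      moreover have "\<forall>\<^sub>F k in sequentially. dist (\<integral>u. f (Y k u) \<partial>U) (\<integral>u. f (Yl u) \<partial>U) < e / 3"
        using \<open>0 < e\<close> by (intro tendstoD[OF YE]) auto
      ultimately have "\<forall>\<^sub>F k in sequentially. C * (1 / 2) ^ k < e / 3 \<and> dist (\<integral>u. f (Y k u) \<partial>U) (\<integral>u. f (Yl u) \<partial>U) < e / 3"
        by (rule eventually_conj)
      then obtain k where k: "C * (1 / 2) ^ k < e / 3" "dist (\<integral>u. f (Y k u) \<partial>U) (\<integral>u. f (Yl u) \<partial>U) < e / 3"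
        by (auto simp: eventually_sequentially)
      obtain N where N: "\<And>n. N \<le> n \<Longrightarrow> \<bar>(\<integral>x. f (d (i k x)) \<partial>Q (r n)) - (\<integral>u. f (Y k u) \<partial>U)\<bar> < e / 3"
        using LIMSEQ_D[OF lev[of k], of "e / 3"] \<open>0 < e\<close> by auto
      show "\<exists>N. \<forall>n\<ge>N. norm ((\<integral>x. f x \<partial>Q (r n)) - (\<integral>u. f (Yl u) \<partial>U)) < e"
      proof (intro exI allI impI)
        fix n assume "N \<le> n"
        from N[OF this] k approx[of "r n" k]
        show "norm ((\<integral>x. f x \<partial>Q (r n)) - (\<integral>u. f (Yl u) \<partial>U)) < e"
          unfolding dist_real_def real_norm_def by linarith
      qed
    qed
    then show "(\<lambda>n. \<integral>x. f x \<partial>Q (r n)) \<longlonglongrightarrow> (\<integral>x. f x \<partial>\<mu>)"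
      unfolding \<mu>_def by (simp add: integral_distr)
  qed
qed

section \<open>Feller semigroups of Markov kernels\<close>

abbreviation borel_probs :: "'a::topological_space measure set" where
  "borel_probs \<equiv> space (prob_algebra borel)"

lemma borel_probsD:
  assumes "\<nu> \<in> borel_probs"
  shows "prob_space \<nu>" "sets \<nu> = sets borel" "space \<nu> = UNIV" "finite_measure \<nu>"
proof -
  show 1: "prob_space \<nu>" "sets \<nu> = sets borel" using assms by (auto simp: space_prob_algebra)
  show "space \<nu> = UNIV" using sets_eq_imp_space_eq[OF 1(2)] by simp
  show "finite_measure \<nu>" using 1(1) by (simp add: prob_space_def)
qed

text \<open>The kernels are measurable maps into \<open>prob_algebra borel\<close>, so the
  Chapman-Kolmogorov equation is a statement about the Giry \<open>bind\<close> and its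
  associativity becomes available.\<close>

locale feller_semigroup =
  fixes P :: "real \<Rightarrow> 'a::polish_space \<Rightarrow> 'a measure"
  assumes kernel: "0 \<le> t \<Longrightarrow> P t \<in> borel \<rightarrow>\<^sub>M prob_algebra borel"
    and chapman_kolmogorov: "0 \<le> s \<Longrightarrow> 0 \<le> t \<Longrightarrow> P (s + t) x = P s x \<bind> P t"
    and feller: "0 \<le> t \<Longrightarrow> continuous_on UNIV f \<Longrightarrow> bounded (range f) \<Longrightarrow>
      continuous_on UNIV (\<lambda>x. \<integral>y. f y \<partial>P t x :: real)"
begin

definition T :: "real \<Rightarrow> ('a \<Rightarrow> real) \<Rightarrow> 'a \<Rightarrow> real" where
  "T t f x = (\<integral>y. f y \<partial>P t x)"

text \<open>The law at time \<open>t\<close> when the initial law is \<open>\<nu>\<close>. Merging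
  is proved for initial laws rather than points because the remainder left after splitting off mass
  on a ball is again such a law.\<close>

definition push :: "'a measure \<Rightarrow> real \<Rightarrow> 'a measure" where
  "push \<nu> t = \<nu> \<bind> P t"

lemma P_prob: "0 \<le> t \<Longrightarrow> P t x \<in> borel_probs"
  by (rule measurable_space[OF kernel]) auto

lemma kernel': "0 \<le> t \<Longrightarrow> P t \<in> borel \<rightarrow>\<^sub>M subprob_algebra borel"
  by (intro measurable_prob_algebraD kernel)

lemma kernel_on: "0 \<le> t \<Longrightarrow> \<nu> \<in> borel_probs \<Longrightarrow> P t \<in> \<nu> \<rightarrow>\<^sub>M subprob_algebra borel"
  by (subst measurable_cong_sets[OF borel_probsD(2) refl]) (simp_all only: kernel')

lemma push_prob: "\<nu> \<in> borel_probs \<Longrightarrow> 0 \<le> t \<Longrightarrow> push \<nu> t \<in> borel_probs"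
  unfolding push_def using prob_space_bind'[OF _ kernel] sets_bind'[OF _ kernel]
  by (auto simp: space_prob_algebra)

lemma push_push:
  assumes "\<nu> \<in> borel_probs" "0 \<le> s" "0 \<le> t"
  shows "push (push \<nu> s) t = push \<nu> (s + t)"
proof -
  have "P (s + t) = (\<lambda>x. P s x \<bind> P t)" using chapman_kolmogorov assms by auto
  then show ?thesis
    unfolding push_def using bind_assoc[OF kernel_on kernel'] assms by metis
qed

lemma return_prob: "return borel x \<in> borel_probs"
  by (simp add: space_prob_algebra prob_space_return)

lemma push_return: "0 \<le> t \<Longrightarrow> push (return borel x) t = P t x"
  unfolding push_def by (rule bind_return[OF kernel']) auto

lemma push_P: "0 \<le> s \<Longrightarrow> 0 \<le> t \<Longrightarrow> push (P s x) t = P (s + t) x"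
  by (simp add: push_def chapman_kolmogorov)

lemma nn_integral_push:
  assumes "\<nu> \<in> borel_probs" "0 \<le> t" "f \<in> borel_measurable borel"
  shows "(\<integral>\<^sup>+y. f y \<partial>push \<nu> t) = (\<integral>\<^sup>+x. \<integral>\<^sup>+y. f y \<partial>P t x \<partial>\<nu>)"
  unfolding push_def by (rule nn_integral_bind[OF assms(3) kernel_on[OF assms(2,1)]])

lemma measurable_nn_T:
  "0 \<le> t \<Longrightarrow> f \<in> borel_measurable borel \<Longrightarrow> (\<lambda>x. \<integral>\<^sup>+y. f y \<partial>P t x) \<in> borel_measurable borel"
  by (rule measurable_compose[OF kernel' nn_integral_measurable_subprob_algebra])

lemma measurable_T:
  "0 \<le> t \<Longrightarrow> f \<in> borel_measurable borel \<Longrightarrow> T t f \<in> borel_measurable borel"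
  unfolding T_def by (rule measurable_compose[OF kernel' integral_measurable_subprob_algebra])

lemma borel_measurable_on:
  "\<nu> \<in> borel_probs \<Longrightarrow> f \<in> borel_measurable borel \<Longrightarrow> f \<in> borel_measurable \<nu>"
  by (subst measurable_cong_sets[OF borel_probsD(2) refl])

text \<open>Fubini for a possibly unbounded \<open>f\<close>, obtained from the nonnegative
  integrals of both parts. At points where \<open>f\<close> is not integrable under
  \<open>P t x\<close>, \<open>T t f x\<close> has the default value 0; these points form a
  \<open>\<nu>\<close>-null set.\<close>

lemma
  fixes f :: "'a \<Rightarrow> real"
  assumes \<nu>: "\<nu> \<in> borel_probs" and t: "0 \<le> t" and int: "integrable (push \<nu> t) f"
  shows integrable_T: "integrable \<nu> (T t f)"
    and integral_push: "(\<integral>y. f y \<partial>push \<nu> t) = (\<integral>x. T t f x \<partial>\<nu>)"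
proof -
  have f [measurable]: "f \<in> borel_measurable borel"
    using borel_measurable_integrable[OF int] borel_probsD(2)[OF push_prob[OF \<nu> t]]
    by (simp cong: measurable_cong_sets)
  define a where "a g x = (\<integral>\<^sup>+y. ennreal (g y) \<partial>P t x)" for g :: "'a \<Rightarrow> real" and x
  have am [measurable]: "a g \<in> borel_measurable \<nu>" if "g \<in> borel_measurable borel" for g
    unfolding a_def using that by (intro borel_measurable_on[OF \<nu> measurable_nn_T[OF t]]) measurable
  have ai: "(\<integral>\<^sup>+x. a g x \<partial>\<nu>) = (\<integral>\<^sup>+y. ennreal (g y) \<partial>push \<nu> t)" if "g \<in> borel_measurable borel" for g
    unfolding a_def using that by (subst nn_integral_push[OF \<nu> t]) auto
  have fin: "(\<integral>\<^sup>+x. a (\<lambda>y. \<bar>f y\<bar>) x \<partial>\<nu>) < \<infinity>"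
    using int by (subst ai) (auto simp: integrable_iff_bounded)
  have aefin: "AE x in \<nu>. a (\<lambda>y. \<bar>f y\<bar>) x \<noteq> \<infinity>"
    using fin by (intro nn_integral_PInf_AE) auto
  have fP: "f \<in> borel_measurable (P t x)" for x by (rule borel_measurable_on[OF P_prob[OF t] f])
  have aeint: "AE x in \<nu>. integrable (P t x) f"
    using aefin by eventually_elim (auto simp: integrable_iff_bounded a_def less_top fP)
  have part: "integrable \<nu> (\<lambda>x. enn2real (a g x)) \<and> (\<integral>x. enn2real (a g x) \<partial>\<nu>) = enn2real (\<integral>\<^sup>+y. ennreal (g y) \<partial>push \<nu> t)"
    if g [measurable]: "g \<in> borel_measurable borel" and le: "\<And>y. g y \<le> \<bar>f y\<bar>" for g
  proof -
    have "AE x in \<nu>. ennreal (enn2real (a g x)) = a g x"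
      using aefin
    proof eventually_elim
      case (elim x)
      have "a g x \<le> a (\<lambda>y. \<bar>f y\<bar>) x" unfolding a_def by (intro nn_integral_mono ennreal_leI le)
      then show ?case using elim by (metis ennreal_enn2real infinity_ennreal_def neq_top_trans less_top)
    qed
    then have eq: "(\<integral>\<^sup>+x. ennreal (enn2real (a g x)) \<partial>\<nu>) = (\<integral>\<^sup>+x. a g x \<partial>\<nu>)" by (rule nn_integral_cong_AE)
    have "(\<integral>\<^sup>+x. a g x \<partial>\<nu>) \<le> (\<integral>\<^sup>+x. a (\<lambda>y. \<bar>f y\<bar>) x \<partial>\<nu>)"
      unfolding a_def by (intro nn_integral_mono ennreal_leI le)
    then have "(\<integral>\<^sup>+x. ennreal (enn2real (a g x)) \<partial>\<nu>) < \<infinity>" using fin eq by (simp add: order_le_less_trans)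
    then have "integrable \<nu> (\<lambda>x. enn2real (a g x))" by (intro integrableI_nonneg) auto
    moreover have "(\<integral>x. enn2real (a g x) \<partial>\<nu>) = enn2real (\<integral>\<^sup>+y. ennreal (g y) \<partial>push \<nu> t)"
      by (subst integral_eq_nn_integral) (auto simp: eq ai)
    ultimately show ?thesis by simp
  qed
  have p1: "integrable \<nu> (\<lambda>x. enn2real (a f x))" "(\<integral>x. enn2real (a f x) \<partial>\<nu>) = enn2real (\<integral>\<^sup>+y. ennreal (f y) \<partial>push \<nu> t)"
    using part[of f] by auto
  have p2: "integrable \<nu> (\<lambda>x. enn2real (a (\<lambda>y. - f y) x))"
    "(\<integral>x. enn2real (a (\<lambda>y. - f y) x) \<partial>\<nu>) = enn2real (\<integral>\<^sup>+y. ennreal (- f y) \<partial>push \<nu> t)"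
    using part[of "\<lambda>y. - f y"] by auto
  have Tm [measurable]: "T t f \<in> borel_measurable \<nu>" by (rule borel_measurable_on[OF \<nu> measurable_T[OF t f]])
  have ae: "AE x in \<nu>. T t f x = enn2real (a f x) - enn2real (a (\<lambda>y. - f y) x)"
    using aeint by eventually_elim (simp add: T_def a_def real_lebesgue_integral_def)
  show "integrable \<nu> (T t f)"
    using integrable_cong_AE[OF Tm _ ae] p1 p2 by auto
  have "(\<integral>x. T t f x \<partial>\<nu>) = (\<integral>x. enn2real (a f x) - enn2real (a (\<lambda>y. - f y) x) \<partial>\<nu>)"
    by (rule integral_cong_AE[OF Tm _ ae]) measurable
  also have "\<dots> = (\<integral>y. f y \<partial>push \<nu> t)"
    using p1 p2 by (simp add: real_lebesgue_integral_def[OF int])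
  finally show "(\<integral>y. f y \<partial>push \<nu> t) = (\<integral>x. T t f x \<partial>\<nu>)" by simp
qed

lemma integrable_bounded_prob:
  fixes f :: "'a \<Rightarrow> real"
  assumes "\<nu> \<in> borel_probs" "f \<in> borel_measurable borel" "\<And>x. \<bar>f x\<bar> \<le> B"
  shows "integrable \<nu> f"
proof -
  interpret prob_space \<nu> by (rule borel_probsD[OF assms(1)])
  show ?thesis using assms borel_measurable_on[OF assms(1,2)] by (intro integrable_const_bound[where B=B]) auto
qed

lemma T_bounded:
  assumes "0 \<le> t" "\<And>x. \<bar>f x\<bar> \<le> B" "0 \<le> B"
  shows "\<bar>T t f x\<bar> \<le> B"
proof -
  interpret prob_space "P t x" by (rule borel_probsD[OF P_prob[OF assms(1)]])
  show ?thesis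
  proof (cases "integrable (P t x) f")
    case True
    have "\<bar>T t f x\<bar> \<le> (\<integral>y. \<bar>f y\<bar> \<partial>P t x)" unfolding T_def by (rule integral_abs_bound)
    also have "\<dots> \<le> (\<integral>y. B \<partial>P t x)" using True assms by (intro integral_mono) auto
    finally show ?thesis by (simp add: prob_space)
  next
    case False
    then show ?thesis using assms by (simp add: T_def not_integrable_integral_eq)
  qed
qed

lemma T_T:
  assumes "0 \<le> s" "0 \<le> t" "f \<in> borel_measurable borel" "\<And>x. \<bar>f x\<bar> \<le> B"
  shows "T (s + t) f x = T s (T t f) x"
proof -
  have "push (P s x) t = P (s + t) x" by (rule push_P[OF assms(1,2)])
  moreover have "integrable (P (s + t) x) f"
    using assms by (intro integrable_bounded_prob P_prob) auto
  ultimately show ?thesis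
    using integral_push[OF P_prob[OF assms(1)] assms(2), of x f] by (simp add: T_def[abs_def])
qed

lemma measure_push:
  assumes "\<nu> \<in> borel_probs" "0 \<le> t" "A \<in> sets borel"
  shows "measure (push \<nu> t) A = (\<integral>x. measure (P t x) A \<partial>\<nu>)"
proof -
  have "integrable (push \<nu> t) (indicator A :: 'a \<Rightarrow> real)"
    using assms by (intro integrable_bounded_prob[where B=1] push_prob) (auto simp: indicator_def)
  from integral_push[OF assms(1,2) this] show ?thesis
    by (simp add: T_def borel_probsD(3)[OF push_prob[OF assms(1,2)]] borel_probsD(3)[OF P_prob[OF assms(2)]])
qed

end

section \<open>Merging of trajectories\<close>

context feller_semigroup
begin

text \<open>The bound is uniform over all later times, so it is inherited by
  \<open>push \<nu> s\<close>; the nonnegative integral makes it meaningful before integrability of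
  \<open>f\<close> is known.\<close>

definition tail_bound :: "('a \<Rightarrow> real) \<Rightarrow> real \<Rightarrow> real \<Rightarrow> 'a measure \<Rightarrow> bool" where
  "tail_bound f K c \<nu> \<longleftrightarrow>
     (\<forall>t\<ge>0. (\<integral>\<^sup>+y. ennreal (\<bar>f y\<bar> * indicator {y. K \<le> \<bar>f y\<bar>} y) \<partial>push \<nu> t) \<le> ennreal c)"

definition unif_integrable :: "('a \<Rightarrow> real) \<Rightarrow> 'a measure \<Rightarrow> bool" where
  "unif_integrable f \<nu> \<longleftrightarrow> (\<forall>e>0. \<exists>K\<ge>0. tail_bound f K e \<nu>)"

lemma tail_bound_mono:
  assumes "tail_bound f K c \<nu>" "K \<le> K'" "c \<le> c'"
  shows "tail_bound f K' c' \<nu>"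
  unfolding tail_bound_def
proof (intro allI impI)
  fix t :: real assume "0 \<le> t"
  have "(\<integral>\<^sup>+y. ennreal (\<bar>f y\<bar> * indicator {y. K' \<le> \<bar>f y\<bar>} y) \<partial>push \<nu> t)
      \<le> (\<integral>\<^sup>+y. ennreal (\<bar>f y\<bar> * indicator {y. K \<le> \<bar>f y\<bar>} y) \<partial>push \<nu> t)"
    using assms(2) by (intro nn_integral_mono ennreal_leI) (auto simp: indicator_def)
  also have "\<dots> \<le> ennreal c" using assms(1) \<open>0 \<le> t\<close> by (auto simp: tail_bound_def)
  also have "\<dots> \<le> ennreal c'" by (rule ennreal_leI) fact
  finally show "(\<integral>\<^sup>+y. ennreal (\<bar>f y\<bar> * indicator {y. K' \<le> \<bar>f y\<bar>} y) \<partial>push \<nu> t) \<le> ennreal c'" .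
qed

lemma tail_bound_push:
  "tail_bound f K c \<nu> \<Longrightarrow> \<nu> \<in> borel_probs \<Longrightarrow> 0 \<le> s \<Longrightarrow> tail_bound f K c (push \<nu> s)"
  by (auto simp: tail_bound_def push_push)

lemma unif_integrable_push:
  "unif_integrable f \<nu> \<Longrightarrow> \<nu> \<in> borel_probs \<Longrightarrow> 0 \<le> s \<Longrightarrow> unif_integrable f (push \<nu> s)"
  by (auto simp: unif_integrable_def intro!: tail_bound_push)

lemma unif_integrable_bounded:
  assumes "\<And>x. \<bar>f x\<bar> \<le> B" shows "unif_integrable f \<nu>"
proof -
  have "\<not> max 0 B + 1 \<le> \<bar>f y\<bar>" for y using assms[of y] by linarith
  then have "{y. max 0 B + 1 \<le> \<bar>f y\<bar>} = {}" by blast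
  then have "tail_bound f (max 0 B + 1) e \<nu>" for e by (simp add: tail_bound_def)
  then show ?thesis unfolding unif_integrable_def by (metis add_nonneg_nonneg max.cobounded1 zero_le_one)
qed

text \<open>All three follow from \<open>\<bar>f\<bar> \<le> K\<close> plus the part of
  \<open>\<bar>f\<bar>\<close> on \<open>{y. K \<le> \<bar>f y\<bar>}\<close>.\<close>

lemma
  fixes f :: "'a \<Rightarrow> real"
  assumes f: "f \<in> borel_measurable borel" and tb: "tail_bound f K c \<nu>" and \<nu>: "\<nu> \<in> borel_probs"
    and "0 \<le> t" "0 \<le> K" "0 \<le> c"
  shows tail_bound_nn: "(\<integral>\<^sup>+y. ennreal \<bar>f y\<bar> \<partial>push \<nu> t) \<le> ennreal (K + c)"
    and tail_bound_integrable: "integrable (push \<nu> t) f"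
    and tail_bound_integral_le: "\<bar>\<integral>y. f y \<partial>push \<nu> t\<bar> \<le> K + c"
proof -
  interpret p: prob_space "push \<nu> t" by (rule borel_probsD[OF push_prob[OF \<nu> \<open>0 \<le> t\<close>]])
  note [measurable] = f and [measurable_cong] = borel_probsD(2)[OF push_prob[OF \<nu> \<open>0 \<le> t\<close>]]
  have "(\<integral>\<^sup>+y. ennreal \<bar>f y\<bar> \<partial>push \<nu> t)
      \<le> (\<integral>\<^sup>+y. ennreal K + ennreal (\<bar>f y\<bar> * indicator {y. K \<le> \<bar>f y\<bar>} y) \<partial>push \<nu> t)"
    using \<open>0 \<le> K\<close> by (intro nn_integral_mono)
      (auto simp: indicator_def ennreal_plus[symmetric] simp del: ennreal_plus intro!: ennreal_leI)
  also have "\<dots> = ennreal K + (\<integral>\<^sup>+y. ennreal (\<bar>f y\<bar> * indicator {y. K \<le> \<bar>f y\<bar>} y) \<partial>push \<nu> t)"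
    by (subst nn_integral_add) (auto simp: p.emeasure_space_1)
  also have "\<dots> \<le> ennreal K + ennreal c"
    using tb \<open>0 \<le> t\<close> by (intro add_left_mono) (auto simp: tail_bound_def)
  finally show nn: "(\<integral>\<^sup>+y. ennreal \<bar>f y\<bar> \<partial>push \<nu> t) \<le> ennreal (K + c)"
    using assms by (simp add: ennreal_plus)
  show int: "integrable (push \<nu> t) f"
    using nn by (intro integrableI_bounded) (auto simp: top_unique less_top[symmetric])
  have "ennreal \<bar>\<integral>y. f y \<partial>push \<nu> t\<bar> \<le> (\<integral>\<^sup>+y. ennreal \<bar>f y\<bar> \<partial>push \<nu> t)"
    using integral_norm_bound_ennreal[OF int] by simp
  with nn have "ennreal \<bar>\<integral>y. f y \<partial>push \<nu> t\<bar> \<le> ennreal (K + c)" by (rule order_trans[rotated])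
  then show "\<bar>\<integral>y. f y \<partial>push \<nu> t\<bar> \<le> K + c" using assms ennreal_le_iff[of "K + c"] by (simp del: ennreal_plus)
qed

lemma unif_integrable_imp_integrable:
  assumes "f \<in> borel_measurable borel" "unif_integrable f \<nu>" "\<nu> \<in> borel_probs" "0 \<le> t"
  shows "integrable (push \<nu> t) f"
proof -
  obtain K where "0 \<le> K" "tail_bound f K 1 \<nu>" using assms(2) by (auto simp: unif_integrable_def dest: spec[of _ 1])
  then show ?thesis using assms by (intro tail_bound_integrable[of f K 1]) auto
qed

text \<open>Vitali's convergence theorem: on \<open>B\<close> the functions \<open>T t f\<close> stay
  asymptotically \<open>e\<close>-close to \<open>m t\<close>, and uniform integrability allows to integrate this.\<close>

lemma eventually_integral_close:
  fixes f :: "'a \<Rightarrow> real"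
  assumes f: "f \<in> borel_measurable borel" and ui: "unif_integrable f \<sigma>" and \<sigma>: "\<sigma> \<in> borel_probs"
    and B: "B \<in> sets borel" and e: "0 < e" and pos: "0 < measure \<sigma> B"
    and m: "\<And>t. 0 \<le> t \<Longrightarrow> \<bar>m t\<bar> \<le> C"
    and close: "\<And>w. w \<in> B \<Longrightarrow> \<forall>\<^sub>F t in at_top. \<bar>T t f w - m t\<bar> < e"
  shows "\<forall>\<^sub>F t in at_top. \<bar>\<integral>w. indicator B w * (T t f w - m t) \<partial>\<sigma>\<bar> \<le> 2 * e * measure \<sigma> B"
proof -
  interpret s: prob_space \<sigma> by (rule borel_probsD[OF \<sigma>])
  note [measurable_cong] = borel_probsD(2)[OF \<sigma>] and sp = borel_probsD(3)[OF \<sigma>]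
  note [measurable] = f B
  define \<eta> where "\<eta> = e * measure \<sigma> B"
  have "0 < \<eta>" using e pos by (simp add: \<eta>_def)
  obtain K where K: "0 \<le> K" "tail_bound f K (\<eta> / 2) \<sigma>"
    using ui \<open>0 < \<eta>\<close> by (auto simp: unif_integrable_def dest: spec[of _ "\<eta> / 2"])
  define R where "R y = \<bar>f y\<bar> * indicator {y. K \<le> \<bar>f y\<bar>} y" for y
  have R [measurable]: "R \<in> borel_measurable borel" unfolding R_def by measurable
  have R0: "0 \<le> R y" for y by (simp add: R_def)
  \<comment> \<open>The excess of the error over \<open>e\<close>; by assumption it is eventually 0
    at every point. Truncated at \<open>K + C\<close> it is handled by dominated convergence, while
    \<open>T t R\<close> pays for what the truncation removes.\<close>
  define \<phi> where "\<phi> t w = indicator B w * max 0 (\<bar>T t f w - m t\<bar> - e)" for t w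
  have T_meas: "T t g \<in> borel_measurable \<sigma>" if "0 \<le> t" "g \<in> borel_measurable borel" for t g
    by (rule borel_measurable_on[OF \<sigma> measurable_T[OF that]])
  have phi_meas: "\<phi> t \<in> borel_measurable \<sigma>" if "0 \<le> t" for t
  proof -
    note [measurable] = T_meas[OF that f]
    show ?thesis unfolding \<phi>_def by measurable
  qed
  have Rint: "integrable (push \<sigma> t) R" and Rle: "(\<integral>w. T t R w \<partial>\<sigma>) \<le> \<eta> / 2" if "0 \<le> t" for t
  proof -
    have le: "(\<integral>\<^sup>+y. ennreal (R y) \<partial>push \<sigma> t) \<le> ennreal (\<eta> / 2)"
      using K(2) that by (simp add: tail_bound_def R_def)
    have Rm: "R \<in> borel_measurable (push \<sigma> t)"
      by (rule borel_measurable_on[OF push_prob[OF \<sigma> that] R])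
    show Rint: "integrable (push \<sigma> t) R"
      using le by (intro integrableI_nonneg Rm) (auto simp: R0 top_unique less_top[symmetric])
    have "ennreal (\<integral>y. R y \<partial>push \<sigma> t) \<le> ennreal (\<eta> / 2)"
      using le nn_integral_eq_integral[OF Rint] R0 by simp
    then show "(\<integral>w. T t R w \<partial>\<sigma>) \<le> \<eta> / 2"
      using integral_push[OF \<sigma> that Rint] \<open>0 < \<eta>\<close> by simp
  qed
  have T_le: "\<bar>T t f w\<bar> \<le> K + T t R w" if "0 \<le> t" for t w
  proof -
    interpret p: prob_space "P t w" by (rule borel_probsD[OF P_prob[OF that]])
    have TR0: "0 \<le> T t R w" unfolding T_def by (intro Bochner_Integration.integral_nonneg) (auto simp: R0)
    show ?thesis
    proof (cases "integrable (P t w) f")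
      case True
      have Rm: "R \<in> borel_measurable (P t w)" by (rule borel_measurable_on[OF P_prob[OF that] R])
      have Ri: "integrable (P t w) R"
        by (rule Bochner_Integration.integrable_bound[OF True Rm]) (auto simp: R_def indicator_def)
      have le: "\<bar>f y\<bar> \<le> K + R y" for y using K(1) by (simp add: R_def indicator_def)
      have "\<bar>T t f w\<bar> \<le> (\<integral>y. \<bar>f y\<bar> \<partial>P t w)" unfolding T_def by (rule integral_abs_bound)
      also have "\<dots> \<le> (\<integral>y. K + R y \<partial>P t w)"
        using True Ri le by (intro integral_mono) auto
      also have "\<dots> = K + T t R w" using Ri by (simp add: T_def p.prob_space)
      finally show ?thesis .
    next
      case False
      then have "T t f w = 0" by (simp add: T_def not_integrable_integral_eq)
      then show ?thesis using TR0 K by simp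
    qed
  qed
  have C0: "0 \<le> C" using m[of 0] by linarith
  \<comment> \<open>\<open>max 0 t\<close> is used because the dominated convergence rule asks for
    measurability at every real \<open>t\<close>, whereas the kernels are controlled only for
    \<open>0 \<le> t\<close>.\<close>
  have lim: "((\<lambda>t. \<integral>w. min (\<phi> (max 0 t) w) (K + C) \<partial>\<sigma>) \<longlongrightarrow> (\<integral>w. 0 \<partial>\<sigma>)) at_top"
  proof (rule integral_dominated_convergence_at_top[where w="\<lambda>_. K + C"])
    show "(\<lambda>w. min (\<phi> (max 0 t) w) (K + C)) \<in> borel_measurable \<sigma>" for t
      using phi_meas[of "max 0 t"] by measurable
    show "AE w in \<sigma>. ((\<lambda>t. min (\<phi> (max 0 t) w) (K + C)) \<longlongrightarrow> 0) at_top"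
    proof (intro AE_I2)
      fix w
      have "\<forall>\<^sub>F t in at_top. min (\<phi> (max 0 t) w) (K + C) = 0"
      proof (cases "w \<in> B")
        case True
        show ?thesis using close[OF True] eventually_ge_at_top[of 0]
          by eventually_elim (use K C0 in \<open>auto simp: \<phi>_def max_def\<close>)
      next
        case False
        then show ?thesis using K C0 by (simp add: \<phi>_def)
      qed
      then show "((\<lambda>t. min (\<phi> (max 0 t) w) (K + C)) \<longlongrightarrow> 0) at_top" by (rule tendsto_eventually)
    qed
    show "\<forall>\<^sub>F t in at_top. AE w in \<sigma>. norm (min (\<phi> (max 0 t) w) (K + C)) \<le> K + C"
      using K C0 by (intro always_eventually allI AE_I2) (auto simp: \<phi>_def indicator_def)
  qed auto
  have "\<forall>\<^sub>F t in at_top. (\<integral>w. min (\<phi> (max 0 t) w) (K + C) \<partial>\<sigma>) < \<eta> / 2"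
    using order_tendstoD(2)[OF lim, of "\<eta> / 2"] \<open>0 < \<eta>\<close> by simp
  then show ?thesis
    using eventually_ge_at_top[of 0]
  proof eventually_elim
    case (elim t)
    then have t: "0 \<le> t" "max 0 t = t" by auto
    note [measurable] = phi_meas[OF t(1)] T_meas[OF t(1) f]
    have TRi: "integrable \<sigma> (T t R)" by (rule integrable_T[OF \<sigma> t(1) Rint[OF t(1)]])
    have Ti: "integrable \<sigma> (T t f)"
      by (rule integrable_T[OF \<sigma> t(1) unif_integrable_imp_integrable[OF f ui \<sigma> t(1)]])
    have mi: "integrable \<sigma> (\<lambda>w. min (\<phi> t w) (K + C))"
      using K C0 by (intro s.integrable_const_bound[where B="K + C"]) (auto simp: \<phi>_def indicator_def)
    have Bi: "integrable \<sigma> (indicator B :: 'a \<Rightarrow> real)"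
      by (intro s.integrable_const_bound[where B=1]) (auto simp: indicator_def)
    have "\<bar>\<integral>w. indicator B w * (T t f w - m t) \<partial>\<sigma>\<bar> \<le> (\<integral>w. \<bar>indicator B w * (T t f w - m t)\<bar> \<partial>\<sigma>)"
      by (rule integral_abs_bound)
    \<comment> \<open>If the excess is above \<open>K + C\<close>, the estimate
      \<open>\<bar>T t f w - m t\<bar> \<le> K + T t R w + C\<close> takes over. The last two terms
      integrate to at most \<open>\<eta> / 2\<close> each, and \<open>\<eta>\<close> is
      \<open>e * measure \<sigma> B\<close>.\<close>
    also have "\<dots> \<le> (\<integral>w. (e * indicator B w + min (\<phi> t w) (K + C)) + T t R w \<partial>\<sigma>)"
    proof (rule integral_mono)
      show "integrable \<sigma> (\<lambda>w. \<bar>indicator B w * (T t f w - m t)\<bar>)"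
        using integrable_real_mult_indicator[of B \<sigma> \<open>\<lambda>w. T t f w - m t\<close>] Ti by (intro integrable_abs) (simp add: mult.commute)
      show "integrable \<sigma> (\<lambda>w. (e * indicator B w + min (\<phi> t w) (K + C)) + T t R w)"
        using TRi mi Bi by auto
      fix w
      have TR0: "0 \<le> T t R w" unfolding T_def by (intro Bochner_Integration.integral_nonneg) (auto simp: R0)
      show "\<bar>indicator B w * (T t f w - m t)\<bar> \<le> (e * indicator B w + min (\<phi> t w) (K + C)) + T t R w"
        using T_le[OF t(1), of w] m[OF t(1)] TR0 e K C0 by (auto simp: \<phi>_def indicator_def)
    qed
    also have "\<dots> = e * measure \<sigma> B + (\<integral>w. min (\<phi> t w) (K + C) \<partial>\<sigma>) + (\<integral>w. T t R w \<partial>\<sigma>)"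
      using TRi mi Bi by (simp add: sp)
    also have "\<dots> \<le> 2 * e * measure \<sigma> B"
      using elim Rle[OF t(1)] t(2) by (simp add: \<eta>_def)
    finally show ?case .
  qed
qed

text \<open>\<open>\<sigma>\<close> is \<open>a\<close> times its conditional law on
  \<open>B\<close> plus \<open>1 - a\<close> times a remainder with density \<open>h\<close>. The
  density is nonnegative because \<open>a \<le> measure \<sigma> B\<close>. The last conclusion,
  \<open>(1 - a) \<rho> \<le> \<sigma>\<close>, transfers tail bounds to the remainder.\<close>

lemma split_prob:
  assumes \<sigma>: "\<sigma> \<in> borel_probs" and B: "B \<in> sets borel" and a: "0 < a" "a < 1" "a \<le> measure \<sigma> B"
  obtains \<rho> where "\<rho> \<in> borel_probs"
    "\<And>f :: 'a \<Rightarrow> real. integrable \<sigma> f \<Longrightarrow>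
      (\<integral>x. f x \<partial>\<sigma>) = a / measure \<sigma> B * (\<integral>x. indicator B x * f x \<partial>\<sigma>) + (1 - a) * (\<integral>x. f x \<partial>\<rho>)"
    "\<And>g. g \<in> borel_measurable borel \<Longrightarrow> ennreal (1 - a) * (\<integral>\<^sup>+x. g x \<partial>\<rho>) \<le> (\<integral>\<^sup>+x. g x \<partial>\<sigma>)"
proof -
  interpret s: prob_space \<sigma> by (rule borel_probsD[OF \<sigma>])
  note [measurable_cong] = borel_probsD(2)[OF \<sigma>] and sp = borel_probsD(3)[OF \<sigma>]
  note [measurable] = B
  define b where "b = a / measure \<sigma> B"
  have b: "0 < b" "b \<le> 1" using a by (auto simp: b_def)
  define h where "h x = (1 - b * indicator B x) / (1 - a)" for x
  have hx: "(1 - a) * h x = 1 - b * indicator B x" for x using a by (simp add: h_def)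
  have h0: "0 \<le> h x" for x using a b by (auto simp: h_def indicator_def)
  have [measurable]: "h \<in> borel_measurable borel" unfolding h_def by measurable
  have Bi: "integrable \<sigma> (indicator B :: 'a \<Rightarrow> real)"
    by (intro s.integrable_const_bound[where B=1]) (auto simp: indicator_def)
  have hi: "integrable \<sigma> h" unfolding h_def using Bi by auto
  define \<rho> where "\<rho> = density \<sigma> (\<lambda>x. ennreal (h x))"
  have "(\<integral>x. h x \<partial>\<sigma>) = (1 - b * measure \<sigma> B) / (1 - a)"
    unfolding h_def using Bi by (simp add: sp s.prob_space[unfolded sp])
  also have "\<dots> = 1" using a by (simp add: b_def)
  finally have "(\<integral>\<^sup>+x. ennreal (h x) \<partial>\<sigma>) = 1"
    using nn_integral_eq_integral[OF hi] h0 by simp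
  then have "emeasure \<rho> (space \<rho>) = 1" unfolding \<rho>_def by (subst emeasure_density) (auto simp: sp)
  then have 1: "\<rho> \<in> borel_probs"
    by (auto simp: space_prob_algebra \<rho>_def borel_probsD(2)[OF \<sigma>] intro!: prob_spaceI)
  have 2: "(\<integral>x. f x \<partial>\<sigma>) = a / measure \<sigma> B * (\<integral>x. indicator B x * f x \<partial>\<sigma>) + (1 - a) * (\<integral>x. f x \<partial>\<rho>)"
    if f: "integrable \<sigma> f" for f :: "'a \<Rightarrow> real"
  proof -
    have fB: "integrable \<sigma> (\<lambda>x. indicator B x * f x)"
      using integrable_real_mult_indicator[OF _ f, of B] by (simp add: mult.commute)
    have "(1 - a) * (\<integral>x. f x \<partial>\<rho>) = (1 - a) * (\<integral>x. h x * f x \<partial>\<sigma>)"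
      unfolding \<rho>_def using f h0 by (subst integral_density) auto
    also have "\<dots> = (\<integral>x. (1 - a) * (h x * f x) \<partial>\<sigma>)" by simp
    also have "\<dots> = (\<integral>x. f x - b * (indicator B x * f x) \<partial>\<sigma>)"
      using hx by (intro Bochner_Integration.integral_cong) (auto simp: mult.assoc[symmetric] left_diff_distrib)
    also have "\<dots> = (\<integral>x. f x \<partial>\<sigma>) - b * (\<integral>x. indicator B x * f x \<partial>\<sigma>)"
      using f fB by simp
    finally show ?thesis by (simp add: b_def)
  qed
  have 3: "ennreal (1 - a) * (\<integral>\<^sup>+x. g x \<partial>\<rho>) \<le> (\<integral>\<^sup>+x. g x \<partial>\<sigma>)" if [measurable]: "g \<in> borel_measurable borel" for g
  proof -
    have "ennreal (1 - a) * (\<integral>\<^sup>+x. g x \<partial>\<rho>) = (\<integral>\<^sup>+x. ennreal (1 - a) * (ennreal (h x) * g x) \<partial>\<sigma>)"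
      unfolding \<rho>_def by (subst nn_integral_density) (auto simp: nn_integral_cmult)
    also have "\<dots> \<le> (\<integral>\<^sup>+x. g x \<partial>\<sigma>)"
    proof (rule nn_integral_mono)
      fix x
      have "ennreal (1 - a) * (ennreal (h x) * g x) = ennreal ((1 - a) * h x) * g x"
        using a h0 by (simp add: ennreal_mult mult.assoc)
      also have "\<dots> \<le> 1 * g x"
        using a b by (intro mult_right_mono) (auto simp: h_def indicator_def ennreal_le_1)
      finally show "ennreal (1 - a) * (ennreal (h x) * g x) \<le> g x" by simp
    qed
    finally show ?thesis .
  qed
  show ?thesis by (rule that[OF 1 2 3])
qed

text \<open>The domination \<open>(1 - a) \<rho> \<le> \<sigma>\<close> is preserved by the
  semigroup; dividing by \<open>1 - a\<close> gives the factor.\<close>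

lemma tail_bound_split:
  assumes f: "f \<in> borel_measurable borel" and "\<sigma> \<in> borel_probs" "\<rho> \<in> borel_probs" "a < 1" "0 \<le> c"
    and le: "\<And>g. g \<in> borel_measurable borel \<Longrightarrow> ennreal (1 - a) * (\<integral>\<^sup>+x. g x \<partial>\<rho>) \<le> (\<integral>\<^sup>+x. g x \<partial>\<sigma>)"
    and tb: "tail_bound f K c \<sigma>"
  shows "tail_bound f K (c / (1 - a)) \<rho>"
  unfolding tail_bound_def
proof (intro allI impI)
  fix t :: real assume t: "0 \<le> t"
  note [measurable] = f
  let ?R = "\<lambda>y. ennreal (\<bar>f y\<bar> * indicator {y. K \<le> \<bar>f y\<bar>} y)"
  have R: "?R \<in> borel_measurable borel" by measurable
  have "ennreal (1 - a) * (\<integral>\<^sup>+y. ?R y \<partial>push \<rho> t) \<le> (\<integral>\<^sup>+y. ?R y \<partial>push \<sigma> t)"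
    unfolding nn_integral_push[OF assms(2) t R] nn_integral_push[OF assms(3) t R]
    by (rule le[OF measurable_nn_T[OF t R]])
  also have "\<dots> \<le> ennreal c" using tb t by (auto simp: tail_bound_def)
  finally have *: "ennreal (1 - a) * (\<integral>\<^sup>+y. ?R y \<partial>push \<rho> t) \<le> ennreal c" .
  have "(\<integral>\<^sup>+y. ?R y \<partial>push \<rho> t) = ennreal (1 / (1 - a)) * (ennreal (1 - a) * (\<integral>\<^sup>+y. ?R y \<partial>push \<rho> t))"
    using assms(4) by (simp add: mult.assoc[symmetric] ennreal_mult[symmetric])
  also have "\<dots> \<le> ennreal (1 / (1 - a)) * ennreal c" by (rule mult_left_mono[OF *]) simp
  also have "\<dots> = ennreal (c / (1 - a))"
    using assms(4,5) by (simp add: ennreal_mult[symmetric])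
  finally show "(\<integral>\<^sup>+y. ?R y \<partial>push \<rho> t) \<le> ennreal (c / (1 - a))" .
qed

text \<open>The reference \<open>m t\<close> may move, but it is common to both laws and cancels.
  The parts split off on \<open>B\<close> differ from \<open>a * m t\<close> by at most
  \<open>a * (2 * e)\<close> each, and the remainders carry the weight \<open>1 - a\<close>; thus
  \<open>4 * e\<close> reproduces itself, being \<open>a * (4 * e) + (1 - a) * (4 * e)\<close>. Tail
  bounds of the remainders grow by \<open>1 / (1 - a)\<close>, exactly cancelled by the weight. So
  \<open>K\<close>, \<open>c1\<close>, \<open>c2\<close> stay fixed during the iteration and only
  the crude bound \<open>2 * K\<close> shrinks.\<close>

lemma eventually_close_iterate:
  fixes f :: "'a \<Rightarrow> real"
  assumes f: "f \<in> borel_measurable borel" and B: "B \<in> sets borel" and a: "0 < a" "a < 1" and e: "0 < e"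
    and hit: "\<And>\<nu>. \<nu> \<in> borel_probs \<Longrightarrow> \<forall>\<^sub>F t in at_top. a \<le> measure (push \<nu> t) B"
    and m: "\<And>t. 0 \<le> t \<Longrightarrow> \<bar>m t\<bar> \<le> C"
    and close: "\<And>w. w \<in> B \<Longrightarrow> \<forall>\<^sub>F t in at_top. \<bar>T t f w - m t\<bar> < e"
    and "\<nu>1 \<in> borel_probs" "\<nu>2 \<in> borel_probs" "unif_integrable f \<nu>1" "unif_integrable f \<nu>2"
    and "0 \<le> K" "0 \<le> c1" "0 \<le> c2" "tail_bound f K c1 \<nu>1" "tail_bound f K c2 \<nu>2"
  shows "\<forall>\<^sub>F t in at_top. \<bar>(\<integral>y. f y \<partial>push \<nu>1 t) - (\<integral>y. f y \<partial>push \<nu>2 t)\<bar>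
    \<le> 4 * e + (1 - a) ^ j * (2 * K) + c1 + c2"
  using assms(9-)
proof (induction j arbitrary: \<nu>1 \<nu>2 c1 c2)
  case 0
  show ?case
    using eventually_ge_at_top[of 0]
  proof eventually_elim
    case (elim t)
    have "\<bar>\<integral>y. f y \<partial>push \<nu>1 t\<bar> \<le> K + c1" "\<bar>\<integral>y. f y \<partial>push \<nu>2 t\<bar> \<le> K + c2"
      using 0 elim by (auto intro!: tail_bound_integral_le[OF f])
    then show ?case using e by simp
  qed
next
  case (Suc j)
  have "\<forall>\<^sub>F t in at_top. 0 \<le> t \<and> a \<le> measure (push \<nu>1 t) B \<and> a \<le> measure (push \<nu>2 t) B"
    using eventually_ge_at_top[of 0] hit[OF Suc.prems(1)] hit[OF Suc.prems(2)]
    by eventually_elim auto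
  then obtain s where s: "0 \<le> s" "a \<le> measure (push \<nu>1 s) B" "a \<le> measure (push \<nu>2 s) B"
    using eventually_happens'[OF trivial_limit_at_top_linorder] by blast
  \<comment> \<open>A common time \<open>s\<close> works for both laws because hitting
    \<open>B\<close> with mass at least \<open>a\<close> holds eventually for each.\<close>
  define \<sigma>1 where "\<sigma>1 = push \<nu>1 s"
  define \<sigma>2 where "\<sigma>2 = push \<nu>2 s"
  have s1: "\<sigma>1 \<in> borel_probs" "\<sigma>2 \<in> borel_probs"
    using Suc.prems s by (auto simp: \<sigma>1_def \<sigma>2_def intro!: push_prob)
  have a': "a \<le> measure \<sigma>1 B" "a \<le> measure \<sigma>2 B" using s by (auto simp: \<sigma>1_def \<sigma>2_def)
  have ui: "unif_integrable f \<sigma>1" "unif_integrable f \<sigma>2"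
    using Suc.prems s by (auto simp: \<sigma>1_def \<sigma>2_def intro!: unif_integrable_push)
  have tb: "tail_bound f K c1 \<sigma>1" "tail_bound f K c2 \<sigma>2"
    using Suc.prems s by (auto simp: \<sigma>1_def \<sigma>2_def intro!: tail_bound_push)
  obtain \<rho>1 where r1: "\<rho>1 \<in> borel_probs"
    "\<And>f :: 'a \<Rightarrow> real. integrable \<sigma>1 f \<Longrightarrow>
      (\<integral>x. f x \<partial>\<sigma>1) = a / measure \<sigma>1 B * (\<integral>x. indicator B x * f x \<partial>\<sigma>1) + (1 - a) * (\<integral>x. f x \<partial>\<rho>1)"
    "\<And>g. g \<in> borel_measurable borel \<Longrightarrow> ennreal (1 - a) * (\<integral>\<^sup>+x. g x \<partial>\<rho>1) \<le> (\<integral>\<^sup>+x. g x \<partial>\<sigma>1)"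
    by (rule split_prob[OF s1(1) B a a'(1)]) blast
  obtain \<rho>2 where r2: "\<rho>2 \<in> borel_probs"
    "\<And>f :: 'a \<Rightarrow> real. integrable \<sigma>2 f \<Longrightarrow>
      (\<integral>x. f x \<partial>\<sigma>2) = a / measure \<sigma>2 B * (\<integral>x. indicator B x * f x \<partial>\<sigma>2) + (1 - a) * (\<integral>x. f x \<partial>\<rho>2)"
    "\<And>g. g \<in> borel_measurable borel \<Longrightarrow> ennreal (1 - a) * (\<integral>\<^sup>+x. g x \<partial>\<rho>2) \<le> (\<integral>\<^sup>+x. g x \<partial>\<sigma>2)"
    by (rule split_prob[OF s1(2) B a a'(2)]) blast
  have rtb: "\<And>K c. 0 \<le> c \<Longrightarrow> tail_bound f K c \<sigma>1 \<Longrightarrow> tail_bound f K (c / (1 - a)) \<rho>1"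
    "\<And>K c. 0 \<le> c \<Longrightarrow> tail_bound f K c \<sigma>2 \<Longrightarrow> tail_bound f K (c / (1 - a)) \<rho>2"
    using tail_bound_split[OF f s1(1) r1(1) a(2) _ r1(3)] tail_bound_split[OF f s1(2) r2(1) a(2) _ r2(3)] by auto
  have rui: "unif_integrable f \<rho>1" "unif_integrable f \<rho>2"
    unfolding unif_integrable_def
  proof (safe)
    fix e' :: real assume "0 < e'"
    then have e': "0 < (1 - a) * e'" using a by simp
    show "\<exists>K\<ge>0. tail_bound f K e' \<rho>1"
      using ui(1) e' rtb(1)[of "(1 - a) * e'"] a by (fastforce simp: unif_integrable_def)
    show "\<exists>K\<ge>0. tail_bound f K e' \<rho>2"
      using ui(2) e' rtb(2)[of "(1 - a) * e'"] a by (fastforce simp: unif_integrable_def)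
  qed
  have IH: "\<forall>\<^sub>F t in at_top. \<bar>(\<integral>y. f y \<partial>push \<rho>1 t) - (\<integral>y. f y \<partial>push \<rho>2 t)\<bar>
      \<le> 4 * e + (1 - a) ^ j * (2 * K) + c1 / (1 - a) + c2 / (1 - a)"
    using Suc.prems a tb by (intro Suc.IH r1(1) r2(1) rui rtb) auto
  have cl1: "\<forall>\<^sub>F t in at_top. \<bar>\<integral>w. indicator B w * (T t f w - m t) \<partial>\<sigma>1\<bar> \<le> 2 * e * measure \<sigma>1 B"
    using a a' by (intro eventually_integral_close[OF f ui(1) s1(1) B e _ m close]) auto
  have cl2: "\<forall>\<^sub>F t in at_top. \<bar>\<integral>w. indicator B w * (T t f w - m t) \<partial>\<sigma>2\<bar> \<le> 2 * e * measure \<sigma>2 B"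
    using a a' by (intro eventually_integral_close[OF f ui(2) s1(2) B e _ m close]) auto
  have "\<forall>\<^sub>F t in at_top. \<bar>(\<integral>y. f y \<partial>push \<sigma>1 t) - (\<integral>y. f y \<partial>push \<sigma>2 t)\<bar>
    \<le> 4 * e + (1 - a) ^ Suc j * (2 * K) + c1 + c2"
    using IH cl1 cl2 eventually_ge_at_top[of 0]
  proof eventually_elim
    case (elim t)
    \<comment> \<open>The decomposition of one law relative to \<open>m t\<close>; stated once for
      both pairs.\<close>
    have dec: "\<exists>q. \<bar>q\<bar> \<le> a * (2 * e) \<and> (\<integral>y. f y \<partial>push \<sigma> t) - m t = q + (1 - a) * ((\<integral>y. f y \<partial>push \<rho> t) - m t)"
      if "\<sigma> \<in> borel_probs" "\<rho> \<in> borel_probs" "unif_integrable f \<sigma>" "unif_integrable f \<rho>" "a \<le> measure \<sigma> B"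
        and sp: "\<And>f :: 'a \<Rightarrow> real. integrable \<sigma> f \<Longrightarrow>
      (\<integral>x. f x \<partial>\<sigma>) = a / measure \<sigma> B * (\<integral>x. indicator B x * f x \<partial>\<sigma>) + (1 - a) * (\<integral>x. f x \<partial>\<rho>)"
        and cl: "\<bar>\<integral>w. indicator B w * (T t f w - m t) \<partial>\<sigma>\<bar> \<le> 2 * e * measure \<sigma> B" for \<sigma> \<rho>
    proof -
      interpret s: prob_space \<sigma> by (rule borel_probsD[OF that(1)])
      interpret r: prob_space \<rho> by (rule borel_probsD[OF that(2)])
      have i1: "integrable (push \<sigma> t) f" "integrable (push \<rho> t) f"
        using unif_integrable_imp_integrable[OF f] that elim by auto
      have i2: "integrable \<sigma> (T t f)" "integrable \<rho> (T t f)"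
        using integrable_T i1 that elim by auto
      have "(\<integral>y. f y \<partial>push \<sigma> t) - m t = (\<integral>w. T t f w - m t \<partial>\<sigma>)"
        using integral_push[OF that(1) elim(4) i1(1)] i2 by (simp add: s.prob_space)
      also have "\<dots> = a / measure \<sigma> B * (\<integral>x. indicator B x * (T t f x - m t) \<partial>\<sigma>) + (1 - a) * (\<integral>x. T t f x - m t \<partial>\<rho>)"
        using i2 by (intro sp) auto
      also have "(\<integral>x. T t f x - m t \<partial>\<rho>) = (\<integral>y. f y \<partial>push \<rho> t) - m t"
        using integral_push[OF that(2) elim(4) i1(2)] i2 by (simp add: r.prob_space)
      finally have eq: "(\<integral>y. f y \<partial>push \<sigma> t) - m t
        = a / measure \<sigma> B * (\<integral>x. indicator B x * (T t f x - m t) \<partial>\<sigma>) + (1 - a) * ((\<integral>y. f y \<partial>push \<rho> t) - m t)" .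
      have "0 < measure \<sigma> B" using a that by linarith
      have "\<bar>a / measure \<sigma> B * (\<integral>x. indicator B x * (T t f x - m t) \<partial>\<sigma>)\<bar> \<le> a / measure \<sigma> B * (2 * e * measure \<sigma> B)"
        unfolding abs_mult using cl a \<open>0 < measure \<sigma> B\<close> by (intro mult_mono) auto
      also have "\<dots> = a * (2 * e)" using \<open>0 < measure \<sigma> B\<close> by simp
      finally show ?thesis using eq by blast
    qed
    obtain q1 where q1: "\<bar>q1\<bar> \<le> a * (2 * e)" "(\<integral>y. f y \<partial>push \<sigma>1 t) - m t = q1 + (1 - a) * ((\<integral>y. f y \<partial>push \<rho>1 t) - m t)"
      using dec[OF s1(1) r1(1) ui(1) rui(1) a'(1) r1(2) elim(2)] by blast
    obtain q2 where q2: "\<bar>q2\<bar> \<le> a * (2 * e)" "(\<integral>y. f y \<partial>push \<sigma>2 t) - m t = q2 + (1 - a) * ((\<integral>y. f y \<partial>push \<rho>2 t) - m t)"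
      using dec[OF s1(2) r2(1) ui(2) rui(2) a'(2) r2(2) elim(3)] by blast
    have "(\<integral>y. f y \<partial>push \<sigma>1 t) - (\<integral>y. f y \<partial>push \<sigma>2 t)
        = (q1 - q2) + (1 - a) * ((\<integral>y. f y \<partial>push \<rho>1 t) - (\<integral>y. f y \<partial>push \<rho>2 t))"
      using q1(2) q2(2) by (simp add: algebra_simps)
    also have "\<bar>\<dots>\<bar> \<le> a * (4 * e) + (1 - a) * (4 * e + (1 - a) ^ j * (2 * K) + c1 / (1 - a) + c2 / (1 - a))"
    proof -
      have "\<bar>(1 - a) * ((\<integral>y. f y \<partial>push \<rho>1 t) - (\<integral>y. f y \<partial>push \<rho>2 t))\<bar>
        \<le> (1 - a) * (4 * e + (1 - a) ^ j * (2 * K) + c1 / (1 - a) + c2 / (1 - a))"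
        unfolding abs_mult using a elim(1) by (intro mult_mono) auto
      then show ?thesis using q1(1) q2(1) by linarith
    qed
    also have "\<dots> = 4 * e + (1 - a) ^ Suc j * (2 * K) + c1 + c2"
    proof -
      have "(1 - a) * (c1 / (1 - a)) = c1" "(1 - a) * (c2 / (1 - a)) = c2" using a by auto
      then show ?thesis unfolding distrib_left by (simp add: algebra_simps)
    qed
    finally show ?case .
  qed
  \<comment> \<open>The estimate concerns the laws already advanced by \<open>s\<close>, so time is
    shifted back by \<open>s\<close>.\<close>
  then have "\<forall>\<^sub>F t in at_top. \<bar>(\<integral>y. f y \<partial>push \<sigma>1 (t - s)) - (\<integral>y. f y \<partial>push \<sigma>2 (t - s))\<bar>
    \<le> 4 * e + (1 - a) ^ Suc j * (2 * K) + c1 + c2"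
    by (rule eventually_compose_filterlim)
      (auto intro!: filterlim_tendsto_add_at_top[OF tendsto_const[of "- s"] filterlim_ident, simplified])
  then show ?case
    using eventually_ge_at_top[of s]
    by eventually_elim (simp add: \<sigma>1_def \<sigma>2_def push_push Suc.prems s)
qed

text \<open>The two upper limits unfolded: the radius is uniform, the time after which the estimate
  holds may depend on \<open>w\<close>.\<close>

definition ev_cont :: "('a \<Rightarrow> real) \<Rightarrow> 'a \<Rightarrow> bool" where
  "ev_cont f z \<longleftrightarrow> (\<forall>e>0. \<exists>d>0. \<forall>w\<in>ball z d. \<forall>\<^sub>F t in at_top. \<bar>T t f w - T t f z\<bar> < e)"

text \<open>The level \<open>\<alpha>\<close> is uniform in the starting point, the waiting time is
  not.\<close>

definition lower_bound :: "'a \<Rightarrow> bool" where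
  "lower_bound z \<longleftrightarrow> (\<forall>r>0. \<exists>\<alpha>>0. \<forall>x. \<forall>\<^sub>F t in at_top. \<alpha> \<le> measure (P t x) (ball z r))"

text \<open>For a general initial law the waiting times of its points have no common bound. The
  average shortfall below \<open>\<alpha>\<close> still tends to 0 by dominated convergence, so half
  of \<open>\<alpha>\<close> is eventually attained. The cap \<open>1 / 2\<close> keeps
  \<open>1 - a\<close> positive.\<close>

lemma lower_bound_push:
  assumes "lower_bound z" "0 < r"
  obtains a where "0 < a" "a < 1" "\<And>\<nu>. \<nu> \<in> borel_probs \<Longrightarrow> \<forall>\<^sub>F t in at_top. a \<le> measure (push \<nu> t) (ball z r)"
proof -
  obtain \<alpha> where \<alpha>: "0 < \<alpha>" "\<And>x. \<forall>\<^sub>F t in at_top. \<alpha> \<le> measure (P t x) (ball z r)"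
    using assms by (auto simp: lower_bound_def)
  define a where "a = min (\<alpha> / 2) (1 / 2)"
  have "\<forall>\<^sub>F t in at_top. a \<le> measure (push \<nu> t) (ball z r)" if \<nu>: "\<nu> \<in> borel_probs" for \<nu>
  proof -
    interpret prob_space \<nu> by (rule borel_probsD[OF \<nu>])
    define g where "g t x = measure (P t x) (ball z r)" for t x
    have gm [measurable]: "g (max 0 t) \<in> borel_measurable \<nu>" for t
      using measurable_T[of "max 0 t" "indicator (ball z r)", OF _ borel_measurable_indicator] borel_probsD(3)[OF P_prob[of "max 0 t"]]
      by (intro borel_measurable_on[OF \<nu>]) (simp add: T_def[abs_def] g_def[abs_def])
    have g01: "0 \<le> g (max 0 t) x" "g (max 0 t) x \<le> 1" for t x
      using prob_space.prob_le_1[OF borel_probsD(1)[OF P_prob[of "max 0 t" x]]] by (auto simp: g_def)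
    have lim: "((\<lambda>t. \<integral>x. max 0 (\<alpha> - g (max 0 t) x) \<partial>\<nu>) \<longlongrightarrow> (\<integral>x. 0 \<partial>\<nu>)) at_top"
    proof (rule integral_dominated_convergence_at_top[where w="\<lambda>_. \<alpha>"])
      show "AE x in \<nu>. ((\<lambda>t. max 0 (\<alpha> - g (max 0 t) x)) \<longlongrightarrow> 0) at_top"
      proof (intro AE_I2)
        fix x
        have "\<forall>\<^sub>F t in at_top. max 0 (\<alpha> - g (max 0 t) x) = 0"
          using \<alpha>(2)[of x] eventually_ge_at_top[of 0] by eventually_elim (auto simp: g_def max_def)
        then show "((\<lambda>t. max 0 (\<alpha> - g (max 0 t) x)) \<longlongrightarrow> 0) at_top" by (rule tendsto_eventually)
      qed
      show "\<forall>\<^sub>F t in at_top. AE x in \<nu>. norm (max 0 (\<alpha> - g (max 0 t) x)) \<le> \<alpha>"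
        using g01 \<alpha>(1) by (intro always_eventually allI AE_I2) auto
    qed auto
    have "\<forall>\<^sub>F t in at_top. (\<integral>x. max 0 (\<alpha> - g (max 0 t) x) \<partial>\<nu>) < \<alpha> / 2"
      using order_tendstoD(2)[OF lim, of "\<alpha> / 2"] \<alpha>(1) by simp
    then show ?thesis
      using eventually_ge_at_top[of 0]
    proof eventually_elim
      case (elim t)
      then have t: "0 \<le> t" "max 0 t = t" by auto
      have gi: "integrable \<nu> (g t)"
        using gm[of t] g01[of t] t by (intro integrable_const_bound[where B=1]) auto
      have mi: "integrable \<nu> (\<lambda>x. max 0 (\<alpha> - g t x))"
        using gm[of t] g01[of t] t \<alpha>(1) by (intro integrable_const_bound[where B=\<alpha>]) auto
      have "\<alpha> - (\<integral>x. g t x \<partial>\<nu>) = (\<integral>x. \<alpha> - g t x \<partial>\<nu>)" using gi by (simp add: prob_space)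
      also have "\<dots> \<le> (\<integral>x. max 0 (\<alpha> - g t x) \<partial>\<nu>)" using gi mi by (intro integral_mono) auto
      also have "\<dots> < \<alpha> / 2" using elim t by simp
      finally show ?case using measure_push[OF \<nu> t(1), of "ball z r"] by (simp add: g_def[abs_def] a_def)
    qed
  qed
  moreover have "0 < a" "a < 1" using \<alpha>(1) by (auto simp: a_def)
  ultimately show ?thesis using that by blast
qed

text \<open>The iteration is run on a ball around \<open>z\<close> with reference
  \<open>T t f z\<close>; uniform integrability from \<open>z\<close> keeps this reference bounded
  in time.\<close>

lemma merging:
  fixes f :: "'a \<Rightarrow> real"
  assumes f: "f \<in> borel_measurable borel" and ec: "ev_cont f z" and lb: "lower_bound z"
    and z: "unif_integrable f (return borel z)"
    and \<nu>: "\<nu>1 \<in> borel_probs" "\<nu>2 \<in> borel_probs" "unif_integrable f \<nu>1" "unif_integrable f \<nu>2"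
  shows "((\<lambda>t. (\<integral>y. f y \<partial>push \<nu>1 t) - (\<integral>y. f y \<partial>push \<nu>2 t)) \<longlongrightarrow> 0) at_top"
proof (rule tendstoI)
  fix e :: real assume "0 < e"
  \<comment> \<open>The final estimate adds up to less than \<open>9 * e'\<close>: 4 from closeness
    on the ball, 1 from the geometric term, 2 from each tail.\<close>
  define e' where "e' = e / 16"
  have "0 < e'" using \<open>0 < e\<close> by (simp add: e'_def)
  obtain d where d: "0 < d" "\<And>w. w \<in> ball z d \<Longrightarrow> \<forall>\<^sub>F t in at_top. \<bar>T t f w - T t f z\<bar> < e'"
    using ec \<open>0 < e'\<close> by (auto simp: ev_cont_def)
  obtain a where a: "0 < a" "a < 1" and hit: "\<And>\<nu>. \<nu> \<in> borel_probs \<Longrightarrow> \<forall>\<^sub>F t in at_top. a \<le> measure (push \<nu> t) (ball z d)"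
    using lower_bound_push[OF lb d(1)] by metis
  obtain K0 where K0: "0 \<le> K0" "tail_bound f K0 1 (return borel z)"
    using z by (auto simp: unif_integrable_def dest: spec[of _ 1])
  have m: "\<bar>T t f z\<bar> \<le> K0 + 1" if "0 \<le> t" for t
    using tail_bound_integral_le[OF f K0(2) return_prob that K0(1)] that by (simp add: push_return T_def)
  obtain K1 where K1: "0 \<le> K1" "tail_bound f K1 (2 * e') \<nu>1"
    using \<nu>(3) \<open>0 < e'\<close> by (auto simp: unif_integrable_def dest: spec[of _ "2 * e'"])
  obtain K2 where K2: "0 \<le> K2" "tail_bound f K2 (2 * e') \<nu>2"
    using \<nu>(4) \<open>0 < e'\<close> by (auto simp: unif_integrable_def dest: spec[of _ "2 * e'"])
  define K where "K = max K1 K2"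
  have K: "0 \<le> K" "tail_bound f K (2 * e') \<nu>1" "tail_bound f K (2 * e') \<nu>2"
    using K1 K2 by (auto simp: K_def intro: tail_bound_mono)
  have "(\<lambda>j. (1 - a) ^ j * (2 * K)) \<longlonglongrightarrow> 0 * (2 * K)"
    using a by (intro tendsto_mult tendsto_const LIMSEQ_realpow_zero) auto
  from order_tendstoD(2)[OF this, of e'] obtain j where j: "(1 - a) ^ j * (2 * K) < e'"
    using \<open>0 < e'\<close> by (auto simp: eventually_sequentially)
  have "\<forall>\<^sub>F t in at_top. \<bar>(\<integral>y. f y \<partial>push \<nu>1 t) - (\<integral>y. f y \<partial>push \<nu>2 t)\<bar>
      \<le> 4 * e' + (1 - a) ^ j * (2 * K) + 2 * e' + 2 * e'"
    using \<open>0 < e'\<close> by (intro eventually_close_iterate[OF f _ a _ hit m d(2)] \<nu> K) auto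
  then show "\<forall>\<^sub>F t in at_top. dist ((\<integral>y. f y \<partial>push \<nu>1 t) - (\<integral>y. f y \<partial>push \<nu>2 t)) 0 < e"
    by eventually_elim (use j \<open>0 < e\<close> in \<open>simp add: e'_def\<close>)
qed

end

section \<open>Tightness\<close>

lemma small_cball_in_open:
  fixes x :: "'a::metric_space"
  assumes "open S" "x \<in> S" "0 < c"
  obtains r where "0 < r" "r \<le> c" "cball x r \<subseteq> S"
proof -
  obtain e where e: "0 < e" "cball x e \<subseteq> S" using assms open_contains_cball by blast
  show ?thesis
    by (rule that[of "min e c"]) (use e assms in auto)
qed

text \<open>Cantor's intersection theorem for the closed balls. Since each closed ball lies in the
  previous open one, the common point lies in the open balls, where the strict inequalities of the
  constructions are arranged.\<close>

lemma nested_balls_meet: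
  fixes x :: "nat \<Rightarrow> 'a::complete_space"
  assumes "\<And>n. 0 < r n" "\<And>n. cball (x (Suc n)) (r (Suc n)) \<subseteq> ball (x n) (r n)" "\<And>n. r (Suc n) \<le> r n / 2"
  obtains y where "\<And>n. y \<in> ball (x n) (r n)"
proof -
  have sub: "cball (x (Suc n)) (r (Suc n)) \<subseteq> cball (x n) (r n)" for n
    using assms(2)[of n] ball_subset_cball by blast
  have mono: "cball (x n) (r n) \<subseteq> cball (x m) (r m)" if "m \<le> n" for m n
    using that by (rule lift_Suc_antimono_le[of "\<lambda>n. cball (x n) (r n)", OF sub])
  have geo: "r n \<le> r 0 * (1 / 2) ^ n" for n
  proof (induction n)
    case (Suc n)
    then show ?case using assms(3)[of n] by simp
  qed simp
  have "\<exists>n. \<forall>u\<in>cball (x n) (r n). \<forall>v\<in>cball (x n) (r n). dist u v < e" if "0 < e" for e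
  proof -
    have "(\<lambda>n. r 0 * (1 / 2) ^ n) \<longlonglongrightarrow> r 0 * 0"
      by (intro tendsto_mult tendsto_const LIMSEQ_realpow_zero) auto
    from order_tendstoD(2)[OF this, of "e / 2"] obtain n where "r 0 * (1 / 2) ^ n < e / 2"
      using \<open>0 < e\<close> by (auto simp: eventually_sequentially)
    then have "r n < e / 2" using geo[of n] by linarith
    then have "dist u v < e" if "u \<in> cball (x n) (r n)" "v \<in> cball (x n) (r n)" for u v
      using that dist_triangle3[of u v "x n"] by (simp add: dist_commute)
    then show ?thesis by blast
  qed
  then obtain y where y: "\<And>n. y \<in> cball (x n) (r n)"
    using decreasing_closed_nest[of "\<lambda>n. cball (x n) (r n)"] assms(1) mono
    by (metis closed_cball cball_eq_empty less_le_not_le order_less_imp_le)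
  show ?thesis by (rule that) (use y assms(2) in blast)
qed

lemma sum_disjoint_le:
  fixes g :: "'b \<Rightarrow> real"
  assumes "finite A" "\<And>i j. i \<in> A \<Longrightarrow> j \<in> A \<Longrightarrow> i \<noteq> j \<Longrightarrow> g i = 0 \<or> g j = 0" "\<And>i. i \<in> A \<Longrightarrow> g i \<le> c" "0 \<le> c"
  shows "sum g A \<le> c"
proof (cases "\<exists>i\<in>A. g i \<noteq> 0")
  case True
  then obtain i where i: "i \<in> A" "g i \<noteq> 0" by blast
  have "sum g (A - {i}) = 0" using assms(2) i by (intro sum.neutral) auto
  then have "sum g A = g i" using sum.remove[OF assms(1) i(1), of g] by simp
  then show ?thesis using assms(3) i by simp
next
  case False
  then show ?thesis using assms(4) by (simp add: sum.neutral)
qed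

text \<open>Distance to a finite initial part of the sequence \<open>d\<close>; index
  \<open>I\<close> is included, so the minimum is never over an empty set. Its sublevel sets are the
  finite unions of balls in terms of which tightness is phrased.\<close>

definition near_dist :: "(nat \<Rightarrow> 'a::metric_space) \<Rightarrow> nat \<Rightarrow> 'a \<Rightarrow> real" where
  "near_dist d I x = Min ((\<lambda>i. dist x (d i)) ` {..I})"

lemma near_dist_less_iff: "near_dist d I x < r \<longleftrightarrow> (\<exists>i\<le>I. dist x (d i) < r)"
  by (auto simp: near_dist_def Min_less_iff)

lemma near_dist_antimono: "I \<le> J \<Longrightarrow> near_dist d J x \<le> near_dist d I x"
  unfolding near_dist_def by (intro Min_antimono) auto

lemma near_dist_lipschitz: "\<bar>near_dist d I x - near_dist d I y\<bar> \<le> dist x y"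
proof -
  have "near_dist d I x \<le> near_dist d I y + dist x y" for x y
  proof -
    have "near_dist d I y \<in> (\<lambda>i. dist y (d i)) ` {..I}" unfolding near_dist_def by (rule Min_in) auto
    then obtain i where i: "i \<le> I" "near_dist d I y = dist y (d i)" by auto
    have "near_dist d I x \<le> dist x (d i)" unfolding near_dist_def using i by (intro Min_le) auto
    then show ?thesis using i dist_triangle[of x "d i" y] by linarith
  qed
  from this[of x y] this[of y x] show ?thesis by (simp add: dist_commute abs_le_iff)
qed

lemma near_dist_measurable [measurable]: "near_dist d I \<in> borel_measurable borel"
proof (intro borel_measurable_continuous_onI lipschitz_on_continuous_on)
  show "1-lipschitz_on UNIV (near_dist d I)"
    by (rule lipschitz_onI) (auto simp: dist_real_def near_dist_lipschitz)
qed

text \<open>Equal to 1 on points at distance at least \<open>\<delta>\<close> from the first centres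
  up to \<open>I\<close> but within \<open>\<delta> / 4\<close> of those up to \<open>J\<close>.
  Both cutoffs vanish at the same threshold \<open>\<delta> / 2\<close>, so a bump starting at or
  beyond \<open>J\<close> is disjoint from this one. The slope is at most
  \<open>4 / \<delta>\<close> whatever \<open>I\<close> and \<open>J\<close> are, which keeps
  infinite combinations Lipschitz.\<close>

definition bump :: "(nat \<Rightarrow> 'a::metric_space) \<Rightarrow> real \<Rightarrow> nat \<Rightarrow> nat \<Rightarrow> 'a \<Rightarrow> real" where
  "bump d \<delta> I J x = min (ramp (\<delta> / 2) \<delta> (near_dist d I x)) (1 - ramp (\<delta> / 4) (\<delta> / 2) (near_dist d J x))"

lemma bump_range: "0 \<le> bump d \<delta> I J x" "bump d \<delta> I J x \<le> 1"
  using ramp_range by (auto simp: bump_def min_def)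

lemma bump_lipschitz:
  assumes "0 < \<delta>" shows "\<bar>bump d \<delta> I J x - bump d \<delta> I J y\<bar> \<le> 4 / \<delta> * dist x y"
proof -
  have 1: "\<bar>ramp (\<delta> / 2) \<delta> (near_dist d I x) - ramp (\<delta> / 2) \<delta> (near_dist d I y)\<bar> \<le> 4 / \<delta> * dist x y"
  proof -
    have "1 / (\<delta> - \<delta> / 2) * dist x y \<le> 4 / \<delta> * dist x y"
      using assms by (intro mult_right_mono) (auto simp: field_simps)
    then show ?thesis
      using ramp_lipschitz_comp[of "\<delta> / 2" \<delta> "near_dist d I" x y] assms near_dist_lipschitz by fastforce
  qed
  have 2: "\<bar>ramp (\<delta> / 4) (\<delta> / 2) (near_dist d J x) - ramp (\<delta> / 4) (\<delta> / 2) (near_dist d J y)\<bar> \<le> 4 / \<delta> * dist x y"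
    using ramp_lipschitz_comp[of "\<delta> / 4" "\<delta> / 2" "near_dist d J" x y] assms near_dist_lipschitz
    by (force simp: field_simps)
  show ?thesis using 1 2 by (auto simp: bump_def min_def)
qed

lemma bump_Lb: "0 < \<delta> \<Longrightarrow> bump d \<delta> I J \<in> Lb"
  by (rule LbI[where B=1, OF bump_lipschitz]) (auto simp: abs_of_nonneg bump_range)

lemma bump_eq_0: "0 < \<delta> \<Longrightarrow> near_dist d I x < \<delta> / 2 \<Longrightarrow> bump d \<delta> I J x = 0"
  using ramp_range[of "\<delta> / 4" "\<delta> / 2" "near_dist d J x"] by (simp add: bump_def ramp_eq_0)

lemma bump_eq_0': "0 < \<delta> \<Longrightarrow> \<delta> / 2 \<le> near_dist d J x \<Longrightarrow> bump d \<delta> I J x = 0"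
  using ramp_range[of "\<delta> / 2" \<delta> "near_dist d I x"] by (simp add: bump_def ramp_eq_1)

lemma bump_eq_1: "0 < \<delta> \<Longrightarrow> \<delta> \<le> near_dist d I x \<Longrightarrow> near_dist d J x \<le> \<delta> / 4 \<Longrightarrow> bump d \<delta> I J x = 1"
  by (simp add: bump_def ramp_eq_1 ramp_eq_0)

lemma bump_disjoint:
  assumes "0 < \<delta>" "J \<le> I'" shows "bump d \<delta> I J x = 0 \<or> bump d \<delta> I' J' x = 0"
proof (cases "near_dist d J x < \<delta> / 2")
  case True
  then have "near_dist d I' x < \<delta> / 2" using near_dist_antimono[OF assms(2), of d x] by linarith
  then show ?thesis using bump_eq_0 assms by blast
next
  case False
  then show ?thesis using bump_eq_0' assms by (metis not_le)
qed

text \<open>By density of \<open>d\<close> the sets increase to the whole space, so a single law is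
  concentrated near finitely many centres up to \<open>\<eta>\<close>.\<close>

lemma prob_near_dist:
  fixes \<nu> :: "'a::polish_space measure"
  assumes \<nu>: "\<nu> \<in> borel_probs" and dense: "\<And>x \<delta>. 0 < \<delta> \<Longrightarrow> \<exists>i. dist x (d i) < \<delta>" and "0 < r" "0 < \<eta>"
  obtains J where "I \<le> J" "1 - \<eta> < measure \<nu> {x. near_dist d J x < r}"
proof -
  interpret prob_space \<nu> by (rule borel_probsD[OF \<nu>])
  have sets: "{x. near_dist d J x < r} \<in> sets \<nu>" for J using borel_probsD(2)[OF \<nu>] by simp
  have "(\<lambda>J. measure \<nu> {x. near_dist d J x < r}) \<longlonglongrightarrow> measure \<nu> (\<Union>J. {x. near_dist d J x < r})"
  proof (rule finite_Lim_measure_incseq)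
    show "incseq (\<lambda>J. {x. near_dist d J x < r})"
      using near_dist_antimono by (fastforce simp: incseq_def intro: le_less_trans)
  qed (use sets in auto)
  moreover have "(\<Union>J. {x. near_dist d J x < r}) = space \<nu>"
    using dense[OF \<open>0 < r\<close>] by (fastforce simp: borel_probsD(3)[OF \<nu>] near_dist_less_iff)
  ultimately have "(\<lambda>J. measure \<nu> {x. near_dist d J x < r}) \<longlonglongrightarrow> 1" by (simp add: prob_space)
  from order_tendstoD(1)[OF this, of "1 - \<eta>"] obtain N where "\<And>J. N \<le> J \<Longrightarrow> 1 - \<eta> < measure \<nu> {x. near_dist d J x < r}"
    using \<open>0 < \<eta>\<close> by (auto simp: eventually_sequentially)
  then show ?thesis using that[of "max I N"] by simp
qed

text \<open>Almost every point lies in the support: by the Lindelof property the union of all null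
  balls is a union of countably many of them.\<close>

lemma AE_not_in_null_ball:
  fixes \<nu> :: "'a::polish_space measure"
  assumes \<nu>: "\<nu> \<in> borel_probs"
  shows "AE x in \<nu>. \<forall>r>0. 0 < measure \<nu> (ball x r)"
proof -
  interpret prob_space \<nu> by (rule borel_probsD[OF \<nu>])
  define \<F> where "\<F> = {ball y r | y r. measure \<nu> (ball y r) = 0}"
  obtain \<F>' where F': "\<F>' \<subseteq> \<F>" "countable \<F>'" "\<Union>\<F>' = \<Union>\<F>"
    by (rule Lindelof[of \<F>]) (auto simp: \<F>_def)
  have "S \<in> null_sets \<nu>" if "S \<in> \<F>'" for S
    using that F'(1) borel_probsD(2)[OF \<nu>] by (auto simp: \<F>_def emeasure_eq_measure intro!: null_setsI)
  then have "(\<Union>S\<in>\<F>'. S) \<in> null_sets \<nu>" by (intro null_sets_UN' F'(2)) auto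
  moreover have "y \<in> \<Union>\<F>" if "0 < r" "\<not> 0 < measure \<nu> (ball y r)" for y r
  proof -
    have "ball y r \<in> \<F>" using that by (auto simp: \<F>_def not_less measure_le_0_iff)
    then show ?thesis using \<open>0 < r\<close> by (meson UnionI centre_in_ball)
  qed
  ultimately show ?thesis using F'(3) by (intro AE_I'[of "\<Union>\<F>"]) auto
qed

context feller_semigroup
begin

section \<open>Kernel estimates for test functions and the points charged from
  \<open>z\<close>\<close>

lemma T_continuous: "f \<in> Lb \<Longrightarrow> 0 \<le> t \<Longrightarrow> continuous_on UNIV (T t f)"
  unfolding T_def[abs_def] using feller Lb_continuous Lb_bounded by blast

lemma P_nat_prob: "P (real n) x \<in> borel_probs"
  by (rule P_prob) simp

lemma Lb_integrable_P: "f \<in> Lb \<Longrightarrow> 0 \<le> t \<Longrightarrow> integrable (P t x) f"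
  using Lb_integrable borel_probsD[OF P_prob] by blast

lemma T_mono: "integrable (P t x) f \<Longrightarrow> integrable (P t x) g \<Longrightarrow> (\<And>y. f y \<le> g y) \<Longrightarrow> T t f x \<le> T t g x"
  unfolding T_def by (rule integral_mono)

lemma integrable_indicator_P: "0 \<le> t \<Longrightarrow> A \<in> sets borel \<Longrightarrow> integrable (P t x) (indicator A :: 'a \<Rightarrow> real)"
  by (rule integrable_bounded_prob[OF P_prob, where B=1]) (auto simp: indicator_def)

lemma T_indicator: "0 \<le> t \<Longrightarrow> T t (indicator A) x = measure (P t x) A"
  by (simp add: T_def borel_probsD(3)[OF P_prob])

lemma measure_le_T:
  assumes "0 \<le> t" "A \<in> sets borel" "integrable (P t x) f" "\<And>y. 0 \<le> f y" "\<And>y. y \<in> A \<Longrightarrow> 1 \<le> f y"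
  shows "measure (P t x) A \<le> T t f x"
  using T_mono[OF integrable_indicator_P[OF assms(1,2)] assms(3)] assms(4,5) T_indicator[OF assms(1)]
  by (simp add: indicator_def)

lemma T_le_measure:
  assumes "0 \<le> t" "A \<in> sets borel" "integrable (P t x) f" "\<And>y. f y \<le> 1" "\<And>y. y \<notin> A \<Longrightarrow> f y \<le> 0"
  shows "T t f x \<le> measure (P t x) A"
  using T_mono[OF assms(3) integrable_indicator_P[OF assms(1,2)]] assms(4,5) T_indicator[OF assms(1)]
  by (simp add: indicator_def)

text \<open>The closure of the union of the supports of the laws \<open>P (real n) z\<close>.
  Starting points are sought here because every neighbourhood of such a point is visited from
  \<open>z\<close> with positive probability.\<close>

definition reach :: "'a \<Rightarrow> 'a set" where
  "reach z = {y. \<forall>r>0. \<exists>n. 0 < measure (P (real n) z) (ball y r)}"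

lemma AE_reach: "AE x in P (real n) z. x \<in> reach z"
  using AE_not_in_null_ball[OF P_nat_prob[of n z]] by eventually_elim (auto simp: reach_def)

lemma lower_bound_reach:
  assumes "lower_bound z" shows "z \<in> reach z"
  unfolding reach_def
proof (intro CollectI allI impI)
  fix r :: real assume "0 < r"
  then obtain \<alpha> where \<alpha>: "0 < \<alpha>" "\<forall>\<^sub>F t in at_top. \<alpha> \<le> measure (P t z) (ball z r)"
    using assms by (auto simp: lower_bound_def)
  from eventually_compose_filterlim[OF \<alpha>(2) filterlim_real_sequentially] obtain n where "\<alpha> \<le> measure (P (real n) z) (ball z r)"
    by (auto simp: eventually_sequentially)
  then show "\<exists>n. 0 < measure (P (real n) z) (ball z r)" using \<alpha>(1) by (intro exI[of _ n]) linarith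
qed

text \<open>Chapman-Kolmogorov at time \<open>s\<close>; the law \<open>P (real s) z\<close> is
  carried by \<open>reach z\<close>, so a lower bound on that part of \<open>A\<close> is
  enough.\<close>

lemma T_ge_on_reach:
  assumes f: "f \<in> Lb" and f0: "\<And>y. 0 \<le> f y" and A: "A \<in> sets borel"
    and c: "\<And>y. y \<in> A \<Longrightarrow> y \<in> reach z \<Longrightarrow> c \<le> T (real k) f y"
  shows "c * measure (P (real s) z) A \<le> T (real (s + k)) f z"
proof -
  obtain B where B: "\<And>x. \<bar>f x\<bar> \<le> B" "0 \<le> B" using LbE[OF f] by metis
  have Tn: "0 \<le> T (real k) f x" for x unfolding T_def by (intro Bochner_Integration.integral_nonneg f0)
  have Ti: "integrable (P (real s) z) (T (real k) f)"
    using T_bounded[of "real k" f B] B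
    by (intro integrable_bounded_prob[OF P_prob, where B=B] measurable_T Lb_measurable[OF f]) auto
  have "c * measure (P (real s) z) A = (\<integral>x. c * indicator A x \<partial>P (real s) z)"
    using T_indicator[of "real s" A z] by (simp add: T_def)
  also have "\<dots> \<le> (\<integral>x. T (real k) f x \<partial>P (real s) z)"
  proof (rule integral_mono_AE)
    show "integrable (P (real s) z) (\<lambda>x. c * indicator A x)"
      using A by (intro integrable_mult_right integrable_indicator_P) auto
    show "AE x in P (real s) z. c * indicator A x \<le> T (real k) f x"
      using AE_reach[where n=s and z=z] by eventually_elim (use c Tn in \<open>auto simp: indicator_def\<close>)
  qed (rule Ti)
  also have "\<dots> = T (real (s + k)) f z"
    using T_T[of "real s" "real k" f B z] B Lb_measurable[OF f] by (simp add: T_def[of "real s"])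
  finally show ?thesis .
qed

text \<open>Being charged at one time is upgraded to all late times. By the Feller property, points
  near \<open>z\<close> charge the ball in \<open>n\<close> steps with at least \<open>c\<close>; by
  the lower bound the process started at \<open>z\<close> is near \<open>z\<close> with mass at
  least \<open>\<alpha>\<close> at every late time. Hence the constant
  \<open>c * \<alpha>\<close>.\<close>

lemma reach_charged:
  assumes lb: "lower_bound z" and y: "y \<in> reach z" and "0 < r"
  obtains \<beta> s0 where "0 < \<beta>" "\<And>s. s0 \<le> s \<Longrightarrow> \<beta> \<le> measure (P (real s) z) (ball y r)"
proof -
  obtain h where h: "h \<in> Lb" and h01: "\<And>x. 0 \<le> h x" "\<And>x. h x \<le> 1"
    and h1: "\<And>x. x \<in> ball y (r / 2) \<Longrightarrow> h x = 1" and h0: "\<And>x. x \<notin> ball y r \<Longrightarrow> h x = 0"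
    by (rule ball_cutoff[OF \<open>0 < r\<close>]) blast
  obtain n where n: "0 < measure (P (real n) z) (ball y (r / 2))"
    using y \<open>0 < r\<close> by (auto simp: reach_def dest: spec[of _ "r / 2"])
  define c where "c = T (real n) h z / 2"
  have "measure (P (real n) z) (ball y (r / 2)) \<le> T (real n) h z"
    using h01 h1 by (intro measure_le_T Lb_integrable_P h) auto
  then have c: "0 < c" "c < T (real n) h z" using n by (auto simp: c_def)
  have "open {x. c < T (real n) h x}" by (intro open_Collect_less T_continuous h continuous_on_const) auto
  then obtain \<delta> where \<delta>: "0 < \<delta>" "ball z \<delta> \<subseteq> {x. c < T (real n) h x}"
    using c(2) by (metis (mono_tags, lifting) mem_Collect_eq open_contains_ball)
  obtain \<alpha> where \<alpha>: "0 < \<alpha>" "\<forall>\<^sub>F t in at_top. \<alpha> \<le> measure (P t z) (ball z \<delta>)"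
    using lb \<delta>(1) by (auto simp: lower_bound_def)
  from eventually_compose_filterlim[OF \<alpha>(2) filterlim_real_sequentially] obtain N where
    N: "\<And>s. N \<le> s \<Longrightarrow> \<alpha> \<le> measure (P (real s) z) (ball z \<delta>)" by (auto simp: eventually_sequentially)
  show ?thesis
  proof (rule that[of "c * \<alpha>" "N + n"])
    show "0 < c * \<alpha>" using c \<alpha> by simp
    fix s assume s: "N + n \<le> s"
    define s' where "s' = s - n"
    have s': "s = s' + n" "N \<le> s'" using s by (auto simp: s'_def)
    have "c * \<alpha> \<le> c * measure (P (real s') z) (ball z \<delta>)" using N[OF s'(2)] c by (intro mult_left_mono) auto
    also have "\<dots> \<le> T (real s) h z"
      unfolding s'(1) using \<delta>(2) h01 by (intro T_ge_on_reach h) (auto simp: subset_eq less_imp_le)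
    also have "\<dots> \<le> measure (P (real s) z) (ball y r)"
      using h01 h0 by (intro T_le_measure Lb_integrable_P h) auto
    finally show "c * \<alpha> \<le> measure (P (real s) z) (ball y r)" .
  qed
qed

context
  fixes z :: 'a
  assumes lb: "lower_bound z"
    and merge: "\<And>f x. f \<in> Lb \<Longrightarrow> ((\<lambda>t. T t f x - T t f z) \<longlongrightarrow> 0) at_top"
begin

lemma merge_seq:
  assumes "f \<in> Lb" shows "(\<lambda>n. T (real n) f x - T (real n) f z) \<longlonglongrightarrow> 0"
  by (rule filterlim_compose[OF merge[OF assms] filterlim_real_sequentially])

text \<open>A Baire category argument turns the pointwise merging into a locally uniform one.\<close>

lemma locally_uniform_merge:
  assumes f: "f \<in> Lb" and "0 < \<eta>" and x0: "x0 \<in> reach z" "0 < r0"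
  shows "\<exists>x r N. x \<in> reach z \<and> 0 < r \<and> ball x r \<subseteq> ball x0 r0 \<and>
    (\<forall>y k. y \<in> ball x r \<and> y \<in> reach z \<and> N \<le> k \<longrightarrow> \<bar>T (real k) f y - T (real k) f z\<bar> \<le> \<eta>)"
proof (rule ccontr)
  assume neg: "\<not> ?thesis"
  have bad: "\<exists>y k. y \<in> ball x r \<and> y \<in> reach z \<and> N \<le> k \<and> \<eta> < \<bar>T (real k) f y - T (real k) f z\<bar>"
    if "x \<in> reach z" "0 < r" "ball x r \<subseteq> ball x0 r0" for x r N
    using neg that by (metis not_le)
  define Inv where "Inv s \<longleftrightarrow> (case s of (x, r, k) \<Rightarrow> x \<in> reach z \<and> 0 < r \<and> ball x r \<subseteq> ball x0 r0)"
    for s :: "'a \<times> real \<times> nat"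
  define Step where "Step s s' \<longleftrightarrow> (case s of (x, r, k) \<Rightarrow> case s' of (x', r', k') \<Rightarrow>
      cball x' r' \<subseteq> ball x r \<and> r' \<le> r / 2 \<and> k < k' \<and> (\<forall>y\<in>ball x' r'. \<eta> < \<bar>T (real k') f y - T (real k') f z\<bar>))"
    for s s' :: "'a \<times> real \<times> nat"
  have "\<exists>s. \<forall>n. Inv (s n) \<and> Step (s n) (s (Suc n))"
  proof (rule dependent_nat_choice)
    show "\<exists>s. Inv s" using x0 by (intro exI[of _ "(x0, r0, 0)"]) (simp add: Inv_def)
    fix s :: "'a \<times> real \<times> nat" and n :: nat assume "Inv s"
    obtain x r k where s: "s = (x, r, k)" by (cases s)
    have xr: "x \<in> reach z" "0 < r" "ball x r \<subseteq> ball x0 r0" using \<open>Inv s\<close> by (auto simp: s Inv_def)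
    obtain x' k' where x': "x' \<in> ball x r" "x' \<in> reach z" "Suc k \<le> k'" "\<eta> < \<bar>T (real k') f x' - T (real k') f z\<bar>"
      using bad[OF xr] by blast
    \<comment> \<open>Feller continuity makes the failure at the fixed time \<open>k'\<close> an
      open condition, so it persists on a ball.\<close>
    define S where "S = {y. \<eta> < \<bar>T (real k') f y - T (real k') f z\<bar>} \<inter> ball x r"
    have "open S" unfolding S_def
      by (intro open_Int open_Collect_less continuous_intros T_continuous f) auto
    then obtain r' where r': "0 < r'" "r' \<le> r / 2" "cball x' r' \<subseteq> S"
      using x' xr by (elim small_cball_in_open[where c="r / 2" and x=x']) (auto simp: S_def)
    have "ball x' r' \<subseteq> S" using r'(3) ball_subset_cball by blast
    then show "\<exists>s'. Inv s' \<and> Step s s'"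
      using r' x' xr by (intro exI[of _ "(x', r', k')"]) (auto simp: s Inv_def Step_def S_def)
  qed
  then obtain s where s: "\<And>n. Inv (s n)" "\<And>n. Step (s n) (s (Suc n))" by blast
  define x r k where "x n = fst (s n)" and "r n = fst (snd (s n))" and "k n = snd (snd (s n))" for n
  have sn: "s n = (x n, r n, k n)" for n by (simp add: x_def r_def k_def)
  have r0: "0 < r n" for n using s(1)[of n] by (simp add: sn Inv_def)
  have st: "cball (x (Suc n)) (r (Suc n)) \<subseteq> ball (x n) (r n)" "r (Suc n) \<le> r n / 2" "k n < k (Suc n)"
    "\<And>y. y \<in> ball (x (Suc n)) (r (Suc n)) \<Longrightarrow> \<eta> < \<bar>T (real (k (Suc n))) f y - T (real (k (Suc n))) f z\<bar>" for n
    using s(2)[of n] by (auto simp: sn Step_def)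
  \<comment> \<open>At \<open>y\<close> the failure occurs at every one of the strictly increasing
    times, against pointwise merging.\<close>
  obtain y where y: "\<And>n. y \<in> ball (x n) (r n)" using nested_balls_meet[of r x] r0 st(1,2) by blast
  have "strict_mono k" using st(3) by (simp add: strict_mono_Suc_iff)
  from LIMSEQ_subseq_LIMSEQ[OF merge_seq[OF f, of y] this]
  have "(\<lambda>n. T (real (k n)) f y - T (real (k n)) f z) \<longlonglongrightarrow> 0" by (simp add: o_def)
  from LIMSEQ_D[OF this \<open>0 < \<eta>\<close>] obtain N where "\<bar>T (real (k (Suc N))) f y - T (real (k (Suc N))) f z\<bar> < \<eta>"
    by auto (meson le_Suc_eq le_refl)
  then show False using st(4)[OF y, of N] by linarith
qed

section \<open>The non-tight case, assumed for contradiction\<close>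

context
  fixes d :: "nat \<Rightarrow> 'a" and \<delta> \<epsilon> :: real
  assumes dense: "\<And>x \<delta>. 0 < \<delta> \<Longrightarrow> \<exists>i. dist x (d i) < \<delta>"
    and \<delta>: "0 < \<delta>" and \<epsilon>: "0 < \<epsilon>"
    and escape: "\<And>I. \<exists>n. measure (P (real n) z) {x. near_dist d I x < \<delta>} < 1 - \<epsilon>"
begin

lemma near_dist_mono_measure:
  assumes "0 \<le> t" "I \<le> J"
  shows "measure (P t x) {y. near_dist d I y < c} \<le> measure (P t x) {y. near_dist d J y < c}"
proof -
  interpret prob_space "P t x" by (rule borel_probsD[OF P_prob[OF assms(1)]])
  show ?thesis
    using near_dist_antimono[OF assms(2), of d] borel_probsD(2)[OF P_prob[OF assms(1)]]
    by (intro finite_measure_mono) (auto intro: le_less_trans)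
qed

text \<open>The finitely many laws up to time \<open>N\<close> are jointly concentrated near
  finitely many centres, so escape from a larger set of centres must happen later.\<close>

lemma escape_late: "\<exists>n\<ge>N. measure (P (real n) z) {x. near_dist d I x < \<delta>} < 1 - \<epsilon>"
proof -
  have "\<exists>J. 1 - \<epsilon> < measure (P (real n) z) {x. near_dist d J x < \<delta>}" for n
    using prob_near_dist[OF P_nat_prob[of n z] dense \<delta> \<epsilon>] by metis
  then obtain J where J: "\<And>n. 1 - \<epsilon> < measure (P (real n) z) {x. near_dist d (J n) x < \<delta>}" by metis
  define M where "M = Max (insert I (J ` {..N}))"
  have M: "I \<le> M" "\<And>n. n \<le> N \<Longrightarrow> J n \<le> M" by (auto simp: M_def intro!: Max_ge simp del: Max_insert)
  obtain n where n: "measure (P (real n) z) {x. near_dist d M x < \<delta>} < 1 - \<epsilon>" using escape by blast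
  have "N \<le> n"
  proof (rule ccontr)
    assume "\<not> N \<le> n"
    then show False using near_dist_mono_measure[where t="real n" and I="J n" and J=M and x=z and c=\<delta>] J[of n] n M(2)[of n] by simp
  qed
  moreover have "measure (P (real n) z) {x. near_dist d I x < \<delta>} < 1 - \<epsilon>"
    using near_dist_mono_measure[where t="real n" and I=I and J=M and x=z and c=\<delta>] n M(1) by simp
  ultimately show ?thesis by blast
qed

text \<open>More than \<open>\<epsilon>\<close> of the mass is at least \<open>\<delta>\<close> away
  from the centres up to \<open>I\<close>, and less than \<open>\<epsilon> / 8\<close> is lost by
  choosing \<open>J\<close> so large that the rest is within \<open>\<delta> / 4\<close> of the
  centres up to \<open>J\<close>.\<close>

lemma escape_bump: "\<exists>k J. N \<le> k \<and> I \<le> J \<and> 7 / 8 * \<epsilon> \<le> T (real k) (bump d \<delta> I J) z"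
proof -
  obtain k where k: "N \<le> k" "measure (P (real k) z) {x. near_dist d I x < \<delta>} < 1 - \<epsilon>"
    using escape_late by blast
  obtain J where J: "I \<le> J" "1 - \<epsilon> / 8 < measure (P (real k) z) {x. near_dist d J x < \<delta> / 4}"
    by (rule prob_near_dist[OF P_nat_prob[of k z] dense, where I=I and r="\<delta> / 4" and \<eta>="\<epsilon> / 8"]) (use \<delta> \<epsilon> in auto)
  interpret prob_space "P (real k) z" by (rule borel_probsD[OF P_prob]) simp
  have [measurable_cong]: "sets (P (real k) z) = sets borel" by (rule borel_probsD[OF P_prob]) simp
  have "measure (P (real k) z) {x. near_dist d J x < \<delta> / 4}
      \<le> measure (P (real k) z) ({x. \<delta> \<le> near_dist d I x \<and> near_dist d J x < \<delta> / 4} \<union> {x. near_dist d I x < \<delta>})"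
    by (rule finite_measure_mono) auto
  also have "\<dots> \<le> measure (P (real k) z) {x. \<delta> \<le> near_dist d I x \<and> near_dist d J x < \<delta> / 4}
      + measure (P (real k) z) {x. near_dist d I x < \<delta>}"
    by (rule measure_Un_le) auto
  also have "measure (P (real k) z) {x. \<delta> \<le> near_dist d I x \<and> near_dist d J x < \<delta> / 4} \<le> T (real k) (bump d \<delta> I J) z"
    using bump_range \<delta> by (intro measure_le_T Lb_integrable_P bump_Lb) (auto simp: bump_eq_1)
  finally show ?thesis using k J by (intro exI[of _ k] exI[of _ J]) auto
qed

text \<open>If every point of a charged ball sent mass \<open>\<epsilon> / 2\<close> into each of many disjoint bumps, then so
  would, at a common later time, the law started from \<open>z\<close>, up to a fixed factor; the total mass would
  exceed 1.\<close>

lemma bump_avoided: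
  assumes F: "F \<in> Lb" and x0: "x0 \<in> reach z" "0 < r0"
  obtains I' J k x where "I \<le> I'" "I' \<le> J" "N \<le> k" "x \<in> reach z" "x \<in> ball x0 r0"
    "7 / 8 * \<epsilon> \<le> T (real k) (bump d \<delta> I' J) z" "T (real k) (bump d \<delta> I' J) x \<le> \<epsilon> / 2"
    "\<bar>T (real k) F x - T (real k) F z\<bar> \<le> \<epsilon> / 16"
proof -
  obtain x r N' where x: "x \<in> reach z" "0 < r" "ball x r \<subseteq> ball x0 r0"
    and unif: "\<And>y k. y \<in> ball x r \<Longrightarrow> y \<in> reach z \<Longrightarrow> N' \<le> k \<Longrightarrow> \<bar>T (real k) F y - T (real k) F z\<bar> \<le> \<epsilon> / 16"
  proof -
    have "0 < \<epsilon> / 16" using \<epsilon> by simp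
    from locally_uniform_merge[OF F this x0] show ?thesis using that by blast
  qed
  obtain \<beta> s0 where \<beta>: "0 < \<beta>" "\<And>s. s0 \<le> s \<Longrightarrow> \<beta> \<le> measure (P (real s) z) (ball x r)"
    using reach_charged[OF lb x(1,2)] by blast
  \<comment> \<open>\<open>L\<close> bumps, each receiving mass at least
    \<open>\<epsilon> / 2 * \<beta>\<close>, would together receive more than 1.\<close>
  obtain L :: nat where "1 / (\<epsilon> / 2 * \<beta>) < real L" using reals_Archimedean2 by blast
  then have L: "1 < real L * (\<epsilon> / 2 * \<beta>)" using \<epsilon> \<beta>(1) by (simp add: divide_simps)
  define Inv where "Inv s \<longleftrightarrow> (case s of (I', J, k) \<Rightarrow> I \<le> I' \<and> I' \<le> J \<and> max N N' \<le> k \<and> 7 / 8 * \<epsilon> \<le> T (real k) (bump d \<delta> I' J) z)"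
    for s :: "nat \<times> nat \<times> nat"
  have ex: "\<exists>s. Inv s \<and> I0 = fst s" if "I \<le> I0" for I0
    using escape_bump[of "max N N'" I0] that by (auto simp: Inv_def)
  have "\<exists>s. \<forall>n. Inv (s n) \<and> fst (snd (s n)) = fst (s (Suc n))"
  proof (rule dependent_nat_choice)
    show "\<exists>s. Inv s" using ex[of I] by blast
    fix s :: "nat \<times> nat \<times> nat" and n :: nat assume "Inv s"
    then have "I \<le> fst (snd s)" by (auto simp: Inv_def)
    then show "\<exists>s'. Inv s' \<and> fst (snd s) = fst s'" using ex by blast
  qed
  then obtain s where s: "\<And>n. Inv (s n)" "\<And>n. fst (snd (s n)) = fst (s (Suc n))" by blast
  define I' J k where "I' n = fst (s n)" and "J n = fst (snd (s n))" and "k n = snd (snd (s n))" for n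
  have sn: "s n = (I' n, J n, k n)" for n by (simp add: I'_def J_def k_def)
  have inv: "I \<le> I' n" "I' n \<le> J n" "N \<le> k n" "N' \<le> k n" "7 / 8 * \<epsilon> \<le> T (real (k n)) (bump d \<delta> (I' n) (J n)) z" for n
    using s(1)[of n] by (auto simp: sn Inv_def)
  \<comment> \<open>Each bump starts where the previous one ends, which makes them pairwise
    disjoint.\<close>
  have JI: "J n = I' (Suc n)" for n using s(2)[of n] by (simp add: sn)
  have I'_mono: "I' m \<le> I' n" if "m \<le> n" for m n
    using that by (rule lift_Suc_mono_le[rotated]) (use inv(2) JI in metis)
  have JI': "J m \<le> I' n" if "m < n" for m n using I'_mono[of "Suc m" n] that JI by simp
  define b where "b n = bump d \<delta> (I' n) (J n)" for n
  have bL: "b n \<in> Lb" and b01: "0 \<le> b n y" "b n y \<le> 1" for n y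
    using bump_Lb[OF \<delta>] bump_range by (auto simp: b_def)
  have disj: "b m y = 0 \<or> b n y = 0" if "m \<noteq> n" for m n y
  proof (cases "m < n")
    case True
    show ?thesis unfolding b_def by (rule bump_disjoint[OF \<delta> JI'[OF True]])
  next
    case False
    then have "n < m" using that by simp
    from JI'[OF this] have "b n y = 0 \<or> b m y = 0" unfolding b_def by (rule bump_disjoint[OF \<delta>])
    then show ?thesis by blast
  qed
  have "\<exists>i<L. \<exists>y\<in>ball x r. y \<in> reach z \<and> T (real (k i)) (b i) y \<le> \<epsilon> / 2"
  proof (rule ccontr)
    assume "\<not> ?thesis"
    then have neg: "\<And>i y. i < L \<Longrightarrow> y \<in> ball x r \<Longrightarrow> y \<in> reach z \<Longrightarrow> \<epsilon> / 2 \<le> T (real (k i)) (b i) y"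
      by (meson less_imp_le not_le)
    \<comment> \<open>One time serves all \<open>L\<close> bumps: \<open>t - k i\<close> is at least
      \<open>s0\<close> for every \<open>i\<close>, so the ball is already charged when
      \<open>k i\<close> steps remain.\<close>
    define t where "t = s0 + (\<Sum>i<L. k i)"
    have low: "\<epsilon> / 2 * \<beta> \<le> T (real t) (b i) z" if i: "i < L" for i
    proof -
      have "k i \<le> (\<Sum>i<L. k i)" using i by (intro member_le_sum) auto
      then obtain u where u: "t = u + k i" "s0 \<le> u"
        by (metis t_def add.assoc add.commute le_add1 le_iff_add)
      have "\<epsilon> / 2 * \<beta> \<le> \<epsilon> / 2 * measure (P (real u) z) (ball x r)"
        using \<beta>(2)[OF u(2)] \<epsilon> by (intro mult_left_mono) auto
      also have "\<dots> \<le> T (real t) (b i) z"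
        unfolding u(1) by (rule T_ge_on_reach[OF bL b01(1)]) (use neg i in auto)
      finally show ?thesis .
    qed
    interpret prob_space "P (real t) z" by (rule borel_probsD[OF P_prob]) simp
    have bi: "integrable (P (real t) z) (b i)" for i by (rule Lb_integrable_P[OF bL]) simp
    have "real L * (\<epsilon> / 2 * \<beta>) = (\<Sum>i<L. \<epsilon> / 2 * \<beta>)" by simp
    also have "\<dots> \<le> (\<Sum>i<L. T (real t) (b i) z)" using low by (intro sum_mono) auto
    also have "\<dots> = (\<integral>y. (\<Sum>i<L. b i y) \<partial>P (real t) z)"
      unfolding T_def using bi by (subst Bochner_Integration.integral_sum) auto
    also have "\<dots> \<le> (\<integral>y. 1 \<partial>P (real t) z)"
      using bi disj b01 by (intro integral_mono sum_disjoint_le) auto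
    also have "\<dots> = 1" by (simp add: prob_space)
    finally show False using L by linarith
  qed
  then obtain i y where y: "y \<in> ball x r" "y \<in> reach z" "T (real (k i)) (b i) y \<le> \<epsilon> / 2" by blast
  show ?thesis
    by (rule that[of "I' i" "J i" "k i" y]) (use inv[of i] y x(3) unif[OF y(1,2) inv(4)] in \<open>auto simp: b_def\<close>)
qed

text \<open>The gliding hump: \<open>F\<close> collects the bumps chosen so far, and at the times
  \<open>k\<close> a gap between \<open>z\<close> and all points of the current ball is created. It
  survives in the limit function because later bumps can only help at \<open>z\<close>, while near
  the limit point they meet little mass.\<close>

lemma no_escape: False
proof -
  \<comment> \<open>\<open>\<psi> I\<close> dominates every bump starting at or beyond
    \<open>I\<close>, so its integral bounds the effect of all later choices at once.\<close>
  define \<psi> where "\<psi> I y = ramp (\<delta> / 4) (\<delta> / 2) (near_dist d I y)" for I y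
  have \<psi>L: "\<psi> I \<in> Lb" for I
    unfolding \<psi>_def using \<delta> by (intro Lb_ramp) (auto simp: near_dist_lipschitz)
  \<comment> \<open>The state records the current ball \<open>x\<close>, \<open>r\<close>, the sum
    \<open>F\<close>, the index \<open>I\<close> from which later bumps start, the time
    \<open>k\<close> of the last gap and the two indices of the last bump. The clause for
    \<open>n = 0\<close> fixes the empty sum at the start.\<close>
  define Inv where "Inv n s \<longleftrightarrow> (case s of (x, r, F, I, k, p) \<Rightarrow> x \<in> reach z \<and> 0 < r \<and> F \<in> Lb \<and> (n = 0 \<longrightarrow> F = (\<lambda>_. 0)))"
    for n :: nat and s :: "'a \<times> real \<times> ('a \<Rightarrow> real) \<times> nat \<times> nat \<times> nat \<times> nat"
  define Step where "Step s s' \<longleftrightarrow> (case s of (x, r, F, I, k, _) \<Rightarrow> case s' of (x', r', F', I', k', J1, J2) \<Rightarrow>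
      cball x' r' \<subseteq> ball x r \<and> r' \<le> r / 2 \<and> k < k' \<and> I \<le> J1 \<and> J1 \<le> J2 \<and> J2 \<le> I' \<and>
      F' = (\<lambda>y. F y + bump d \<delta> J1 J2 y) \<and>
      (\<forall>y\<in>ball x' r'. \<epsilon> / 4 < T (real k') F' z - T (real k') F' y \<and> T (real k') (\<psi> I') y < \<epsilon> / 8))"
    for s s' :: "'a \<times> real \<times> ('a \<Rightarrow> real) \<times> nat \<times> nat \<times> nat \<times> nat"
  have "\<exists>s. \<forall>n. Inv n (s n) \<and> Step (s n) (s (Suc n))"
  proof (rule dependent_nat_choice)
    show "\<exists>s. Inv 0 s"
      using lower_bound_reach[OF lb] by (intro exI[of _ "(z, 1, \<lambda>_. 0, 0, 0, 0, 0)"]) (simp add: Inv_def)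
    fix s :: "'a \<times> real \<times> ('a \<Rightarrow> real) \<times> nat \<times> nat \<times> nat \<times> nat" and n :: nat
    assume "Inv n s"
    obtain x r F I k p where s: "s = (x, r, F, I, k, p)" by (cases s)
    have x: "x \<in> reach z" "0 < r" and F: "F \<in> Lb" using \<open>Inv n s\<close> by (auto simp: s Inv_def)
    obtain J1 J2 k' x' where J: "I \<le> J1" "J1 \<le> J2" "Suc k \<le> k'" "x' \<in> reach z" "x' \<in> ball x r"
      "7 / 8 * \<epsilon> \<le> T (real k') (bump d \<delta> J1 J2) z" "T (real k') (bump d \<delta> J1 J2) x' \<le> \<epsilon> / 2"
      "\<bar>T (real k') F x' - T (real k') F z\<bar> \<le> \<epsilon> / 16"
      by (rule bump_avoided[OF F x, of I "Suc k"])
    define F' where "F' y = F y + bump d \<delta> J1 J2 y" for y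
    have F': "F' \<in> Lb" unfolding F'_def by (intro Lb_add F bump_Lb \<delta>)
    have TF': "T (real k') F' y = T (real k') F y + T (real k') (bump d \<delta> J1 J2) y" for y
      unfolding T_def F'_def by (intro Bochner_Integration.integral_add Lb_integrable_P F bump_Lb \<delta>) auto
    obtain I' where I': "J2 \<le> I'" "1 - \<epsilon> / 8 < measure (P (real k') x') {y. near_dist d I' y < \<delta> / 4}"
      by (rule prob_near_dist[OF P_nat_prob[of k' x'] dense, where I=J2 and r="\<delta> / 4" and \<eta>="\<epsilon> / 8"]) (use \<delta> \<epsilon> in auto)
    interpret prob_space "P (real k') x'" by (rule borel_probsD[OF P_prob]) simp
    have "T (real k') (\<psi> I') x' \<le> measure (P (real k') x') (space (P (real k') x') - {y. near_dist d I' y < \<delta> / 4})"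
      using ramp_range \<delta> borel_probsD(3)[OF P_prob[of "real k'" x']]
      by (intro T_le_measure Lb_integrable_P \<psi>L) (auto simp: \<psi>_def ramp_eq_0)
    also have "\<dots> = 1 - measure (P (real k') x') {y. near_dist d I' y < \<delta> / 4}"
      using borel_probsD(2)[OF P_prob[of "real k'" x']] by (intro prob_compl) simp
    finally have chi: "T (real k') (\<psi> I') x' < \<epsilon> / 8" using I'(2) by simp
    define S where "S = {y. \<epsilon> / 4 < T (real k') F' z - T (real k') F' y} \<inter> {y. T (real k') (\<psi> I') y < \<epsilon> / 8} \<inter> ball x r"
    have "open S" unfolding S_def
      by (intro open_Int open_Collect_less continuous_intros T_continuous F' \<psi>L) auto
    \<comment> \<open>\<open>7 / 8 - 1 / 2 - 1 / 16\<close> is \<open>5 / 16\<close>, which exceeds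
      \<open>1 / 4\<close>.\<close>
    moreover have "\<epsilon> / 4 < T (real k') F' z - T (real k') F' x'"
      using J(6-8) \<epsilon> unfolding TF' by linarith
    then have "x' \<in> S" using chi J(5) by (auto simp: S_def)
    ultimately obtain r' where r': "0 < r'" "r' \<le> r / 2" "cball x' r' \<subseteq> S"
      using x by (elim small_cball_in_open[where c="r / 2" and x=x']) auto
    have "ball x' r' \<subseteq> S" using r'(3) ball_subset_cball by blast
    then show "\<exists>s'. Inv (Suc n) s' \<and> Step s s'"
      using r' J F' I' by (intro exI[of _ "(x', r', F', I', k', J1, J2)"]) (auto simp: s Inv_def Step_def S_def F'_def)
  qed
  then obtain s where s: "\<And>n. Inv n (s n)" "\<And>n. Step (s n) (s (Suc n))" by blast
  define x r F I k J1 J2 where "x n = fst (s n)" and "r n = fst (snd (s n))" and "F n = fst (snd (snd (s n)))"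
    and "I n = fst (snd (snd (snd (s n))))" and "k n = fst (snd (snd (snd (snd (s n)))))"
    and "J1 n = fst (snd (snd (snd (snd (snd (s n))))))" and "J2 n = snd (snd (snd (snd (snd (snd (s n))))))" for n
  have sn: "s n = (x n, r n, F n, I n, k n, J1 n, J2 n)" for n
    by (simp add: x_def r_def F_def I_def k_def J1_def J2_def)
  have inv: "0 < r n" "F n \<in> Lb" for n using s(1)[of n] by (simp_all add: sn Inv_def)
  have F0: "F 0 = (\<lambda>_. 0)" using s(1)[of 0] by (simp add: sn Inv_def)
  have st: "cball (x (Suc n)) (r (Suc n)) \<subseteq> ball (x n) (r n)" "r (Suc n) \<le> r n / 2" "k n < k (Suc n)"
    "I n \<le> J1 (Suc n)" "J1 (Suc n) \<le> J2 (Suc n)" "J2 (Suc n) \<le> I (Suc n)"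
    "F (Suc n) = (\<lambda>y. F n y + bump d \<delta> (J1 (Suc n)) (J2 (Suc n)) y)"
    "\<And>y. y \<in> ball (x (Suc n)) (r (Suc n)) \<Longrightarrow> \<epsilon> / 4 < T (real (k (Suc n))) (F (Suc n)) z - T (real (k (Suc n))) (F (Suc n)) y"
    "\<And>y. y \<in> ball (x (Suc n)) (r (Suc n)) \<Longrightarrow> T (real (k (Suc n))) (\<psi> (I (Suc n))) y < \<epsilon> / 8" for n
    using s(2)[of n] by (auto simp: sn Step_def)
  have I_Suc: "I n \<le> I (Suc n)" for n using st(4-6)[of n] by linarith
  have I_mono: "I m \<le> I n" if "m \<le> n" for m n
    using that by (rule lift_Suc_mono_le[of I, OF I_Suc])
  obtain y where y: "\<And>n. y \<in> ball (x n) (r n)" using nested_balls_meet[of r x] inv(1) st(1,2) by blast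
  define b where "b n = bump d \<delta> (J1 (Suc n)) (J2 (Suc n))" for n
  have b01: "0 \<le> b n u" "b n u \<le> 1" for n u using bump_range by (auto simp: b_def)
  have disj: "b m u = 0 \<or> b n u = 0" if "m \<noteq> n" for m n u
  proof -
    have *: "J2 (Suc m) \<le> J1 (Suc n)" if "m < n" for m n
      using st(6)[of m] I_mono[of "Suc m" n] st(4)[of n] that by simp
    show ?thesis
      using bump_disjoint[OF \<delta> *[of m n], of d "J1 (Suc m)" u "J2 (Suc n)"]
        bump_disjoint[OF \<delta> *[of n m], of d "J1 (Suc n)" u "J2 (Suc m)"] that
      unfolding b_def by (metis nat_neq_iff)
  qed
  have Fsum: "F n u = (\<Sum>i<n. b i u)" for n u
    by (induction n) (simp_all add: F0 st(7) b_def)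
  \<comment> \<open>At most one bump is nonzero at any point, so the supremum is the sum of all
    bumps; in this form the common Lipschitz constant is inherited directly.\<close>
  define f where "f u = (SUP n. b n u)" for u
  have bdd: "bdd_above (range (\<lambda>n. b n u))" for u using b01 by (intro bdd_aboveI2[where M=1]) auto
  have b_le_f: "b n u \<le> f u" for n u unfolding f_def by (rule cSUP_upper[OF _ bdd]) auto
  have f_le: "f u \<le> c" if "\<And>n. b n u \<le> c" for u c unfolding f_def by (rule cSUP_least) (auto simp: that)
  have f01: "0 \<le> f u" "f u \<le> 1" for u using b_le_f[of 0 u] b01(1)[of 0 u] f_le[of u 1] b01(2) by auto
  have fL: "f \<in> Lb"
  proof (rule LbI[where C="4 / \<delta>" and B=1])
    have "f u \<le> f v + 4 / \<delta> * dist u v" for u v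
    proof (rule f_le)
      show "b n u \<le> f v + 4 / \<delta> * dist u v" for n
        using bump_lipschitz[OF \<delta>, of d "J1 (Suc n)" "J2 (Suc n)" u v] b_le_f[of n v]
        by (simp add: b_def abs_le_iff)
    qed
    from this this show "\<bar>f u - f v\<bar> \<le> 4 / \<delta> * dist u v" for u v
      by (smt (verit) dist_commute)
    show "\<bar>f u\<bar> \<le> 1" for u using f01[of u] by simp
  qed
  have F_le_f: "F n u \<le> f u" for n u
    unfolding Fsum using disj b_le_f f01 by (intro sum_disjoint_le) auto
  \<comment> \<open>Within \<open>\<delta> / 2\<close> of the centres up to \<open>I (Suc n)\<close>
    all later bumps vanish; elsewhere \<open>\<psi>\<close> is 1 and dominates \<open>f\<close>
    trivially.\<close>
  have f_le_F: "f u \<le> F (Suc n) u + \<psi> (I (Suc n)) u" for n u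
  proof (cases "near_dist d (I (Suc n)) u < \<delta> / 2")
    case True
    have "f u \<le> F (Suc n) u"
    proof (rule f_le)
      fix m
      show "b m u \<le> F (Suc n) u"
      proof (cases "m \<le> n")
        case True
        then show ?thesis unfolding Fsum using b01 by (intro member_le_sum) auto
      next
        case False
        then have "I (Suc n) \<le> J1 (Suc m)" using I_mono[of "Suc n" m] st(4)[of m] by simp
        then have "near_dist d (J1 (Suc m)) u < \<delta> / 2"
          using True near_dist_antimono by (metis le_less_trans)
        then have "b m u = 0" unfolding b_def by (rule bump_eq_0[OF \<delta>])
        then show ?thesis unfolding Fsum using b01 by (simp add: sum_nonneg)
      qed
    qed
    then show ?thesis using ramp_range[of "\<delta> / 4" "\<delta> / 2"] by (simp add: \<psi>_def add_increasing2)
  next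
    case False
    then have "\<psi> (I (Suc n)) u = 1" using \<delta> by (simp add: \<psi>_def ramp_eq_1)
    moreover have "0 \<le> F (Suc n) u" unfolding Fsum using b01 by (simp add: sum_nonneg)
    ultimately show ?thesis using f01(2)[of u] by linarith
  qed
  \<comment> \<open>\<open>F \<le> f\<close> is used at \<open>z\<close> and
    \<open>f \<le> F + \<psi>\<close> at \<open>y\<close>; the gap \<open>\<epsilon> / 4\<close>
    loses at most \<open>\<epsilon> / 8\<close>.\<close>
  have gap: "\<epsilon> / 8 < T (real (k (Suc n))) f z - T (real (k (Suc n))) f y" for n
  proof -
    let ?k = "real (k (Suc n))"
    note li = Lb_integrable_P[OF fL] Lb_integrable_P[OF inv(2)] Lb_integrable_P[OF \<psi>L]
    have "T ?k (F (Suc n)) z \<le> T ?k f z" using li F_le_f by (intro T_mono) auto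
    moreover have "T ?k f y \<le> T ?k (\<lambda>u. F (Suc n) u + \<psi> (I (Suc n)) u) y"
      using li f_le_F by (intro T_mono) auto
    moreover have "\<dots> = T ?k (F (Suc n)) y + T ?k (\<psi> (I (Suc n))) y"
      unfolding T_def using li by (intro Bochner_Integration.integral_add) auto
    ultimately show ?thesis using st(8,9)[OF y, of n] by linarith
  qed
  have "strict_mono k" using st(3) by (simp add: strict_mono_Suc_iff)
  from LIMSEQ_subseq_LIMSEQ[OF merge_seq[OF fL, of y] this]
  have "(\<lambda>n. T (real (k n)) f y - T (real (k n)) f z) \<longlonglongrightarrow> 0" by (simp add: o_def)
  from LIMSEQ_D[OF this, of "\<epsilon> / 8"] obtain N where "\<bar>T (real (k (Suc N))) f y - T (real (k (Suc N))) f z\<bar> < \<epsilon> / 8"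
    using \<epsilon> by auto (meson le_Suc_eq le_refl)
  then show False using gap[of N] by linarith
qed

end

lemma tight:
  fixes d :: "nat \<Rightarrow> 'a"
  assumes dense: "\<And>x \<delta>. 0 < \<delta> \<Longrightarrow> \<exists>i. dist x (d i) < \<delta>" and "0 < \<delta>" "0 < \<epsilon>"
  shows "\<exists>I. \<forall>n. 1 - \<epsilon> \<le> measure (P (real n) z) (\<Union>i<I. ball (d i) \<delta>)"
proof (rule ccontr)
  assume neg: "\<not> ?thesis"
  \<comment> \<open>\<open>near_dist d I\<close> includes index \<open>I\<close>, hence
    \<open>Suc I\<close> balls.\<close>
  have "{x. near_dist d I x < \<delta>} = (\<Union>i<Suc I. ball (d i) \<delta>)" for I
    by (auto simp: near_dist_less_iff less_Suc_eq_le dist_commute)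
  with neg have "\<exists>n. measure (P (real n) z) {x. near_dist d I x < \<delta>} < 1 - \<epsilon>" for I
    by (metis not_le)
  from no_escape[OF dense \<open>0 < \<delta>\<close> \<open>0 < \<epsilon>\<close> this] show False by simp
qed

end

end

section \<open>The invariant measure\<close>

lemma dense_sequence:
  obtains d :: "nat \<Rightarrow> 'a::polish_space" where "\<And>x \<delta>. 0 < \<delta> \<Longrightarrow> \<exists>i. dist x (d i) < \<delta>"
proof -
  obtain D :: "'a set" where D: "countable D" "\<And>X. open X \<Longrightarrow> X \<noteq> {} \<Longrightarrow> \<exists>d\<in>D. d \<in> X"
    by (rule countable_dense_setE) blast
  have "D \<noteq> {}" using D(2)[of UNIV] by auto
  have "\<exists>i. dist x (from_nat_into D i) < \<delta>" if "0 < \<delta>" for x \<delta>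
  proof -
    have "\<exists>y\<in>D. y \<in> ball x \<delta>" using D(2)[of "ball x \<delta>"] that by auto
    then obtain y where "y \<in> D" "dist x y < \<delta>" by auto
    then show ?thesis using from_nat_into_surj[OF D(1)] by metis
  qed
  then show ?thesis by (rule that)
qed

text \<open>Lipschitz minorants give the lower estimate for \<open>g\<close>, and the same applied
  to \<open>- g\<close> gives the upper one. This is needed for \<open>T t f\<close>, which the
  Feller property makes continuous but not Lipschitz.\<close>

lemma weak_convergence_continuous:
  fixes Q :: "nat \<Rightarrow> 'a::polish_space measure" and g :: "'a \<Rightarrow> real"
  assumes Q: "\<And>n. Q n \<in> borel_probs" and \<mu>: "\<mu> \<in> borel_probs"
    and conv: "\<And>f. f \<in> Lb \<Longrightarrow> (\<lambda>n. \<integral>x. f x \<partial>Q n) \<longlonglongrightarrow> (\<integral>x. f x \<partial>\<mu>)"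
    and g: "continuous_on UNIV g" "\<And>x. \<bar>g x\<bar> \<le> B"
  shows "(\<lambda>n. \<integral>x. g x \<partial>Q n) \<longlonglongrightarrow> (\<integral>x. g x \<partial>\<mu>)"
proof -
  have int: "integrable \<nu> h" if "\<nu> \<in> borel_probs" "continuous_on UNIV h" "\<And>x. \<bar>h x\<bar> \<le> B" for \<nu> and h :: "'a \<Rightarrow> real"
  proof -
    interpret prob_space \<nu> by (rule borel_probsD[OF that(1)])
    have "h \<in> borel_measurable borel" using that(2) by (rule borel_measurable_continuous_onI)
    then show ?thesis using that(3)
      by (intro integrable_const_bound[where B=B])
        (auto simp: measurable_cong_sets[OF borel_probsD(2)[OF that(1)] refl])
  qed
  have lower: "\<forall>\<^sub>F n in sequentially. (\<integral>x. h x \<partial>\<mu>) - e < (\<integral>x. h x \<partial>Q n)"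
    if h: "continuous_on UNIV h" "\<And>x. \<bar>h x\<bar> \<le> B" and e: "0 < e" for h :: "'a \<Rightarrow> real" and e
  proof -
    obtain G where G: "\<And>n. G n \<in> Lb" "\<And>n x. G n x \<le> h x" "\<And>n x. \<bar>G n x\<bar> \<le> B" "\<And>x. (\<lambda>n. G n x) \<longlonglongrightarrow> h x"
      using continuous_Lb_approx[OF h] by blast
    interpret prob_space \<mu> by (rule borel_probsD[OF \<mu>])
    have "(\<lambda>n. \<integral>x. G n x \<partial>\<mu>) \<longlonglongrightarrow> (\<integral>x. h x \<partial>\<mu>)"
      by (rule integral_dominated_convergence[where w="\<lambda>_. B"])
        (use G int[OF \<mu> h] Lb_integrable[OF G(1) borel_probsD(4,2)[OF \<mu>]] in \<open>auto intro: borel_measurable_integrable\<close>)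
    from order_tendstoD(1)[OF this, of "(\<integral>x. h x \<partial>\<mu>) - e"] obtain m where m: "(\<integral>x. h x \<partial>\<mu>) - e < (\<integral>x. G m x \<partial>\<mu>)"
      using e by (auto simp: eventually_sequentially)
    from order_tendstoD(1)[OF conv[OF G(1)] m] show ?thesis
    proof eventually_elim
      case (elim n)
      have "(\<integral>x. G m x \<partial>Q n) \<le> (\<integral>x. h x \<partial>Q n)"
        using int[OF Q h] Lb_integrable[OF G(1) borel_probsD(4,2)[OF Q]] G(2) by (intro integral_mono) auto
      then show ?case using elim by simp
    qed
  qed
  show ?thesis
  proof (rule tendstoI)
    fix e :: real assume e: "0 < e"
    have "\<forall>\<^sub>F n in sequentially. (\<integral>x. - g x \<partial>\<mu>) - e < (\<integral>x. - g x \<partial>Q n)"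
      using g e by (intro lower continuous_intros) auto
    with lower[OF g e]
    show "\<forall>\<^sub>F n in sequentially. dist (\<integral>x. g x \<partial>Q n) (\<integral>x. g x \<partial>\<mu>) < e"
      by eventually_elim (simp add: dist_real_def abs_less_iff)
  qed
qed

context feller_semigroup
begin

definition invariant :: "'a measure \<Rightarrow> bool" where
  "invariant \<mu> \<longleftrightarrow> \<mu> \<in> borel_probs \<and> (\<forall>t\<ge>0. push \<mu> t = \<mu>)"

lemma integral_push_return: "0 \<le> t \<Longrightarrow> (\<integral>y. f y \<partial>push (return borel x) t) = T t f x"
  by (simp add: push_return T_def)

context
  fixes z :: 'a
  assumes lb: "lower_bound z" and ec: "\<And>f. f \<in> Lb \<Longrightarrow> ev_cont f z"
begin

lemma merging_Lb:
  assumes "f \<in> Lb" "\<nu>1 \<in> borel_probs" "\<nu>2 \<in> borel_probs"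
  shows "((\<lambda>t. (\<integral>y. f y \<partial>push \<nu>1 t) - (\<integral>y. f y \<partial>push \<nu>2 t)) \<longlongrightarrow> 0) at_top"
proof -
  obtain B where "\<And>x. \<bar>f x\<bar> \<le> B" using LbE[OF assms(1)] by metis
  then have "unif_integrable f \<nu>" for \<nu> by (rule unif_integrable_bounded)
  then show ?thesis using assms by (intro merging[OF Lb_measurable ec lb]) auto
qed

lemma merging_Lb_points:
  assumes "f \<in> Lb" shows "((\<lambda>t. T t f x - T t f y) \<longlongrightarrow> 0) at_top"
proof (rule Lim_transform_eventually[OF merging_Lb[OF assms return_prob[of x] return_prob[of y]]])
  show "\<forall>\<^sub>F t in at_top. (\<integral>u. f u \<partial>push (return borel x) t) - (\<integral>u. f u \<partial>push (return borel y) t) = T t f x - T t f y"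
    using eventually_ge_at_top[of 0] by eventually_elim (simp add: integral_push_return)
qed

text \<open>A Krylov-Bogoliubov argument in which merging replaces time averages: the laws started
  from \<open>P t z\<close> and from \<open>z\<close> merge, so a weak limit of
  \<open>P (real (r n)) z\<close> is unchanged by \<open>push\<close> with \<open>t\<close>.\<close>

lemma exists_invariant: "\<exists>\<mu>. invariant \<mu>"
proof -
  obtain d :: "nat \<Rightarrow> 'a" where d: "\<And>x \<delta>. 0 < \<delta> \<Longrightarrow> \<exists>i. dist x (d i) < \<delta>" using dense_sequence by blast
  obtain r \<mu> where r: "strict_mono (r :: nat \<Rightarrow> nat)" and "prob_space \<mu>" "sets \<mu> = sets borel"
    and conv: "\<And>f. f \<in> Lb \<Longrightarrow> (\<lambda>n. \<integral>x. f x \<partial>P (real (r n)) z) \<longlonglongrightarrow> (\<integral>x. f x \<partial>\<mu>)"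
  proof (rule tight_imp_weakly_convergent_subseq[of "\<lambda>n. P (real n) z" d])
    show "\<exists>I. \<forall>n. 1 - \<epsilon> \<le> measure (P (real n) z) (\<Union>i<I. ball (d i) \<delta>)" if "0 < \<delta>" "0 < \<epsilon>" for \<delta> \<epsilon>
      by (rule tight[OF lb merging_Lb_points d that])
  qed (use d borel_probsD[OF P_nat_prob] in auto)
  have \<mu>: "\<mu> \<in> borel_probs" using \<open>prob_space \<mu>\<close> \<open>sets \<mu> = sets borel\<close> by (simp add: space_prob_algebra)
  have "push \<mu> t = \<mu>" if t: "0 \<le> t" for t
  proof (rule measure_eqI_Lb)
    fix f :: "'a \<Rightarrow> real" assume f: "f \<in> Lb"
    obtain B where B: "\<And>x. \<bar>f x\<bar> \<le> B" "0 \<le> B" using LbE[OF f] by metis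
    have 1: "(\<lambda>n. \<integral>x. T t f x \<partial>P (real (r n)) z) \<longlonglongrightarrow> (\<integral>x. T t f x \<partial>\<mu>)"
      by (rule weak_convergence_continuous[OF P_nat_prob \<mu> conv T_continuous[OF f t] T_bounded[OF t B]])
    have rt: "filterlim (\<lambda>n. real (r n)) at_top sequentially"
      by (rule filterlim_compose[OF filterlim_real_sequentially filterlim_subseq[OF r]])
    have 2: "(\<lambda>n. (\<integral>y. f y \<partial>push (P t z) (real (r n))) - (\<integral>y. f y \<partial>push (return borel z) (real (r n)))) \<longlonglongrightarrow> 0"
      by (rule filterlim_compose[OF merging_Lb[OF f P_prob[OF t] return_prob] rt])
    have "(\<integral>y. f y \<partial>push (P t z) (real (r n))) = (\<integral>x. T t f x \<partial>P (real (r n)) z)" for n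
    proof -
      have "push (P t z) (real (r n)) = push (P (real (r n)) z) t" using t by (simp add: push_P add.commute)
      moreover have "integrable (push (P (real (r n)) z) t) f"
        using B by (intro integrable_bounded_prob push_prob P_nat_prob t Lb_measurable f)
      ultimately show ?thesis using integral_push[OF P_nat_prob t] by simp
    qed
    with 2 have 3: "(\<lambda>n. (\<integral>x. T t f x \<partial>P (real (r n)) z) - (\<integral>x. f x \<partial>P (real (r n)) z)) \<longlonglongrightarrow> 0"
      by (simp add: integral_push_return T_def)
    have "(\<integral>x. T t f x \<partial>\<mu>) - (\<integral>x. f x \<partial>\<mu>) = 0"
      by (rule LIMSEQ_unique[OF tendsto_diff[OF 1 conv[OF f]] 3])
    moreover have "integrable (push \<mu> t) f"
      using B by (intro integrable_bounded_prob push_prob \<mu> t Lb_measurable f)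
    ultimately show "(\<integral>x. f x \<partial>push \<mu> t) = (\<integral>x. f x \<partial>\<mu>)" using integral_push[OF \<mu> t] by simp
  qed (use borel_probsD[OF \<mu>] borel_probsD[OF push_prob[OF \<mu> t]] in auto)
  then show ?thesis using \<mu> by (auto simp: invariant_def)
qed

text \<open>Two invariant laws merge, yet their integrals are constant in time.\<close>

lemma unique_invariant:
  assumes "invariant \<mu>" "invariant \<nu>" shows "\<mu> = \<nu>"
proof (rule measure_eqI_Lb)
  fix f :: "'a \<Rightarrow> real" assume f: "f \<in> Lb"
  have "((\<lambda>t. (\<integral>y. f y \<partial>push \<mu> t) - (\<integral>y. f y \<partial>push \<nu> t)) \<longlongrightarrow> 0) at_top"
    using assms by (intro merging_Lb f) (auto simp: invariant_def)
  moreover have "\<forall>\<^sub>F t in at_top. (\<integral>y. f y \<partial>push \<mu> t) - (\<integral>y. f y \<partial>push \<nu> t) = (\<integral>y. f y \<partial>\<mu>) - (\<integral>y. f y \<partial>\<nu>)"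
    using eventually_ge_at_top[of 0] by eventually_elim (use assms in \<open>simp add: invariant_def\<close>)
  ultimately have "((\<lambda>t::real. (\<integral>y. f y \<partial>\<mu>) - (\<integral>y. f y \<partial>\<nu>)) \<longlongrightarrow> 0) at_top"
    by (rule Lim_transform_eventually)
  then show "(\<integral>y. f y \<partial>\<mu>) = (\<integral>y. f y \<partial>\<nu>)" by (simp add: tendsto_const_iff)
qed (use assms borel_probsD in \<open>auto simp: invariant_def\<close>)

text \<open>For initial laws with bounded density with respect to \<open>\<mu>\<close> the convergence extends from
  \<open>Lb\<close> to all of \<open>L\<^sup>1(\<mu>)\<close>, without any continuity of \<open>f\<close>.\<close>

lemma convergence_bounded_density:
  fixes f :: "'a \<Rightarrow> real"
  assumes \<mu>: "invariant \<mu>" and \<nu>: "\<nu> \<in> borel_probs" and "0 \<le> C"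
    and le: "\<And>g. g \<in> borel_measurable borel \<Longrightarrow> (\<integral>\<^sup>+x. g x \<partial>\<nu>) \<le> ennreal C * (\<integral>\<^sup>+x. g x \<partial>\<mu>)"
    and f: "integrable \<mu> f"
  shows "((\<lambda>t. \<integral>y. f y \<partial>push \<nu> t) \<longlongrightarrow> (\<integral>y. f y \<partial>\<mu>)) at_top"
    and "0 \<le> t \<Longrightarrow> integrable (push \<nu> t) f"
proof -
  have \<mu>p: "\<mu> \<in> borel_probs" and inv: "\<And>t. 0 \<le> t \<Longrightarrow> push \<mu> t = \<mu>" using \<mu> by (auto simp: invariant_def)
  have fm: "f \<in> borel_measurable borel"
    using borel_measurable_integrable[OF f] by (simp add: measurable_cong_sets[OF borel_probsD(2)[OF \<mu>p] refl])
  \<comment> \<open>Invariance of \<open>\<mu>\<close> makes the density bound \<open>C\<close> hold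
    at all times with the same constant.\<close>
  have dom: "(\<integral>\<^sup>+y. g y \<partial>push \<nu> t) \<le> ennreal C * (\<integral>\<^sup>+y. g y \<partial>\<mu>)" if "0 \<le> t" "g \<in> borel_measurable borel" for g t
    using le[OF measurable_nn_T[OF that]] inv[OF that(1)] nn_integral_push[OF \<nu> that] nn_integral_push[OF \<mu>p that] by simp
  have int: "integrable (push \<nu> t) g" and int_le: "(\<integral>y. \<bar>g y\<bar> \<partial>push \<nu> t) \<le> C * (\<integral>y. \<bar>g y\<bar> \<partial>\<mu>)"
    if g: "integrable \<mu> g" and t: "0 \<le> t" for g :: "'a \<Rightarrow> real" and t
  proof -
    have gm: "g \<in> borel_measurable borel"
      using borel_measurable_integrable[OF g] by (simp add: measurable_cong_sets[OF borel_probsD(2)[OF \<mu>p] refl])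
    have "(\<integral>\<^sup>+y. ennreal \<bar>g y\<bar> \<partial>push \<nu> t) \<le> ennreal C * (\<integral>\<^sup>+y. ennreal \<bar>g y\<bar> \<partial>\<mu>)"
      using gm by (intro dom t) measurable
    also have "\<dots> = ennreal (C * (\<integral>y. \<bar>g y\<bar> \<partial>\<mu>))"
      using g \<open>0 \<le> C\<close> by (simp add: nn_integral_eq_integral ennreal_mult)
    finally have b: "(\<integral>\<^sup>+y. ennreal \<bar>g y\<bar> \<partial>push \<nu> t) \<le> ennreal (C * (\<integral>y. \<bar>g y\<bar> \<partial>\<mu>))" .
    show i: "integrable (push \<nu> t) g"
      using b by (intro integrableI_bounded borel_measurable_on[OF push_prob[OF \<nu> t] gm])
        (auto simp: top_unique less_top[symmetric])
    have "ennreal (\<integral>y. \<bar>g y\<bar> \<partial>push \<nu> t) \<le> ennreal (C * (\<integral>y. \<bar>g y\<bar> \<partial>\<mu>))"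
      using b i by (simp add: nn_integral_eq_integral)
    then show "(\<integral>y. \<bar>g y\<bar> \<partial>push \<nu> t) \<le> C * (\<integral>y. \<bar>g y\<bar> \<partial>\<mu>)"
      using \<open>0 \<le> C\<close> by (subst (asm) ennreal_le_iff) auto
  qed
  show "integrable (push \<nu> t) f" if "0 \<le> t" by (rule int[OF f that])
  show "((\<lambda>t. \<integral>y. f y \<partial>push \<nu> t) \<longlongrightarrow> (\<integral>y. f y \<partial>\<mu>)) at_top"
  proof (rule tendstoI)
    fix e :: real assume "0 < e"
    \<comment> \<open>Replacing \<open>f\<close> by \<open>g\<close> costs at most
      \<open>C * e'\<close> under the pushed law and \<open>e'\<close> under \<open>\<mu>\<close>,
      together \<open>e / 2\<close>; merging for \<open>g\<close> supplies the other half.\<close>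
    define e' where "e' = e / 2 / (C + 1)"
    have C1: "C + 1 \<noteq> 0" using \<open>0 \<le> C\<close> by linarith
    have e': "0 < e'" using \<open>0 < e\<close> \<open>0 \<le> C\<close> by (simp add: e'_def)
    have Ce': "(C + 1) * e' = e / 2"
      unfolding e'_def using C1 by (metis nonzero_mult_div_cancel_left times_divide_eq_right)
    obtain g where g: "g \<in> Lb" "(\<integral>x. \<bar>f x - g x\<bar> \<partial>\<mu>) < e'"
      using Lb_dense_L1[OF borel_probsD(4,2)[OF \<mu>p] f e'] by blast
    have gi: "integrable \<mu> g" by (rule Lb_integrable[OF g(1) borel_probsD(4,2)[OF \<mu>p]])
    have "\<forall>\<^sub>F t in at_top. \<bar>(\<integral>y. g y \<partial>push \<nu> t) - (\<integral>y. g y \<partial>push \<mu> t)\<bar> < e / 2"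
      using tendstoD[OF merging_Lb[OF g(1) \<nu> \<mu>p], of "e / 2"] \<open>0 < e\<close> by simp
    then show "\<forall>\<^sub>F t in at_top. dist (\<integral>y. f y \<partial>push \<nu> t) (\<integral>y. f y \<partial>\<mu>) < e"
      using eventually_ge_at_top[of 0]
    proof eventually_elim
      case (elim t)
      have "\<bar>(\<integral>y. f y \<partial>push \<nu> t) - (\<integral>y. g y \<partial>push \<nu> t)\<bar> = \<bar>\<integral>y. f y - g y \<partial>push \<nu> t\<bar>"
        using int[OF f elim(2)] int[OF gi elim(2)] by simp
      also have "\<dots> \<le> (\<integral>y. \<bar>f y - g y\<bar> \<partial>push \<nu> t)" by (rule integral_abs_bound)
      also have "\<dots> \<le> C * (\<integral>y. \<bar>f y - g y\<bar> \<partial>\<mu>)"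
        using f gi by (intro int_le elim) auto
      also have "\<dots> \<le> C * e'" using g(2) \<open>0 \<le> C\<close> by (intro mult_left_mono) auto
      finally have a: "\<bar>(\<integral>y. f y \<partial>push \<nu> t) - (\<integral>y. g y \<partial>push \<nu> t)\<bar> \<le> C * e'" .
      have "\<bar>(\<integral>y. g y \<partial>\<mu>) - (\<integral>y. f y \<partial>\<mu>)\<bar> = \<bar>\<integral>y. f y - g y \<partial>\<mu>\<bar>" using f gi by simp
      also have "\<dots> \<le> (\<integral>y. \<bar>f y - g y\<bar> \<partial>\<mu>)" by (rule integral_abs_bound)
      finally have b: "\<bar>(\<integral>y. g y \<partial>\<mu>) - (\<integral>y. f y \<partial>\<mu>)\<bar> < e'" using g(2) by simp
      have "C * e' + e' = e / 2" using Ce' by (simp add: distrib_right)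
      then show ?case using a b elim(1)[unfolded inv[OF elim(2)]] unfolding dist_real_def by linarith
    qed
  qed
qed

text \<open>Each point has some finite bound on the integrals of \<open>\<bar>f\<bar>\<close> along
  the times \<open>t n\<close>, so the sets \<open>E C\<close> exhaust the space and one has
  positive \<open>\<mu>\<close>-mass; \<open>\<nu>\<close> is \<open>\<mu>\<close> conditioned on
  it. Working along a sequence makes \<open>E C\<close> a countable intersection, hence
  measurable.\<close>

lemma bounded_density_start:
  fixes f :: "'a \<Rightarrow> real"
  assumes \<mu>: "invariant \<mu>" and f: "f \<in> borel_measurable borel" and ui: "\<And>x. unif_integrable f (return borel x)"
    and t: "\<And>n. 0 \<le> t n"
  obtains \<nu> C D where "\<nu> \<in> borel_probs" "0 \<le> C" "0 \<le> D"
    "\<And>g. g \<in> borel_measurable borel \<Longrightarrow> (\<integral>\<^sup>+x. g x \<partial>\<nu>) \<le> ennreal D * (\<integral>\<^sup>+x. g x \<partial>\<mu>)"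
    "AE y in \<nu>. \<forall>n::nat. (\<integral>\<^sup>+u. ennreal \<bar>f u\<bar> \<partial>P (t n) y) \<le> ennreal C"
proof -
  have \<mu>p: "\<mu> \<in> borel_probs" using \<mu> by (auto simp: invariant_def)
  interpret prob_space \<mu> by (rule borel_probsD[OF \<mu>p])
  note [measurable] = f and [measurable_cong] = borel_probsD(2)[OF \<mu>p]
  have [measurable]: "(\<lambda>y. \<integral>\<^sup>+u. ennreal \<bar>f u\<bar> \<partial>P (t n) y) \<in> borel_measurable borel" for n
    by (rule measurable_nn_T[OF t]) measurable
  define E where "E C = {y. \<forall>n. (\<integral>\<^sup>+u. ennreal \<bar>f u\<bar> \<partial>P (t n) y) \<le> ennreal (real C)}" for C :: nat
  have Em [measurable]: "E C \<in> sets borel" for C unfolding E_def by measurable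
  have "\<exists>C. y \<in> E C" for y
  proof -
    obtain K where K: "0 \<le> K" "tail_bound f K 1 (return borel y)"
      using ui[of y] by (auto simp: unif_integrable_def dest: spec[of _ 1])
    obtain C :: nat where C: "K + 1 \<le> real C" using real_arch_simple by blast
    have "(\<integral>\<^sup>+u. ennreal \<bar>f u\<bar> \<partial>P (t n) y) \<le> ennreal (real C)" for n
    proof -
      have "(\<integral>\<^sup>+u. ennreal \<bar>f u\<bar> \<partial>P (t n) y) \<le> ennreal (K + 1)"
        using tail_bound_nn[OF f K(2) return_prob t[of n] K(1)] by (simp add: push_return[OF t])
      also have "\<dots> \<le> ennreal (real C)" by (rule ennreal_leI[OF C])
      finally show ?thesis .
    qed
    then show ?thesis by (auto simp: E_def)
  qed
  then have un: "(\<Union>C. E C) = space \<mu>" by (auto simp: borel_probsD(3)[OF \<mu>p])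
  have "\<exists>C. emeasure \<mu> (E C) \<noteq> 0"
  proof (rule ccontr)
    assume "\<not> ?thesis"
    then have "emeasure \<mu> (\<Union>C. E C) = 0" by (intro emeasure_UN_eq_0) auto
    then show False using emeasure_space_1 un by simp
  qed
  then obtain C where C: "emeasure \<mu> (E C) \<noteq> 0" by blast
  define \<nu> where "\<nu> = uniform_measure \<mu> (E C)"
  have pos: "0 < measure \<mu> (E C)" using C by (simp add: emeasure_eq_measure zero_less_measure_iff)
  have \<nu>: "\<nu> \<in> borel_probs"
    using C by (auto simp: space_prob_algebra \<nu>_def borel_probsD(2)[OF \<mu>p] intro!: prob_space_uniform_measure)
  show ?thesis
  proof (rule that[OF \<nu>, of "real C" "1 / measure \<mu> (E C)"])
    show "AE y in \<nu>. \<forall>n. (\<integral>\<^sup>+u. ennreal \<bar>f u\<bar> \<partial>P (t n) y) \<le> ennreal (real C)"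
      unfolding \<nu>_def by (rule AE_uniform_measureI[OF _ AE_I2]) (measurable, simp add: E_def)
    fix g :: "'a \<Rightarrow> ennreal" assume [measurable]: "g \<in> borel_measurable borel"
    have "(\<integral>\<^sup>+x. g x \<partial>\<nu>) = (\<integral>\<^sup>+x. g x * indicator (E C) x \<partial>\<mu>) / emeasure \<mu> (E C)"
      unfolding \<nu>_def by (rule nn_integral_uniform_measure) measurable
    also have "\<dots> \<le> (\<integral>\<^sup>+x. g x \<partial>\<mu>) / emeasure \<mu> (E C)"
      by (intro divide_right_mono_ennreal nn_integral_mono) (auto simp: indicator_def)
    also have "\<dots> = ennreal (1 / measure \<mu> (E C)) * (\<integral>\<^sup>+x. g x \<partial>\<mu>)"
      using pos by (simp add: emeasure_eq_measure divide_ennreal_def inverse_ennreal inverse_eq_divide mult.commute)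
    finally show "(\<integral>\<^sup>+x. g x \<partial>\<nu>) \<le> ennreal (1 / measure \<mu> (E C)) * (\<integral>\<^sup>+x. g x \<partial>\<mu>)" .
  qed auto
qed

text \<open>The truncations \<open>h K\<close> are bounded, so their \<open>\<mu>\<close>-integrals
  are limits of integrals under \<open>push \<nu> (real n)\<close>. These never exceed
  \<open>C\<close>, which does not depend on \<open>K\<close>; Fatou's lemma removes the
  truncation.\<close>

lemma invariant_integrable:
  fixes f :: "'a \<Rightarrow> real"
  assumes \<mu>: "invariant \<mu>" and f: "f \<in> borel_measurable borel" and ui: "\<And>x. unif_integrable f (return borel x)"
  shows "integrable \<mu> f"
proof -
  have \<mu>p: "\<mu> \<in> borel_probs" using \<mu> by (auto simp: invariant_def)
  note [measurable] = f
  obtain \<nu> C D where \<nu>: "\<nu> \<in> borel_probs" and "0 \<le> C" "0 \<le> D"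
    and le: "\<And>g. g \<in> borel_measurable borel \<Longrightarrow> (\<integral>\<^sup>+x. g x \<partial>\<nu>) \<le> ennreal D * (\<integral>\<^sup>+x. g x \<partial>\<mu>)"
    and bd: "AE y in \<nu>. \<forall>n::nat. (\<integral>\<^sup>+u. ennreal \<bar>f u\<bar> \<partial>P (real n) y) \<le> ennreal C"
    by (rule bounded_density_start[OF \<mu> f ui, where t=real]) (simp, blast)
  interpret \<nu>: prob_space \<nu> by (rule borel_probsD[OF \<nu>])
  define h where "h K y = min \<bar>f y\<bar> (real K)" for K y
  have [measurable]: "h K \<in> borel_measurable borel" for K unfolding h_def by measurable
  have h0: "0 \<le> h K y" "\<bar>h K y\<bar> \<le> real K" for K y by (auto simp: h_def)
  have hi: "integrable \<rho> (h K)" if "\<rho> \<in> borel_probs" for \<rho> K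
    using h0 by (intro integrable_bounded_prob[OF that]) auto
  have hC: "(\<integral>\<^sup>+y. ennreal (h K y) \<partial>\<mu>) \<le> ennreal C" for K
  proof -
    have lim: "(\<lambda>n. \<integral>y. h K y \<partial>push \<nu> (real n)) \<longlonglongrightarrow> (\<integral>y. h K y \<partial>\<mu>)"
      by (rule filterlim_compose[OF convergence_bounded_density(1)[OF \<mu> \<nu> \<open>0 \<le> D\<close> le hi[OF \<mu>p]] filterlim_real_sequentially])
    have "(\<integral>y. h K y \<partial>push \<nu> (real n)) \<le> C" for n
    proof -
      have "ennreal (\<integral>y. h K y \<partial>push \<nu> (real n)) = (\<integral>\<^sup>+y. ennreal (h K y) \<partial>push \<nu> (real n))"
        using h0 by (intro nn_integral_eq_integral[symmetric] hi push_prob \<nu>) auto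
      also have "\<dots> \<le> (\<integral>\<^sup>+y. ennreal \<bar>f y\<bar> \<partial>push \<nu> (real n))"
        by (intro nn_integral_mono ennreal_leI) (auto simp: h_def)
      also have "\<dots> = (\<integral>\<^sup>+y. \<integral>\<^sup>+u. ennreal \<bar>f u\<bar> \<partial>P (real n) y \<partial>\<nu>)"
        by (intro nn_integral_push \<nu>) auto
      also have "\<dots> \<le> (\<integral>\<^sup>+y. ennreal C \<partial>\<nu>)" using bd by (intro nn_integral_mono_AE) auto
      also have "\<dots> = ennreal C" by (simp add: \<nu>.emeasure_space_1)
      finally show ?thesis using \<open>0 \<le> C\<close> by (subst (asm) ennreal_le_iff) auto
    qed
    then have "(\<integral>y. h K y \<partial>\<mu>) \<le> C" using LIMSEQ_le_const2[OF lim] by auto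
    moreover have "(\<integral>\<^sup>+y. ennreal (h K y) \<partial>\<mu>) = ennreal (\<integral>y. h K y \<partial>\<mu>)"
      using h0 hi[OF \<mu>p] by (intro nn_integral_eq_integral) auto
    ultimately show ?thesis by (simp add: ennreal_leI)
  qed
  have "(\<integral>\<^sup>+y. ennreal \<bar>f y\<bar> \<partial>\<mu>) = (\<integral>\<^sup>+y. liminf (\<lambda>K. ennreal (h K y)) \<partial>\<mu>)"
  proof (intro nn_integral_cong)
    fix y
    obtain K0 :: nat where K0: "\<bar>f y\<bar> \<le> real K0" using real_arch_simple by blast
    have "\<forall>\<^sub>F K in sequentially. ennreal (h K y) = ennreal \<bar>f y\<bar>"
      using eventually_ge_at_top[of K0] by eventually_elim (use K0 in \<open>auto simp: h_def min_def\<close>)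
    then have "(\<lambda>K. ennreal (h K y)) \<longlonglongrightarrow> ennreal \<bar>f y\<bar>" by (rule tendsto_eventually)
    then show "ennreal \<bar>f y\<bar> = liminf (\<lambda>K. ennreal (h K y))"
      by (intro lim_imp_Liminf[symmetric]) auto
  qed
  also have "\<dots> \<le> liminf (\<lambda>K. \<integral>\<^sup>+y. ennreal (h K y) \<partial>\<mu>)"
    by (intro nn_integral_liminf borel_measurable_on[OF \<mu>p]) measurable
  also have "\<dots> \<le> ennreal C"
    using hC by (intro Liminf_le) (auto intro: always_eventually)
  finally show ?thesis
    by (intro integrableI_bounded borel_measurable_on[OF \<mu>p f]) (auto simp: top_unique less_top[symmetric])
qed

text \<open>Merging makes \<open>T t f x - T t f y\<close> vanish for every \<open>y\<close>;
  averaging over \<open>y\<close> with respect to \<open>\<nu>\<close> is allowed by the uniform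
  bound \<open>C\<close>, and the average of \<open>T t f\<close> under \<open>\<nu>\<close> is
  already known to converge to the \<open>\<mu>\<close>-integral of \<open>f\<close>.\<close>

lemma convergence_unif_integrable:
  fixes f :: "'a \<Rightarrow> real"
  assumes \<mu>: "invariant \<mu>" and f: "f \<in> borel_measurable borel" and ui: "\<And>x. unif_integrable f (return borel x)"
    and ecf: "ev_cont f z"
  shows "((\<lambda>t. T t f x) \<longlongrightarrow> (\<integral>y. f y \<partial>\<mu>)) at_top"
proof (rule tendsto_at_topI_sequentially)
  fix X :: "nat \<Rightarrow> real" assume X: "filterlim X at_top sequentially"
  \<comment> \<open>Early terms of \<open>X\<close> may be negative, where the kernels are not
    controlled; eventually \<open>t\<close> and \<open>X\<close> agree.\<close>
  define t where "t n = max 0 (X n)" for n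
  have t0: "0 \<le> t n" for n by (simp add: t_def)
  have ev: "\<forall>\<^sub>F n in sequentially. t n = X n"
    using filterlim_at_top_dense[THEN iffD1, OF X, rule_format, of 0]
    by eventually_elim (simp add: t_def)
  have t: "filterlim t at_top sequentially"
    using filterlim_cong[OF refl refl ev] X by simp
  obtain \<nu> C D where \<nu>: "\<nu> \<in> borel_probs" and "0 \<le> C" "0 \<le> D"
    and le: "\<And>g. g \<in> borel_measurable borel \<Longrightarrow> (\<integral>\<^sup>+x. g x \<partial>\<nu>) \<le> ennreal D * (\<integral>\<^sup>+x. g x \<partial>\<mu>)"
    and bd: "AE y in \<nu>. \<forall>n::nat. (\<integral>\<^sup>+u. ennreal \<bar>f u\<bar> \<partial>P (t n) y) \<le> ennreal C"
    by (rule bounded_density_start[OF \<mu> f ui, where t=t]) (rule t0, blast)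
  interpret \<nu>: prob_space \<nu> by (rule borel_probsD[OF \<nu>])
  have lim_push: "((\<lambda>t. \<integral>y. f y \<partial>push \<nu> t) \<longlongrightarrow> (\<integral>y. f y \<partial>\<mu>)) at_top"
    by (rule convergence_bounded_density(1)[OF \<mu> \<nu> \<open>0 \<le> D\<close> _ invariant_integrable[OF \<mu> f ui]]) (rule le)
  have int_push: "integrable (push \<nu> (t n)) f" for n
    by (rule convergence_bounded_density(2)[OF \<mu> \<nu> \<open>0 \<le> D\<close> _ invariant_integrable[OF \<mu> f ui] t0]) (rule le)
  have lim\<nu>: "(\<lambda>n. \<integral>y. T (t n) f y \<partial>\<nu>) \<longlonglongrightarrow> (\<integral>y. f y \<partial>\<mu>)"
    using filterlim_compose[OF lim_push t] integral_push[OF \<nu> t0 int_push] by simp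
  obtain K where K: "0 \<le> K" "tail_bound f K 1 (return borel x)"
    using ui[of x] by (auto simp: unif_integrable_def dest: spec[of _ 1])
  have Tx: "\<bar>T (t n) f x\<bar> \<le> K + 1" for n
    using tail_bound_integral_le[OF f K(2) return_prob t0[of n] K(1)] by (simp add: integral_push_return[OF t0])
  have "(\<lambda>n. \<integral>y. T (t n) f x - T (t n) f y \<partial>\<nu>) \<longlonglongrightarrow> (\<integral>y. 0 \<partial>\<nu>)"
  proof (rule integral_dominated_convergence[where w="\<lambda>_. K + 1 + C"])
    show "(\<lambda>y. T (t n) f x - T (t n) f y) \<in> borel_measurable \<nu>" for n
      using borel_measurable_on[OF \<nu> measurable_T[OF t0 f]] by measurable
    show "AE y in \<nu>. (\<lambda>n. T (t n) f x - T (t n) f y) \<longlonglongrightarrow> 0"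
    proof (intro AE_I2)
      fix y
      have "(\<lambda>n. (\<integral>u. f u \<partial>push (return borel x) (t n)) - (\<integral>u. f u \<partial>push (return borel y) (t n))) \<longlonglongrightarrow> 0"
        by (rule filterlim_compose[OF merging[OF f ecf lb ui return_prob return_prob ui ui] t])
      then show "(\<lambda>n. T (t n) f x - T (t n) f y) \<longlonglongrightarrow> 0" by (simp add: integral_push_return[OF t0])
    qed
    show "AE y in \<nu>. norm (T (t n) f x - T (t n) f y) \<le> K + 1 + C" for n
      using bd
    proof eventually_elim
      case (elim y)
      have "\<bar>T (t n) f y\<bar> \<le> C"
      proof (cases "integrable (P (t n) y) f")
        case True
        have "ennreal \<bar>T (t n) f y\<bar> \<le> (\<integral>\<^sup>+u. ennreal \<bar>f u\<bar> \<partial>P (t n) y)"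
          unfolding T_def using integral_norm_bound_ennreal[OF True] by simp
        also have "\<dots> \<le> ennreal C" using elim by blast
        finally show ?thesis using \<open>0 \<le> C\<close> by simp
      next
        case False
        then show ?thesis using \<open>0 \<le> C\<close> by (simp add: T_def not_integrable_integral_eq)
      qed
      then show ?case using Tx[of n] by simp
    qed
  qed auto
  moreover have "(\<integral>y. T (t n) f x - T (t n) f y \<partial>\<nu>) = T (t n) f x - (\<integral>y. T (t n) f y \<partial>\<nu>)" for n
    using integrable_T[OF \<nu> t0 int_push] by (simp add: \<nu>.prob_space)
  ultimately have "(\<lambda>n. T (t n) f x - (\<integral>y. T (t n) f y \<partial>\<nu>)) \<longlonglongrightarrow> 0" by simp
  from tendsto_add[OF this lim\<nu>] have "(\<lambda>n. T (t n) f x) \<longlonglongrightarrow> (\<integral>y. f y \<partial>\<mu>)" by simp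
  then show "(\<lambda>n. T (X n) f x) \<longlonglongrightarrow> (\<integral>y. f y \<partial>\<mu>)"
    by (rule Lim_transform_eventually) (use ev in eventually_elim, simp)
qed

end

end

section \<open>The equivalence\<close>

lemma measurable_process:
  assumes "markov_family M F Phi Px" "0 \<le> t"
  shows "Phi t \<in> Px x \<rightarrow>\<^sub>M borel"
proof -
  have sets: "sets (Px x) = sets M" and F: "F t \<subseteq> sets M"
    and Phi: "\<And>A. A \<in> sets borel \<Longrightarrow> {\<omega> \<in> space M. Phi t \<omega> \<in> A} \<in> F t"
    using assms by (auto simp: markov_family_def)
  have sp: "space (Px x) = space M" by (rule sets_eq_imp_space_eq[OF sets])
  show ?thesis
  proof (rule measurableI)
    fix A :: "'b set" assume "A \<in> sets borel"
    moreover have "Phi t -` A \<inter> space (Px x) = {\<omega> \<in> space M. Phi t \<omega> \<in> A}" by (auto simp: sp)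
    ultimately show "Phi t -` A \<inter> space (Px x) \<in> sets (Px x)" using Phi F sets by auto
  qed simp
qed

text \<open>The Markov property with the whole space as conditioning event is the Chapman-Kolmogorov
  equation; measurability of the kernels comes from that of
  \<open>x \<mapsto> emeasure (Px x) A\<close>.\<close>

lemma feller_semigroup_trans_kernel:
  fixes Phi :: "real \<Rightarrow> 'w \<Rightarrow> 'a::polish_space"
  assumes "cadlag_feller_markov M F Phi Px"
  shows "feller_semigroup (trans_kernel Px Phi)"
proof -
  have mf: "markov_family M F Phi Px" and fe: "feller Px Phi"
    using assms by (auto simp: cadlag_feller_markov_def)
  have prob: "prob_space (Px x)" and sets: "sets (Px x) = sets M" for x using mf by (auto simp: markov_family_def)
  have sp: "space (Px x) = space M" for x by (rule sets_eq_imp_space_eq[OF sets])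
  have meas: "(\<lambda>x. emeasure (Px x) A) \<in> borel_measurable borel" if "A \<in> sets M" for A
    using mf that by (auto simp: markov_family_def)
  note Phi = measurable_process[OF mf]
  have pk: "prob_space (trans_kernel Px Phi t x)" if "0 \<le> t" for t x
    unfolding trans_kernel_def by (rule prob_space.prob_space_distr[OF prob Phi[OF that]])
  have kernel: "trans_kernel Px Phi t \<in> borel \<rightarrow>\<^sub>M prob_algebra borel" if t: "0 \<le> t" for t
  proof (rule measurable_prob_algebraI[OF pk[OF t]], rule measurable_subprob_algebra)
    show "subprob_space (trans_kernel Px Phi t x)" for x by (rule prob_space_imp_subprob_space[OF pk[OF t]])
    show "sets (trans_kernel Px Phi t x) = sets borel" for x by (simp add: trans_kernel_def)
    fix A :: "'a set" assume A: "A \<in> sets borel"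
    have "emeasure (trans_kernel Px Phi t x) A = emeasure (Px x) (Phi t -` A \<inter> space M)" for x
      unfolding trans_kernel_def by (subst emeasure_distr[OF Phi[OF t] A]) (simp add: sp)
    moreover have "Phi t -` A \<inter> space M \<in> sets M"
      using measurable_sets[OF Phi[OF t] A] by (simp add: sp sets)
    ultimately show "(\<lambda>x. emeasure (trans_kernel Px Phi t x) A) \<in> borel_measurable borel" using meas by simp
  qed
  have CK: "trans_kernel Px Phi (s + t) x = trans_kernel Px Phi s x \<bind> trans_kernel Px Phi t"
    if s: "0 \<le> s" and t: "0 \<le> t" for s t x
  proof (rule measure_eqI)
    have ps: "trans_kernel Px Phi s x \<in> borel_probs" by (rule measurable_space[OF kernel[OF s]]) simp
    show "sets (trans_kernel Px Phi (s + t) x) = sets (trans_kernel Px Phi s x \<bind> trans_kernel Px Phi t)"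
      by (simp add: sets_bind'[OF ps kernel[OF t]] trans_kernel_def)
    fix A assume "A \<in> sets (trans_kernel Px Phi (s + t) x)"
    then have A: "A \<in> sets borel" by (simp add: trans_kernel_def)
    interpret px: prob_space "Px x" by (rule prob)
    interpret pst: prob_space "trans_kernel Px Phi (s + t) x" by (rule pk) (use s t in simp)
    interpret pt: prob_space "trans_kernel Px Phi t y" for y by (rule pk[OF t])
    interpret Fs: sigma_algebra "space M" "F s" using mf s by (auto simp: markov_family_def)
    have sM: "space M \<in> F s" by (rule Fs.top)
    have gm: "(\<lambda>y. measure (trans_kernel Px Phi t y) A) \<in> borel_measurable borel"
      by (rule measurable_compose[OF kernel[OF t] measurable_measure_prob_algebra[OF A]])
    have st: "0 \<le> s + t" using s t by simp
    have "measure (trans_kernel Px Phi (s + t) x) A = measure (Px x) (Phi (s + t) -` A \<inter> space (Px x))"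
      unfolding trans_kernel_def by (rule measure_distr[OF Phi[OF st] A])
    also have "Phi (s + t) -` A \<inter> space (Px x) = {\<omega> \<in> space M. Phi (s + t) \<omega> \<in> A} \<inter> space M"
      by (auto simp: sp)
    also have "measure (Px x) \<dots> = (\<integral>\<omega>. indicator (space M) \<omega> * measure (trans_kernel Px Phi t (Phi s \<omega>)) A \<partial>Px x)"
      using mf s t A sM by (auto simp: markov_family_def)
    also have "\<dots> = (\<integral>\<omega>. measure (trans_kernel Px Phi t (Phi s \<omega>)) A \<partial>Px x)"
      by (intro Bochner_Integration.integral_cong) (auto simp: sp)
    finally have "emeasure (trans_kernel Px Phi (s + t) x) A = ennreal (\<integral>\<omega>. measure (trans_kernel Px Phi t (Phi s \<omega>)) A \<partial>Px x)"
      by (simp add: pst.emeasure_eq_measure)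
    also have "\<dots> = (\<integral>\<^sup>+\<omega>. ennreal (measure (trans_kernel Px Phi t (Phi s \<omega>)) A) \<partial>Px x)"
      by (intro nn_integral_eq_integral[symmetric] px.integrable_const_bound[where B=1]
          measurable_compose[OF Phi[OF s] gm]) auto
    also have "\<dots> = (\<integral>\<^sup>+y. emeasure (trans_kernel Px Phi t y) A \<partial>trans_kernel Px Phi s x)"
      unfolding trans_kernel_def[of Px Phi s x] pt.emeasure_eq_measure
      using gm by (subst nn_integral_distr[OF Phi[OF s]]) auto
    also have "\<dots> = emeasure (trans_kernel Px Phi s x \<bind> trans_kernel Px Phi t) A"
      by (rule emeasure_bind_prob_algebra[OF ps kernel[OF t] A, symmetric])
    finally show "emeasure (trans_kernel Px Phi (s + t) x) A
        = emeasure (trans_kernel Px Phi s x \<bind> trans_kernel Px Phi t) A" .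
  qed
  show ?thesis
    by standard (use kernel CK fe in \<open>auto simp: feller_def\<close>)
qed

theorem mainTheorem1:
  fixes M :: "'w measure" and F :: "real \<Rightarrow> 'w set set"
    and Phi :: "real \<Rightarrow> 'w \<Rightarrow> 'a::polish_space" and Px :: "'a \<Rightarrow> 'w measure"
    and FF :: "('a \<Rightarrow> real) set"
  assumes "cadlag_feller_markov M F Phi Px"
    and "FF \<subseteq> borel_measurable borel"
    and "Lb \<subseteq> FF"
    and "hyp_H1 Px Phi FF"
  shows "(asymptotically_stable Px Phi FF \<longleftrightarrow>
           ((\<forall>x. eventually_continuous_at Px Phi FF x) \<and> (\<exists>z. lower_bound_C1 Px Phi z)))
       \<and> (asymptotically_stable Px Phi FF \<longleftrightarrow>
           (\<exists>z. eventually_continuous_at Px Phi FF z \<and> lower_bound_C1 Px Phi z))"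
proof -
  interpret feller_semigroup "trans_kernel Px Phi" by (rule feller_semigroup_trans_kernel[OF assms(1)])
  have mf: "markov_family M F Phi Px" using assms(1) by (simp add: cadlag_feller_markov_def)
  have Pf: "Pf Px Phi t f x = T t f x" for t f x by (simp add: Pf_def T_def)
  have inv_iff: "invariant_prob Px Phi \<mu> \<longleftrightarrow> invariant \<mu>" for \<mu>
  proof (cases "\<mu> \<in> borel_probs")
    case True
    have "push \<mu> t = \<mu> \<longleftrightarrow> (\<forall>A\<in>sets borel. measure (push \<mu> t) A = measure \<mu> A)" if t: "0 \<le> t" for t
    proof
      interpret m: prob_space \<mu> by (rule borel_probsD[OF True])
      interpret p: prob_space "push \<mu> t" by (rule borel_probsD[OF push_prob[OF True t]])
      assume eq: "\<forall>A\<in>sets borel. measure (push \<mu> t) A = measure \<mu> A"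
      show "push \<mu> t = \<mu>"
        by (rule measure_eqI)
          (use eq borel_probsD(2)[OF True] borel_probsD(2)[OF push_prob[OF True t]] in
            \<open>auto simp: m.emeasure_eq_measure p.emeasure_eq_measure\<close>)
    qed simp
    then show ?thesis
      using True measure_push[OF True] borel_probsD[OF True] by (auto simp: invariant_prob_def invariant_def)
  next
    case False
    then show ?thesis by (auto simp: invariant_prob_def invariant_def space_prob_algebra)
  qed
  \<comment> \<open>Hypothesis \<open>hyp_H1\<close> is moved from the sample space to the state
    space by the change of variables along \<open>Phi t\<close>.\<close>
  have ui: "unif_integrable f (return borel x)" if f: "f \<in> FF" for f x
    unfolding unif_integrable_def
  proof (intro allI impI)
    fix e :: real assume "0 < e"
    have fm [measurable]: "f \<in> borel_measurable borel" using f assms(2) by blast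
    let ?S = "\<lambda>K::real. SUP t\<in>{0..}. (\<integral>\<^sup>+\<omega>. ennreal (\<bar>f (Phi t \<omega>)\<bar> * indicator {\<omega>. \<bar>f (Phi t \<omega>)\<bar> \<ge> K} \<omega>) \<partial>Px x)"
    have "(?S \<longlongrightarrow> 0) at_top" using assms(4) f by (auto simp: hyp_H1_def)
    from order_tendstoD(2)[OF this, of "ennreal e"] have "\<forall>\<^sub>F K in at_top. ?S K < ennreal e"
      using \<open>0 < e\<close> by simp
    then have "\<forall>\<^sub>F K in at_top. 0 \<le> K \<and> ?S K < ennreal e"
      using eventually_ge_at_top[of 0] by eventually_elim simp
    then obtain K where K: "0 \<le> K" "?S K < ennreal e"
      using eventually_happens'[OF trivial_limit_at_top_linorder] by blast
    have "tail_bound f K e (return borel x)"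
      unfolding tail_bound_def
    proof (intro allI impI)
      fix t :: real assume t: "0 \<le> t"
      have "(\<integral>\<^sup>+y. ennreal (\<bar>f y\<bar> * indicator {y. K \<le> \<bar>f y\<bar>} y) \<partial>push (return borel x) t)
          = (\<integral>\<^sup>+\<omega>. ennreal (\<bar>f (Phi t \<omega>)\<bar> * indicator {y. K \<le> \<bar>f y\<bar>} (Phi t \<omega>)) \<partial>Px x)"
        unfolding push_return[OF t] trans_kernel_def
        by (rule nn_integral_distr[OF measurable_process[OF mf t]]) measurable
      also have "\<dots> = (\<integral>\<^sup>+\<omega>. ennreal (\<bar>f (Phi t \<omega>)\<bar> * indicator {\<omega>. \<bar>f (Phi t \<omega>)\<bar> \<ge> K} \<omega>) \<partial>Px x)"
        by (intro nn_integral_cong) (simp add: indicator_def)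
      also have "\<dots> \<le> ?S K" using t by (intro SUP_upper) simp
      also have "\<dots> \<le> ennreal e" using K(2) by simp
      finally show "(\<integral>\<^sup>+y. ennreal (\<bar>f y\<bar> * indicator {y. K \<le> \<bar>f y\<bar>} y) \<partial>push (return borel x) t) \<le> ennreal e" .
    qed
    then show "\<exists>K\<ge>0. tail_bound f K e (return borel x)" using K(1) by blast
  qed
  have ev_contI: "ev_cont f z" if "eventually_continuous_at Px Phi FF z" "f \<in> FF" for f z
    unfolding ev_cont_def
  proof (intro allI impI)
    fix e :: real assume "0 < e"
    have "Limsup (nhds z) (\<lambda>x'. Limsup at_top (\<lambda>t. ereal \<bar>T t f x' - T t f z\<bar>)) < ereal e"
      using that \<open>0 < e\<close> by (simp add: eventually_continuous_at_def Pf)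
    from Limsup_lessD[OF this] obtain d where d: "0 < d"
      "\<And>w. dist w z < d \<Longrightarrow> Limsup at_top (\<lambda>t. ereal \<bar>T t f w - T t f z\<bar>) < ereal e"
      by (auto simp: eventually_nhds_metric)
    have "\<forall>\<^sub>F t in at_top. \<bar>T t f w - T t f z\<bar> < e" if "w \<in> ball z d" for w
      using Limsup_lessD[OF d(2)[of w]] that by (simp add: dist_commute)
    then show "\<exists>d>0. \<forall>w\<in>ball z d. \<forall>\<^sub>F t in at_top. \<bar>T t f w - T t f z\<bar> < e" using d(1) by blast
  qed
  have lower_boundI: "lower_bound z" if "lower_bound_C1 Px Phi z" for z
    unfolding lower_bound_def
  proof (intro allI impI)
    fix r :: real assume "0 < r"
    then have "0 < (INF x. Liminf at_top (\<lambda>t. ereal (measure (trans_kernel Px Phi t x) (ball z r))))"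
      using that by (simp add: lower_bound_C1_def)
    \<comment> \<open>A real number strictly between 0 and the infimum is chosen: strictness makes
      the bound hold eventually at every \<open>x\<close>.\<close>
    from ereal_dense2[OF this] obtain \<alpha> where \<alpha>: "0 < \<alpha>"
      "ereal \<alpha> < (INF x. Liminf at_top (\<lambda>t. ereal (measure (trans_kernel Px Phi t x) (ball z r))))" by auto
    have "\<forall>\<^sub>F t in at_top. \<alpha> \<le> measure (trans_kernel Px Phi t x) (ball z r)" for x
    proof -
      have "ereal \<alpha> < Liminf at_top (\<lambda>t. ereal (measure (trans_kernel Px Phi t x) (ball z r)))"
        using \<alpha>(2) by (rule less_le_trans) (rule INF_lower, simp)
      from less_LiminfD[OF this] show ?thesis by eventually_elim simp
    qed
    then show "\<exists>\<alpha>>0. \<forall>x. \<forall>\<^sub>F t in at_top. \<alpha> \<le> measure (trans_kernel Px Phi t x) (ball z r)"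
      using \<alpha>(1) by blast
  qed
  \<comment> \<open>This is (iii) to (i). The next block gives (i) to (ii), and (ii) contains
    (iii).\<close>
  have stable: "asymptotically_stable Px Phi FF"
    if z: "eventually_continuous_at Px Phi FF z" "lower_bound_C1 Px Phi z" for z
  proof -
    have lb: "lower_bound z" by (rule lower_boundI[OF z(2)])
    have ecL: "ev_cont f z" if "f \<in> Lb" for f using ev_contI[OF z(1)] assms(3) that by blast
    obtain \<mu> where \<mu>: "invariant \<mu>" using exists_invariant[OF lb ecL] by blast
    have fm: "f \<in> borel_measurable borel" if "f \<in> FF" for f using assms(2) that by blast
    show ?thesis
      unfolding asymptotically_stable_def inv_iff Pf
    proof (intro exI[of _ \<mu>] conjI allI ballI impI)
      show "invariant \<mu>" by (rule \<mu>)
      show "\<nu> = \<mu>" if "invariant \<nu>" for \<nu> by (rule unique_invariant[OF lb ecL that \<mu>])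
      show "integrable \<mu> f" if "f \<in> FF" for f
        by (rule invariant_integrable[OF lb ecL \<mu> fm[OF that] ui[OF that]])
      show "((\<lambda>t. \<bar>T t f x - (\<integral>y. f y \<partial>\<mu>)\<bar>) \<longlongrightarrow> 0) at_top" if f: "f \<in> FF" for x f
        using convergence_unif_integrable[OF lb ecL \<mu> fm[OF f] ui[OF f] ev_contI[OF z(1) f], of x]
        by (intro tendsto_rabs_zero) (rule LIM_zero)
    qed
  qed
  have necessary: "(\<forall>x. eventually_continuous_at Px Phi FF x) \<and> (\<exists>z. lower_bound_C1 Px Phi z)"
    if as: "asymptotically_stable Px Phi FF"
  proof -
    obtain \<mu> where \<mu>: "invariant \<mu>"
      and lim: "\<And>x f. f \<in> FF \<Longrightarrow> ((\<lambda>t. \<bar>T t f x - (\<integral>y. f y \<partial>\<mu>)\<bar>) \<longlongrightarrow> 0) at_top"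
      using as unfolding asymptotically_stable_def inv_iff Pf by blast
    have lim': "((\<lambda>t. T t f x) \<longlongrightarrow> (\<integral>y. f y \<partial>\<mu>)) at_top" if "f \<in> FF" for x f
      using tendsto_rabs_zero_cancel[OF lim[OF that, of x]] by (rule LIM_zero_cancel)
    have "eventually_continuous_at Px Phi FF x" for x
      unfolding eventually_continuous_at_def Pf
    proof
      fix f assume f: "f \<in> FF"
      \<comment> \<open>Both terms converge to the same \<open>\<mu>\<close>-integral, so the inner
        upper limit is 0 for every \<open>x'\<close>, near \<open>x\<close> or not.\<close>
      have "Limsup at_top (\<lambda>t. ereal \<bar>T t f x' - T t f x\<bar>) = 0" for x'
      proof -
        have "((\<lambda>t. \<bar>T t f x' - T t f x\<bar>) \<longlongrightarrow> \<bar>(\<integral>y. f y \<partial>\<mu>) - (\<integral>y. f y \<partial>\<mu>)\<bar>) at_top"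
          by (intro tendsto_rabs tendsto_diff lim' f)
        then have "((\<lambda>t. ereal \<bar>T t f x' - T t f x\<bar>) \<longlongrightarrow> ereal 0) at_top"
          by (intro tendsto_ereal) simp
        from lim_imp_Limsup[OF _ this] show ?thesis by (simp add: zero_ereal_def)
      qed
      then show "Limsup (nhds x) (\<lambda>x'. Limsup at_top (\<lambda>t. ereal \<bar>T t f x' - T t f x\<bar>)) = 0"
        by (simp add: Limsup_const)
    qed
    moreover have "\<exists>z. lower_bound_C1 Px Phi z"
    proof -
      have \<mu>p: "\<mu> \<in> borel_probs" using \<mu> by (simp add: invariant_def)
      interpret m: prob_space \<mu> by (rule borel_probsD[OF \<mu>p])
      \<comment> \<open>\<open>z\<close> is any point of the support of
        \<open>\<mu>\<close>.\<close>
      obtain z where z: "\<And>r. 0 < r \<Longrightarrow> 0 < measure \<mu> (ball z r)"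
        using eventually_happens[OF AE_not_in_null_ball[OF \<mu>p]] m.ae_filter_bot by blast
      have "0 < (INF x. Liminf at_top (\<lambda>t. ereal (measure (trans_kernel Px Phi t x) (ball z r))))" if r: "0 < r" for r
      proof -
        \<comment> \<open>A Lipschitz minorant of the indicator of the ball: its limit, the
          \<open>\<mu>\<close>-integral of \<open>h\<close>, is the same for all starting points,
          which gives the uniform lower bound.\<close>
        obtain h where h: "h \<in> Lb" and h01: "\<And>x. 0 \<le> h x" "\<And>x. h x \<le> 1"
          and h1: "\<And>x. x \<in> ball z (r / 2) \<Longrightarrow> h x = 1" and h0: "\<And>x. x \<notin> ball z r \<Longrightarrow> h x = 0"
          by (rule ball_cutoff[OF r]) blast
        have "(\<integral>x. indicator (ball z (r / 2)) x \<partial>\<mu>) \<le> (\<integral>x. h x \<partial>\<mu>)"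
        proof (rule integral_mono)
          show "integrable \<mu> (indicator (ball z (r / 2)) :: 'a \<Rightarrow> real)"
            by (rule integrable_bounded_prob[OF \<mu>p borel_measurable_indicator, where B=1]) (simp_all add: indicator_def)
          show "integrable \<mu> h" by (rule Lb_integrable[OF h borel_probsD(4,2)[OF \<mu>p]])
          show "indicator (ball z (r / 2)) x \<le> h x" for x using h01[of x] h1[of x] by (auto simp: indicator_def)
        qed
        then have "measure \<mu> (ball z (r / 2)) \<le> (\<integral>x. h x \<partial>\<mu>)" by (simp add: borel_probsD(3)[OF \<mu>p])
        then have c: "0 < (\<integral>x. h x \<partial>\<mu>)" using z[of "r / 2"] r by simp
        have "ereal (\<integral>x. h x \<partial>\<mu>) \<le> Liminf at_top (\<lambda>t. ereal (measure (trans_kernel Px Phi t x) (ball z r)))" for x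
        proof -
          have "((\<lambda>t. ereal (T t h x)) \<longlongrightarrow> ereal (\<integral>x. h x \<partial>\<mu>)) at_top"
            using h assms(3) by (intro tendsto_ereal lim') blast
          then have "ereal (\<integral>x. h x \<partial>\<mu>) = Liminf at_top (\<lambda>t. ereal (T t h x))"
            by (intro lim_imp_Liminf[symmetric]) auto
          also have "\<dots> \<le> Liminf at_top (\<lambda>t. ereal (measure (trans_kernel Px Phi t x) (ball z r)))"
          proof (rule Liminf_mono)
            show "\<forall>\<^sub>F t in at_top. ereal (T t h x) \<le> ereal (measure (trans_kernel Px Phi t x) (ball z r))"
              using eventually_ge_at_top[of 0]
            proof eventually_elim
              case (elim t)
              then show ?case using h01 h0 T_le_measure[of t "ball z r" x h] Lb_integrable_P[OF h] by auto
            qed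
          qed
          finally show ?thesis .
        qed
        then have "ereal (\<integral>x. h x \<partial>\<mu>) \<le> (INF x. Liminf at_top (\<lambda>t. ereal (measure (trans_kernel Px Phi t x) (ball z r))))"
          by (intro INF_greatest) auto
        moreover have "0 < ereal (\<integral>x. h x \<partial>\<mu>)" using c by simp
        ultimately show ?thesis by (rule less_le_trans[rotated])
      qed
      then show ?thesis by (auto simp: lower_bound_C1_def)
    qed
    ultimately show ?thesis by blast
  qed
  show ?thesis using stable necessary by blast
qed

end
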